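(* Let $A$ be a commutative ring with unity and $\mathfrak{a}$ an ideal of $A$. (1) The functor $\Gamma_{\mathfrak{a}}: \mathrm{C}(A)_{\mathfrak{a}\text{-red}}\rightarrow \mathrm{C}(A)_{\mathfrak{a}\text{-cor}}$, $M\mapsto \Gamma_{\mathfrak{a}}(M)$, is idempotent, and $\Gamma_{\mathfrak{a}}(M)\cong \mathrm{Hom}_{A}(A/\mathfrak{a},M)$ for any $\mathfrak{a}$-reduced complex $M$. (2) The functor $\Lambda_{\mathfrak{a}}: \mathrm{C}(A)_{\mathfrak{a}\text{-cor}}\rightarrow \mathrm{C}(A)_{\mathfrak{a}\text{-red}}$, $M\mapsto \Lambda_{\mathfrak{a}}(M)$, is idempotent, and $\Lambda_{\mathfrak{a}}(M)\cong A/\mathfrak{a}\otimes_{A} M$ for any $\mathfrak{a}$-coreduced complex $M$. (3) For any $M\in \mathrm{C}(A)_{\mathfrak{a}\text{-cor}}$ and any $N\in \mathrm{C}(A)_{\mathfrak{a}\text{-red}}$, $\mathrm{Hom}_{A}(\Lambda_{\mathfrak{a}}(M),N)\cong \mathrm{Hom}_{A}(M,\Gamma_{\mathfrak{a}}(N))$.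
   Context: $\mathrm{C}(A)$ is the category of chain complexes $M=(M^n,d_M^n)_{n\in\mathbb{Z}}$ of $A$-modules; $\cong$ between complexes means isomorphism in $\mathrm{C}(A)$ (a morphism of complexes that is an isomorphism in each degree). $\mathrm{Hom}_A(M,N)$ and $M\otimes_A N$ denote the usual Hom complex (degree $n$ part $\prod_{j-i=n}\mathrm{Hom}_A(M^i,N^j)$) and tensor product complex (degree $n$ part $\bigoplus_{i+j=n}M^i\otimes_A N^j$), with $A/\mathfrak{a}$ viewed as a complex concentrated in degree $0$. For $A$-modules, $\Gamma_{\mathfrak{a}}(-)=\varinjlim_k \mathrm{Hom}_A(A/\mathfrak{a}^k,-)$ (the $\mathfrak{a}$-torsion functor) and $\Lambda_{\mathfrak{a}}(-)=\varprojlim_k (A/\mathfrak{a}^k\otimes_A -)$ (the $\mathfrak{a}$-adic completion functor); both are applied degreewise to complexes. An $A$-module $M$ is $\mathfrak{a}$-reduced if for all $m\in M$, $\mathfrak{a}^2m=0$ implies $\mathfrak{a}m=0$; it is $\mathfrak{a}$-coreduced if $\mathfrak{a}M=\mathfrak{a}^2M$. A complex is $\mathfrak{a}$-reduced (resp. $\mathfrak{a}$-coreduced) if each of its modules is. $\mathrm{C}(A)_{\mathfrak{a}\text{-red}}$ and $\mathrm{C}(A)_{\mathfrak{a}\text{-cor}}$ are the full subcategories of $\mathrm{C}(A)$ of $\mathfrak{a}$-reduced, resp. $\mathfrak{a}$-coreduced, complexes. A functor $F$ (here $\Gamma_{\mathfrak{a}}$ or $\Lambda_{\mathfrak{a}}$)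 is idempotent if $F(F(M))\cong F(M)$ for every $M$ in its domain. *)

theory Defs
  imports HOL.Hull "HOL-Algebra.Module" "HOL-Algebra.QuotRing" "HOL-Algebra.Ideal_Product"
begin

section \<open>Modules\<close>

text \<open>
  Modules are those of the locale \<^locale>\<open>module\<close>; the fields \<^const>\<open>mult\<close> and \<^const>\<open>one\<close> of the
  record play no role there and are left undefined in the constructions below.
  A linear map is represented by an extensional function (undefined outside the carrier of its
  source), so that equality of linear maps is equality of functions.
\<close>

definition mod_hom :: "'a ring \<Rightarrow> ('a, 'm) module \<Rightarrow> ('a, 'n) module \<Rightarrow> ('m \<Rightarrow> 'n) set" where
  "mod_hom R M N =
    {f \<in> carrier M \<rightarrow>\<^sub>E carrier N.
      (\<forall>x\<in>carrier M. \<forall>y\<in>carrier M. f (x \<oplus>\<^bsub>M\<^esub> y) = f x \<oplus>\<^bsub>N\<^esub> f y) \<and>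
      (\<forall>r\<in>carrier R. \<forall>x\<in>carrier M. f (r \<odot>\<^bsub>M\<^esub> x) = r \<odot>\<^bsub>N\<^esub> f x)}"

definition Hom_mod :: "'a ring \<Rightarrow> ('a, 'm) module \<Rightarrow> ('a, 'n) module \<Rightarrow> ('a, 'm \<Rightarrow> 'n) module" where
  "Hom_mod R M N =
    \<lparr>carrier = mod_hom R M N, mult = undefined, one = undefined,
     zero = (\<lambda>x\<in>carrier M. \<zero>\<^bsub>N\<^esub>),
     add = (\<lambda>f g. \<lambda>x\<in>carrier M. f x \<oplus>\<^bsub>N\<^esub> g x),
     smult = (\<lambda>r f. \<lambda>x\<in>carrier M. r \<odot>\<^bsub>N\<^esub> f x)\<rparr>"

definition span_mod :: "'a ring \<Rightarrow> ('a, 'm) module \<Rightarrow> 'm set \<Rightarrow> 'm set" where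
  "span_mod R M S = (\<lambda>H. submodule H R M) hull S"

definition quot_mod :: "'a ring \<Rightarrow> ('a, 'm) module \<Rightarrow> 'm set \<Rightarrow> ('a, 'm set) module" where
  "quot_mod R M H =
    \<lparr>carrier = a_rcosets\<^bsub>M\<^esub> H, mult = undefined, one = undefined,
     zero = H,
     add = set_add M,
     smult = (\<lambda>r X. \<Union>x\<in>X. H +>\<^bsub>M\<^esub> (r \<odot>\<^bsub>M\<^esub> x))\<rparr>"

text \<open>The quotient ring \<open>R/J\<close>, regarded as an \<open>R\<close>-module.\<close>

definition quot_ring_mod :: "'a ring \<Rightarrow> 'a set \<Rightarrow> ('a, 'a set) module" where
  "quot_ring_mod R J =
    ring.extend (R Quot J) (module.fields (\<lambda>r X. (J +>\<^bsub>R\<^esub> r) \<otimes>\<^bsub>R Quot J\<^esub> X))"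

text \<open>
  If \<open>J' \<subseteq> J\<close>, this sends the coset \<open>J' + x\<close> to \<open>J + (J' + x) = J + x\<close>, i.e. it is the
  canonical projection \<open>R/J' \<rightarrow> R/J\<close>.
\<close>

definition quot_proj :: "'a ring \<Rightarrow> 'a set \<Rightarrow> 'a set \<Rightarrow> 'a set" where
  "quot_proj R J X = J <+>\<^bsub>R\<^esub> X"

definition prod_mod :: "('i \<Rightarrow> ('a, 'm) module) \<Rightarrow> ('a, 'i \<Rightarrow> 'm) module" where
  "prod_mod F =
    \<lparr>carrier = {x. \<forall>i. x i \<in> carrier (F i)}, mult = undefined, one = undefined,
     zero = (\<lambda>i. \<zero>\<^bsub>F i\<^esub>),
     add = (\<lambda>x y i. x i \<oplus>\<^bsub>F i\<^esub> y i),
     smult = (\<lambda>r x i. r \<odot>\<^bsub>F i\<^esub> x i)\<rparr>"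

definition dsum_mod :: "('i \<Rightarrow> ('a, 'm) module) \<Rightarrow> ('a, 'i \<Rightarrow> 'm) module" where
  "dsum_mod F =
    (prod_mod F)\<lparr>carrier := {x \<in> carrier (prod_mod F). finite {i. x i \<noteq> \<zero>\<^bsub>F i\<^esub>}}\<rparr>"

subsection \<open>Tensor products\<close>

text \<open>
  \<open>M \<otimes>\<^sub>R N\<close> is the free \<open>R\<close>-module on \<open>M \<times> N\<close> modulo the submodule generated by the
  bilinearity relations.
\<close>

definition free_mod :: "'a ring \<Rightarrow> 'p set \<Rightarrow> ('a, 'p \<Rightarrow> 'a) module" where
  "free_mod R S =
    \<lparr>carrier = {w. (\<forall>p. w p \<in> carrier R) \<and> finite {p. w p \<noteq> \<zero>\<^bsub>R\<^esub>} \<and> {p. w p \<noteq> \<zero>\<^bsub>R\<^esub>} \<subseteq> S},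
     mult = undefined, one = undefined,
     zero = (\<lambda>p. \<zero>\<^bsub>R\<^esub>),
     add = (\<lambda>v w p. v p \<oplus>\<^bsub>R\<^esub> w p),
     smult = (\<lambda>r w p. r \<otimes>\<^bsub>R\<^esub> w p)\<rparr>"

definition free_gen :: "'a ring \<Rightarrow> 'p \<Rightarrow> 'p \<Rightarrow> 'a" where
  "free_gen R p = (\<lambda>q. if q = p then \<one>\<^bsub>R\<^esub> else \<zero>\<^bsub>R\<^esub>)"

definition tensor_rel :: "'a ring \<Rightarrow> ('a, 'm) module \<Rightarrow> ('a, 'n) module \<Rightarrow> ('m \<times> 'n \<Rightarrow> 'a) set" where
  "tensor_rel R M N =
    (let F = free_mod R (carrier M \<times> carrier N); e = free_gen R in
     span_mod R F
      ({e (x \<oplus>\<^bsub>M\<^esub> x', y) \<ominus>\<^bsub>F\<^esub> (e (x, y) \<oplus>\<^bsub>F\<^esub> e (x', y)) | x x' y.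
          x \<in> carrier M \<and> x' \<in> carrier M \<and> y \<in> carrier N} \<union>
       {e (x, y \<oplus>\<^bsub>N\<^esub> y') \<ominus>\<^bsub>F\<^esub> (e (x, y) \<oplus>\<^bsub>F\<^esub> e (x, y')) | x y y'.
          x \<in> carrier M \<and> y \<in> carrier N \<and> y' \<in> carrier N} \<union>
       {e (r \<odot>\<^bsub>M\<^esub> x, y) \<ominus>\<^bsub>F\<^esub> (r \<odot>\<^bsub>F\<^esub> e (x, y)) | r x y.
          r \<in> carrier R \<and> x \<in> carrier M \<and> y \<in> carrier N} \<union>
       {e (x, r \<odot>\<^bsub>N\<^esub> y) \<ominus>\<^bsub>F\<^esub> (r \<odot>\<^bsub>F\<^esub> e (x, y)) | r x y.
          r \<in> carrier R \<and> x \<in> carrier M \<and> y \<in> carrier N}))"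

definition tensor_mod ::
    "'a ring \<Rightarrow> ('a, 'm) module \<Rightarrow> ('a, 'n) module \<Rightarrow> ('a, ('m \<times> 'n \<Rightarrow> 'a) set) module" where
  "tensor_mod R M N = quot_mod R (free_mod R (carrier M \<times> carrier N)) (tensor_rel R M N)"

definition pure_tensor ::
    "'a ring \<Rightarrow> ('a, 'm) module \<Rightarrow> ('a, 'n) module \<Rightarrow> 'm \<Rightarrow> 'n \<Rightarrow> ('m \<times> 'n \<Rightarrow> 'a) set" where
  "pure_tensor R M N x y =
    tensor_rel R M N +>\<^bsub>free_mod R (carrier M \<times> carrier N)\<^esub> free_gen R (x, y)"

text \<open>
  \<open>f \<otimes> g : M \<otimes> N \<rightarrow> M' \<otimes> N'\<close>, the unique linear map sending \<open>x \<otimes> y\<close> to \<open>f x \<otimes> g y\<close>.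
\<close>

definition tensor_map ::
    "'a ring \<Rightarrow> ('a, 'm) module \<Rightarrow> ('a, 'n) module \<Rightarrow> ('a, 'm') module \<Rightarrow> ('a, 'n') module
      \<Rightarrow> ('m \<Rightarrow> 'm') \<Rightarrow> ('n \<Rightarrow> 'n') \<Rightarrow> ('m \<times> 'n \<Rightarrow> 'a) set \<Rightarrow> ('m' \<times> 'n' \<Rightarrow> 'a) set" where
  "tensor_map R M N M' N' f g =
    (THE h. h \<in> mod_hom R (tensor_mod R M N) (tensor_mod R M' N') \<and>
      (\<forall>x\<in>carrier M. \<forall>y\<in>carrier N.
        h (pure_tensor R M N x y) = pure_tensor R M' N' (f x) (g y)))"

subsection \<open>Sequential limits\<close>

text \<open>
  Direct limit of a direct system \<open>t k l : G k \<rightarrow> G l\<close> (\<open>k \<le> l\<close>): elements are the equivalence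
  classes of pairs \<open>(k, x)\<close> with \<open>x \<in> G k\<close>, two pairs being equivalent if they become equal
  at some later stage.
\<close>

definition dlim_class ::
    "(nat \<Rightarrow> ('a, 'g) module) \<Rightarrow> (nat \<Rightarrow> nat \<Rightarrow> 'g \<Rightarrow> 'g) \<Rightarrow> nat \<times> 'g \<Rightarrow> (nat \<times> 'g) set" where
  "dlim_class G t = (\<lambda>(k, x).
    {(l, y). y \<in> carrier (G l) \<and> (\<exists>m. k \<le> m \<and> l \<le> m \<and> t k m x = t l m y)})"

definition dlim_mod ::
    "(nat \<Rightarrow> ('a, 'g) module) \<Rightarrow> (nat \<Rightarrow> nat \<Rightarrow> 'g \<Rightarrow> 'g) \<Rightarrow> ('a, (nat \<times> 'g) set) module" where
  "dlim_mod G t =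
    \<lparr>carrier = {dlim_class G t (k, x) | k x. x \<in> carrier (G k)},
     mult = undefined, one = undefined,
     zero = dlim_class G t (0, \<zero>\<^bsub>G 0\<^esub>),
     add = (\<lambda>X Y. \<Union>(k, x)\<in>X. \<Union>(l, y)\<in>Y.
       dlim_class G t (max k l, t k (max k l) x \<oplus>\<^bsub>G (max k l)\<^esub> t l (max k l) y)),
     smult = (\<lambda>r X. \<Union>(k, x)\<in>X. dlim_class G t (k, r \<odot>\<^bsub>G k\<^esub> x))\<rparr>"

text \<open>Inverse limit of an inverse system \<open>p k l : G l \<rightarrow> G k\<close> (\<open>k \<le> l\<close>).\<close>

definition ilim_mod ::
    "(nat \<Rightarrow> ('a, 'g) module) \<Rightarrow> (nat \<Rightarrow> nat \<Rightarrow> 'g \<Rightarrow> 'g) \<Rightarrow> ('a, nat \<Rightarrow> 'g) module" where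
  "ilim_mod G p =
    (prod_mod G)\<lparr>carrier :=
      {x \<in> carrier (prod_mod G). \<forall>k l. k \<le> l \<longrightarrow> p k l (x l) = x k}\<rparr>"

subsection \<open>Torsion and completion of modules\<close>

abbreviation ideal_pow :: "'a ring \<Rightarrow> 'a set \<Rightarrow> nat \<Rightarrow> 'a set" where
  "ideal_pow R I k \<equiv> I [^]\<^bsub>ideals_set R\<^esub> k"

text \<open>
  The index \<open>k\<close> runs over all natural numbers, with \<open>I\<^sup>0 = R\<close>; the term at \<open>k = 0\<close> is a
  zero module and affects neither limit.
\<close>

definition tors_system :: "'a ring \<Rightarrow> 'a set \<Rightarrow> ('a, 'm) module \<Rightarrow> nat \<Rightarrow> ('a, 'a set \<Rightarrow> 'm) module" where
  "tors_system R I M k = Hom_mod R (quot_ring_mod R (ideal_pow R I k)) M"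

definition tors_trans :: "'a ring \<Rightarrow> 'a set \<Rightarrow> nat \<Rightarrow> nat \<Rightarrow> ('a set \<Rightarrow> 'm) \<Rightarrow> 'a set \<Rightarrow> 'm" where
  "tors_trans R I k l h =
    (\<lambda>X\<in>carrier (quot_ring_mod R (ideal_pow R I l)). h (quot_proj R (ideal_pow R I k) X))"

definition tors_mod :: "'a ring \<Rightarrow> 'a set \<Rightarrow> ('a, 'm) module \<Rightarrow> ('a, (nat \<times> ('a set \<Rightarrow> 'm)) set) module" where
  "tors_mod R I M = dlim_mod (tors_system R I M) (tors_trans R I)"

definition tors_map ::
    "'a ring \<Rightarrow> 'a set \<Rightarrow> ('a, 'm) module \<Rightarrow> ('a, 'n) module \<Rightarrow> ('m \<Rightarrow> 'n)
      \<Rightarrow> (nat \<times> ('a set \<Rightarrow> 'm)) set \<Rightarrow> (nat \<times> ('a set \<Rightarrow> 'n)) set" where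
  "tors_map R I M N f =
    (\<lambda>X\<in>carrier (tors_mod R I M). \<Union>(k, h)\<in>X.
      dlim_class (tors_system R I N) (tors_trans R I)
        (k, compose (carrier (quot_ring_mod R (ideal_pow R I k))) f h))"

definition compl_system ::
    "'a ring \<Rightarrow> 'a set \<Rightarrow> ('a, 'm) module \<Rightarrow> nat \<Rightarrow> ('a, ('a set \<times> 'm \<Rightarrow> 'a) set) module" where
  "compl_system R I M k = tensor_mod R (quot_ring_mod R (ideal_pow R I k)) M"

definition compl_trans ::
    "'a ring \<Rightarrow> 'a set \<Rightarrow> ('a, 'm) module \<Rightarrow> nat \<Rightarrow> nat
      \<Rightarrow> ('a set \<times> 'm \<Rightarrow> 'a) set \<Rightarrow> ('a set \<times> 'm \<Rightarrow> 'a) set" where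
  "compl_trans R I M k l =
    tensor_map R (quot_ring_mod R (ideal_pow R I l)) M (quot_ring_mod R (ideal_pow R I k)) M
      (quot_proj R (ideal_pow R I k)) id"

definition compl_mod ::
    "'a ring \<Rightarrow> 'a set \<Rightarrow> ('a, 'm) module \<Rightarrow> ('a, nat \<Rightarrow> ('a set \<times> 'm \<Rightarrow> 'a) set) module" where
  "compl_mod R I M = ilim_mod (compl_system R I M) (compl_trans R I M)"

definition compl_map ::
    "'a ring \<Rightarrow> 'a set \<Rightarrow> ('a, 'm) module \<Rightarrow> ('a, 'n) module \<Rightarrow> ('m \<Rightarrow> 'n)
      \<Rightarrow> (nat \<Rightarrow> ('a set \<times> 'm \<Rightarrow> 'a) set) \<Rightarrow> nat \<Rightarrow> ('a set \<times> 'n \<Rightarrow> 'a) set" where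
  "compl_map R I M N f =
    (\<lambda>x\<in>carrier (compl_mod R I M). \<lambda>k.
      tensor_map R (quot_ring_mod R (ideal_pow R I k)) M (quot_ring_mod R (ideal_pow R I k)) N
        id f (x k))"

subsection \<open>Reduced and coreduced modules\<close>

definition reduced_mod :: "'a ring \<Rightarrow> 'a set \<Rightarrow> ('a, 'm) module \<Rightarrow> bool" where
  "reduced_mod R I M \<longleftrightarrow>
    (\<forall>m\<in>carrier M. (\<forall>x\<in>ideal_pow R I 2. x \<odot>\<^bsub>M\<^esub> m = \<zero>\<^bsub>M\<^esub>) \<longrightarrow> (\<forall>x\<in>I. x \<odot>\<^bsub>M\<^esub> m = \<zero>\<^bsub>M\<^esub>))"

definition ideal_smult :: "'a ring \<Rightarrow> 'a set \<Rightarrow> ('a, 'm) module \<Rightarrow> 'm set" where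
  "ideal_smult R J M = span_mod R M {x \<odot>\<^bsub>M\<^esub> m | x m. x \<in> J \<and> m \<in> carrier M}"

definition coreduced_mod :: "'a ring \<Rightarrow> 'a set \<Rightarrow> ('a, 'm) module \<Rightarrow> bool" where
  "coreduced_mod R I M \<longleftrightarrow> ideal_smult R I M = ideal_smult R (ideal_pow R I 2) M"

section \<open>Complexes\<close>

text \<open>Complexes are indexed cohomologically: the differential maps degree \<open>n\<close> to degree \<open>n + 1\<close>.\<close>

record ('a, 'm) cpx =
  obj :: "int \<Rightarrow> ('a, 'm) module"
  diff :: "int \<Rightarrow> 'm \<Rightarrow> 'm"

definition complexes :: "'a ring \<Rightarrow> ('a, 'm) cpx set" where
  "complexes R =
    {M. (\<forall>n. module R (obj M n)) \<and>
        (\<forall>n. diff M n \<in> mod_hom R (obj M n) (obj M (n + 1))) \<and>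
        (\<forall>n. \<forall>x\<in>carrier (obj M n). diff M (n + 1) (diff M n x) = \<zero>\<^bsub>obj M (n + 1 + 1)\<^esub>)}"

definition chain_maps :: "'a ring \<Rightarrow> ('a, 'm) cpx \<Rightarrow> ('a, 'n) cpx \<Rightarrow> (int \<Rightarrow> 'm \<Rightarrow> 'n) set" where
  "chain_maps R M N =
    {f. (\<forall>n. f n \<in> mod_hom R (obj M n) (obj N n)) \<and>
        (\<forall>n. \<forall>x\<in>carrier (obj M n). diff N n (f n x) = f (n + 1) (diff M n x))}"

definition chain_id :: "('a, 'm) cpx \<Rightarrow> int \<Rightarrow> 'm \<Rightarrow> 'm" where
  "chain_id M = (\<lambda>n. \<lambda>x\<in>carrier (obj M n). x)"

definition chain_comp ::
    "('a, 'm) cpx \<Rightarrow> (int \<Rightarrow> 'n \<Rightarrow> 'p) \<Rightarrow> (int \<Rightarrow> 'm \<Rightarrow> 'n) \<Rightarrow> int \<Rightarrow> 'm \<Rightarrow> 'p" where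
  "chain_comp M g f = (\<lambda>n. compose (carrier (obj M n)) (g n) (f n))"

definition cpx_iso :: "'a ring \<Rightarrow> ('a, 'm) cpx \<Rightarrow> ('a, 'n) cpx \<Rightarrow> bool" where
  "cpx_iso R M N \<longleftrightarrow>
    M \<in> complexes R \<and> N \<in> complexes R \<and>
    (\<exists>f\<in>chain_maps R M N. \<forall>n. bij_betw (f n) (carrier (obj M n)) (carrier (obj N n)))"

text \<open>
  A functor between the full subcategories of complexes with object classes \<open>\<C>\<close> and \<open>\<D>\<close>,
  with object part \<open>F\<close> and morphism part \<open>\<phi> M N\<close> on chain maps \<open>M \<rightarrow> N\<close>.
\<close>

definition cpx_functor ::
    "'a ring \<Rightarrow> ('a, 'm) cpx set \<Rightarrow> ('a, 'n) cpx set \<Rightarrow> (('a, 'm) cpx \<Rightarrow> ('a, 'n) cpx)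
      \<Rightarrow> (('a, 'm) cpx \<Rightarrow> ('a, 'm) cpx \<Rightarrow> (int \<Rightarrow> 'm \<Rightarrow> 'm) \<Rightarrow> int \<Rightarrow> 'n \<Rightarrow> 'n) \<Rightarrow> bool" where
  "cpx_functor R \<C> \<D> F \<phi> \<longleftrightarrow>
    (\<forall>M\<in>\<C>. F M \<in> \<D>) \<and>
    (\<forall>M\<in>\<C>. \<forall>N\<in>\<C>. \<forall>f\<in>chain_maps R M N. \<phi> M N f \<in> chain_maps R (F M) (F N)) \<and>
    (\<forall>M\<in>\<C>. \<phi> M M (chain_id M) = chain_id (F M)) \<and>
    (\<forall>L\<in>\<C>. \<forall>M\<in>\<C>. \<forall>N\<in>\<C>. \<forall>f\<in>chain_maps R L M. \<forall>g\<in>chain_maps R M N.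
      \<phi> L N (chain_comp L g f) = chain_comp (F L) (\<phi> M N g) (\<phi> L M f))"

definition red_complexes :: "'a ring \<Rightarrow> 'a set \<Rightarrow> ('a, 'm) cpx set" where
  "red_complexes R I = {M \<in> complexes R. \<forall>n. reduced_mod R I (obj M n)}"

definition cor_complexes :: "'a ring \<Rightarrow> 'a set \<Rightarrow> ('a, 'm) cpx set" where
  "cor_complexes R I = {M \<in> complexes R. \<forall>n. coreduced_mod R I (obj M n)}"

subsection \<open>Torsion and completion of complexes\<close>

definition Gamma :: "'a ring \<Rightarrow> 'a set \<Rightarrow> ('a, 'm) cpx \<Rightarrow> ('a, (nat \<times> ('a set \<Rightarrow> 'm)) set) cpx" where
  "Gamma R I M =
    \<lparr>obj = (\<lambda>n. tors_mod R I (obj M n)),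
     diff = (\<lambda>n. tors_map R I (obj M n) (obj M (n + 1)) (diff M n))\<rparr>"

definition Gamma_map ::
    "'a ring \<Rightarrow> 'a set \<Rightarrow> ('a, 'm) cpx \<Rightarrow> ('a, 'n) cpx \<Rightarrow> (int \<Rightarrow> 'm \<Rightarrow> 'n)
      \<Rightarrow> int \<Rightarrow> (nat \<times> ('a set \<Rightarrow> 'm)) set \<Rightarrow> (nat \<times> ('a set \<Rightarrow> 'n)) set" where
  "Gamma_map R I M N f = (\<lambda>n. tors_map R I (obj M n) (obj N n) (f n))"

definition Lambda :: "'a ring \<Rightarrow> 'a set \<Rightarrow> ('a, 'm) cpx \<Rightarrow> ('a, nat \<Rightarrow> ('a set \<times> 'm \<Rightarrow> 'a) set) cpx" where
  "Lambda R I M =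
    \<lparr>obj = (\<lambda>n. compl_mod R I (obj M n)),
     diff = (\<lambda>n. compl_map R I (obj M n) (obj M (n + 1)) (diff M n))\<rparr>"

definition Lambda_map ::
    "'a ring \<Rightarrow> 'a set \<Rightarrow> ('a, 'm) cpx \<Rightarrow> ('a, 'n) cpx \<Rightarrow> (int \<Rightarrow> 'm \<Rightarrow> 'n)
      \<Rightarrow> int \<Rightarrow> (nat \<Rightarrow> ('a set \<times> 'm \<Rightarrow> 'a) set) \<Rightarrow> nat \<Rightarrow> ('a set \<times> 'n \<Rightarrow> 'a) set" where
  "Lambda_map R I M N f = (\<lambda>n. compl_map R I (obj M n) (obj N n) (f n))"

subsection \<open>Hom and tensor complexes\<close>

definition concentrated :: "('a, 'm) module \<Rightarrow> ('a, 'm) cpx" where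
  "concentrated X =
    (let C = (\<lambda>n::int. if n = 0 then X else X\<lparr>carrier := {\<zero>\<^bsub>X\<^esub>}\<rparr>) in
     \<lparr>obj = C, diff = (\<lambda>n. \<lambda>x\<in>carrier (C n). \<zero>\<^bsub>X\<^esub>)\<rparr>)"

definition signed :: "('a, 'm) module \<Rightarrow> int \<Rightarrow> 'm \<Rightarrow> 'm" where
  "signed M n x = (if even n then x else \<ominus>\<^bsub>M\<^esub> x)"

text \<open>
  The factor \<open>Hom(M\<^sup>i, N\<^sup>j)\<close> in degree \<open>n = j - i\<close> is indexed by \<open>i\<close>. The differential is
  \<open>f \<mapsto> d\<^sub>N f - (-1)\<^sup>n f d\<^sub>M\<close>.
\<close>

definition Hom_cpx :: "'a ring \<Rightarrow> ('a, 'm) cpx \<Rightarrow> ('a, 'n) cpx \<Rightarrow> ('a, int \<Rightarrow> 'm \<Rightarrow> 'n) cpx" where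
  "Hom_cpx R M N =
    (let C = (\<lambda>n. prod_mod (\<lambda>i. Hom_mod R (obj M i) (obj N (i + n)))) in
     \<lparr>obj = C,
      diff = (\<lambda>n. \<lambda>f\<in>carrier (C n). \<lambda>i. \<lambda>x\<in>carrier (obj M i).
        diff N (i + n) (f i x)
          \<ominus>\<^bsub>obj N (i + n + 1)\<^esub> signed (obj N (i + n + 1)) n (f (i + 1) (diff M i x)))\<rparr>)"

text \<open>
  The summand \<open>M\<^sup>i \<otimes> N\<^sup>j\<close> in degree \<open>n = i + j\<close> is indexed by \<open>i\<close>. The differential is
  \<open>x \<otimes> y \<mapsto> d\<^sub>M x \<otimes> y + (-1)\<^sup>i x \<otimes> d\<^sub>N y\<close>, so the component of its value at \<open>i\<close> receives contributions
  from the summands \<open>i - 1\<close> and \<open>i\<close>.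
\<close>

definition tensor_cpx ::
    "'a ring \<Rightarrow> ('a, 'm) cpx \<Rightarrow> ('a, 'n) cpx \<Rightarrow> ('a, int \<Rightarrow> ('m \<times> 'n \<Rightarrow> 'a) set) cpx" where
  "tensor_cpx R M N =
    (let T = (\<lambda>n i. tensor_mod R (obj M i) (obj N (n - i))); C = (\<lambda>n. dsum_mod (T n)) in
     \<lparr>obj = C,
      diff = (\<lambda>n. \<lambda>w\<in>carrier (C n). \<lambda>i.
        tensor_map R (obj M (i - 1)) (obj N (n + 1 - i)) (obj M i) (obj N (n + 1 - i))
            (diff M (i - 1)) id (w (i - 1))
          \<oplus>\<^bsub>T (n + 1) i\<^esub>
        signed (T (n + 1) i) i
          (tensor_map R (obj M i) (obj N (n - i)) (obj M i) (obj N (n + 1 - i))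
            id (diff N (n - i)) (w i)))\<rparr>)"

end

theory Submission
  imports Defs
begin

text \<open>
  Write \<open>M[I]\<close> for the elements of \<open>M\<close> killed by \<open>I\<close>. Everything rests on two comparisons with the identity
  functor. Evaluation at \<open>1\<close> embeds each \<open>Hom(R/I\<^sup>k, M)\<close> in \<open>M\<close> with image \<open>M[I\<^sup>k]\<close>, compatibly
  in \<open>k\<close>, so torsion has a natural injection \<open>tors_incl\<close> into \<open>M\<close> with image the union of the
  \<open>M[I\<^sup>k]\<close>. Dually \<open>m \<mapsto> 1 \<otimes> m\<close> maps \<open>M\<close> onto \<open>R/I\<^sup>k \<otimes> M\<close> with kernel \<open>I\<^sup>kM\<close>, compatibly in
  \<open>k\<close>, which gives a natural map \<open>compl_proj\<close> from \<open>M\<close> to its completion.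

  If \<open>M\<close> is reduced, then \<open>M[I\<^sup>k] = M[I]\<close> for all \<open>k \<ge> 1\<close> (lemma \<open>annihilated_by_power\<close>), so the image of
  \<open>tors_incl\<close> is \<open>M[I]\<close>. If \<open>M\<close> is coreduced, then \<open>I\<^sup>kM = IM\<close> for all \<open>k \<ge> 1\<close> (lemma
  \<open>ideal_smult_power_Suc\<close>), so the tower of the \<open>R/I\<^sup>k \<otimes> M\<close> is constant from \<open>k = 1\<close> on and \<open>compl_proj\<close> is
  surjective with kernel \<open>IM\<close>. In both cases the new module is killed by \<open>I\<close>, hence is reduced and
  coreduced for trivial reasons, and applying the functor again changes nothing.

  All the isomorphisms of complexes follow from one principle (lemmas \<open>cpx_iso_of_injections\<close> and
  \<open>cpx_iso_of_surjections\<close>): two complexes that embed in a third one with the same image are isomorphic,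
  and so are two complexes onto which a third one maps with the same kernel. The complexes
  \<open>\<Gamma>M\<close> and \<open>Hom(R/I, M)\<close> both embed in \<open>M\<close> with image \<open>M[I]\<close>; the complexes \<open>\<Lambda>M\<close> and \<open>R/I \<otimes> M\<close> are
  both quotients of \<open>M\<close> by \<open>IM\<close>; and \<open>Hom(\<Lambda>M, N)\<close> and \<open>Hom(M, \<Gamma>N)\<close> both embed in \<open>Hom(M, N)\<close>, by composition
  with \<open>compl_proj\<close> and \<open>tors_incl\<close>, with image the families of maps whose values are killed by \<open>I\<close>. In the
  same way the module axioms, the equation \<open>dd = 0\<close> and the functor laws are pulled back along
  injections and pushed forward along surjections instead of being computed in the limits.
\<close>

section \<open>Linear maps and transport of module structures\<close>

text \<open>Unlike a member of \<open>mod_hom\<close>, a linear map may take any values outside the carrier, so that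
  compositions, projections and \<open>id\<close> qualify without being restricted.\<close>

definition linear_map :: "'a ring \<Rightarrow> ('a, 'm) module \<Rightarrow> ('a, 'n) module \<Rightarrow> ('m \<Rightarrow> 'n) \<Rightarrow> bool" where
  "linear_map R M N f \<longleftrightarrow> f \<in> carrier M \<rightarrow> carrier N \<and>
    (\<forall>x\<in>carrier M. \<forall>y\<in>carrier M. f (x \<oplus>\<^bsub>M\<^esub> y) = f x \<oplus>\<^bsub>N\<^esub> f y) \<and>
    (\<forall>r\<in>carrier R. \<forall>x\<in>carrier M. f (r \<odot>\<^bsub>M\<^esub> x) = r \<odot>\<^bsub>N\<^esub> f x)"

lemma mod_hom_iff: "f \<in> mod_hom R M N \<longleftrightarrow> linear_map R M N f \<and> f \<in> extensional (carrier M)"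
  by (auto simp: mod_hom_def linear_map_def PiE_def)

lemma mod_homD: "f \<in> mod_hom R M N \<Longrightarrow> linear_map R M N f"
  by (simp add: mod_hom_iff)

lemma linear_mapI:
  assumes "\<And>x. x \<in> carrier M \<Longrightarrow> f x \<in> carrier N"
    and "\<And>x y. \<lbrakk>x \<in> carrier M; y \<in> carrier M\<rbrakk> \<Longrightarrow> f (x \<oplus>\<^bsub>M\<^esub> y) = f x \<oplus>\<^bsub>N\<^esub> f y"
    and "\<And>r x. \<lbrakk>r \<in> carrier R; x \<in> carrier M\<rbrakk> \<Longrightarrow> f (r \<odot>\<^bsub>M\<^esub> x) = r \<odot>\<^bsub>N\<^esub> f x"
  shows "linear_map R M N f"
  using assms by (auto simp: linear_map_def)

lemma linear_mapD:
  assumes "linear_map R M N f"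
  shows linear_map_closed: "x \<in> carrier M \<Longrightarrow> f x \<in> carrier N"
    and linear_map_add: "\<lbrakk>x \<in> carrier M; y \<in> carrier M\<rbrakk> \<Longrightarrow> f (x \<oplus>\<^bsub>M\<^esub> y) = f x \<oplus>\<^bsub>N\<^esub> f y"
    and linear_map_smult: "\<lbrakk>r \<in> carrier R; x \<in> carrier M\<rbrakk> \<Longrightarrow> f (r \<odot>\<^bsub>M\<^esub> x) = r \<odot>\<^bsub>N\<^esub> f x"
  using assms by (auto simp: linear_map_def)

lemma linear_map_cong:
  assumes "module R M" "linear_map R M N f" "\<And>x. x \<in> carrier M \<Longrightarrow> g x = f x"
  shows "linear_map R M N g"
proof -
  interpret M: module R M by fact
  show ?thesis using assms(2) by (auto simp: linear_map_def assms(3))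
qed

lemma restrict_mod_hom:
  assumes "module R M" "linear_map R M N f"
  shows "restrict f (carrier M) \<in> mod_hom R M N"
  using linear_map_cong[OF assms, of "restrict f (carrier M)"] by (simp add: mod_hom_iff)

lemma mod_homI:
  assumes "linear_map R M N f" "f \<in> extensional (carrier M)"
  shows "f \<in> mod_hom R M N"
  using assms by (simp add: mod_hom_iff)

lemma mod_hom_eqI:
  assumes "f \<in> mod_hom R M N" "g \<in> mod_hom R M N'" "\<And>x. x \<in> carrier M \<Longrightarrow> f x = g x"
  shows "f = g"
  using assms by (auto simp: mod_hom_iff intro: extensionalityI)

lemma linear_map_comp:
  assumes "linear_map R L M f" "linear_map R M N g"
  shows "linear_map R L N (\<lambda>x. g (f x))"
  using assms by (auto simp: linear_map_def Pi_def)

lemma compose_mod_hom: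
  assumes "module R L" "linear_map R L M f" "linear_map R M N g"
  shows "compose (carrier L) g f \<in> mod_hom R L N"
  unfolding compose_def
  by (rule restrict_mod_hom[OF assms(1) linear_map_comp[OF assms(2,3)]])

lemma linear_map_zero:
  assumes "module R M" "module R N" "linear_map R M N f"
  shows "f \<zero>\<^bsub>M\<^esub> = \<zero>\<^bsub>N\<^esub>"
proof -
  interpret M: module R M by fact
  interpret N: module R N by fact
  have "f \<zero>\<^bsub>M\<^esub> = f (\<zero>\<^bsub>R\<^esub> \<odot>\<^bsub>M\<^esub> \<zero>\<^bsub>M\<^esub>)" by simp
  also have "\<dots> = \<zero>\<^bsub>R\<^esub> \<odot>\<^bsub>N\<^esub> f \<zero>\<^bsub>M\<^esub>"
    by (rule linear_map_smult[OF assms(3)]) auto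
  also have "\<dots> = \<zero>\<^bsub>N\<^esub>" using linear_map_closed[OF assms(3)] by simp
  finally show ?thesis .
qed

lemma linear_map_neg:
  assumes "module R M" "module R N" "linear_map R M N f" "x \<in> carrier M"
  shows "f (\<ominus>\<^bsub>M\<^esub> x) = \<ominus>\<^bsub>N\<^esub> f x"
proof -
  interpret M: module R M by fact
  interpret N: module R N by fact
  have fx: "f x \<in> carrier N" using assms(3,4) by (rule linear_map_closed)
  have 1: "\<ominus>\<^bsub>M\<^esub> x = (\<ominus>\<^bsub>R\<^esub> \<one>\<^bsub>R\<^esub>) \<odot>\<^bsub>M\<^esub> x" using M.smult_l_minus[of "\<one>\<^bsub>R\<^esub>" x] assms(4) by simp
  have 2: "\<ominus>\<^bsub>N\<^esub> f x = (\<ominus>\<^bsub>R\<^esub> \<one>\<^bsub>R\<^esub>) \<odot>\<^bsub>N\<^esub> f x" using N.smult_l_minus[of "\<one>\<^bsub>R\<^esub>" "f x"] fx by simp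
  show ?thesis unfolding 1 2 by (rule linear_map_smult[OF assms(3)]) (use assms(4) in auto)
qed

lemma linear_map_diff:
  assumes "module R M" "module R N" "linear_map R M N f" "x \<in> carrier M" "y \<in> carrier M"
  shows "f (x \<ominus>\<^bsub>M\<^esub> y) = f x \<ominus>\<^bsub>N\<^esub> f y"
proof -
  interpret M: module R M by fact
  show ?thesis
    unfolding a_minus_def using assms
    by (simp add: linear_map_add[OF assms(3)] linear_map_neg[OF assms(1-3)])
qed

text \<open>Sums, multiples and zero in \<open>P\<close> are images of those in \<open>M\<close>, so every module identity is the image of
  one in \<open>M\<close>. Applied to quotients and to completions.\<close>

lemma module_of_surjection:
  fixes M :: "('a, 'm) module" and P :: "('a, 'p) module"
  assumes "module R M" and img: "carrier P = u ` carrier M"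
    and add: "\<And>x y. \<lbrakk>x \<in> carrier M; y \<in> carrier M\<rbrakk> \<Longrightarrow> u (x \<oplus>\<^bsub>M\<^esub> y) = u x \<oplus>\<^bsub>P\<^esub> u y"
    and zero: "u \<zero>\<^bsub>M\<^esub> = \<zero>\<^bsub>P\<^esub>"
    and smult: "\<And>r x. \<lbrakk>r \<in> carrier R; x \<in> carrier M\<rbrakk> \<Longrightarrow> u (r \<odot>\<^bsub>M\<^esub> x) = r \<odot>\<^bsub>P\<^esub> u x"
  shows "module R P"
proof -
  interpret M: module R M by fact
  note s = add[symmetric] zero[symmetric] smult[symmetric]
  show ?thesis
  proof (rule moduleI[OF M.R.is_cring abelian_groupI])
    show "\<exists>y\<in>carrier P. y \<oplus>\<^bsub>P\<^esub> x = \<zero>\<^bsub>P\<^esub>" if "x \<in> carrier P" for x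
    proof -
      obtain m where "m \<in> carrier M" "x = u m" using \<open>x \<in> carrier P\<close> img by auto
      then show ?thesis
        using img by (intro bexI[of _ "u (\<ominus>\<^bsub>M\<^esub> m)"]) (auto simp: s M.M.l_neg)
    qed
  qed (auto simp: img s M.M.a_ac M.smult_l_distr M.smult_r_distr M.smult_assoc1)
qed

text \<open>The module identities are checked after applying \<open>u\<close>; additive inverses come from multiplication by
  \<open>-1\<close>. Applied to Hom modules, free modules, direct sums and direct limits.\<close>

lemma module_of_injection:
  fixes M :: "('a, 'm) module" and P :: "('a, 'p) module"
  assumes "module R M" and inj: "inj_on u (carrier P)"
    and u: "\<And>x. x \<in> carrier P \<Longrightarrow> u x \<in> carrier M"
    and add: "\<And>x y. \<lbrakk>x \<in> carrier P; y \<in> carrier P\<rbrakk> \<Longrightarrow> x \<oplus>\<^bsub>P\<^esub> y \<in> carrier P \<and> u (x \<oplus>\<^bsub>P\<^esub> y) = u x \<oplus>\<^bsub>M\<^esub> u y"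
    and zero: "\<zero>\<^bsub>P\<^esub> \<in> carrier P \<and> u \<zero>\<^bsub>P\<^esub> = \<zero>\<^bsub>M\<^esub>"
    and smult: "\<And>r x. \<lbrakk>r \<in> carrier R; x \<in> carrier P\<rbrakk> \<Longrightarrow> r \<odot>\<^bsub>P\<^esub> x \<in> carrier P \<and> u (r \<odot>\<^bsub>P\<^esub> x) = r \<odot>\<^bsub>M\<^esub> u x"
  shows "module R P"
proof -
  interpret M: module R M by fact
  have eqI: "x = y" if "u x = u y" "x \<in> carrier P" "y \<in> carrier P" for x y
    using inj that by (auto dest: inj_onD)
  note c = add[THEN conjunct1] zero[THEN conjunct1] smult[THEN conjunct1]
  note e = add[THEN conjunct2] zero[THEN conjunct2] smult[THEN conjunct2]
  show ?thesis
  proof (rule moduleI[OF M.R.is_cring abelian_groupI])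
    show "\<exists>y\<in>carrier P. y \<oplus>\<^bsub>P\<^esub> x = \<zero>\<^bsub>P\<^esub>" if x: "x \<in> carrier P" for x
    proof -
      have "(\<ominus>\<^bsub>R\<^esub> \<one>\<^bsub>R\<^esub>) \<odot>\<^bsub>P\<^esub> x \<oplus>\<^bsub>P\<^esub> x = \<zero>\<^bsub>P\<^esub>"
        by (rule eqI) (auto simp: c e x u M.smult_l_minus M.M.l_neg)
      then show ?thesis using x c by (meson M.R.a_inv_closed M.R.one_closed)
    qed
  qed (auto intro!: eqI simp: c e u M.M.a_ac M.smult_l_distr M.smult_r_distr M.smult_assoc1)
qed

text \<open>\<open>R\<close> as a module over itself, so that \<open>R/J\<close> and free modules are covered by the general results on
  quotients and products.\<close>

definition self_mod :: "'a ring \<Rightarrow> ('a, 'a) module" where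
  "self_mod R = \<lparr>carrier = carrier R, mult = undefined, one = undefined,
     zero = \<zero>\<^bsub>R\<^esub>, add = add R, smult = mult R\<rparr>"

lemma self_mod_simps [simp]:
  "carrier (self_mod R) = carrier R" "\<zero>\<^bsub>self_mod R\<^esub> = \<zero>\<^bsub>R\<^esub>"
  "x \<oplus>\<^bsub>self_mod R\<^esub> y = x \<oplus>\<^bsub>R\<^esub> y" "r \<odot>\<^bsub>self_mod R\<^esub> x = r \<otimes>\<^bsub>R\<^esub> x"
  by (simp_all add: self_mod_def)

lemma self_mod_module:
  assumes "cring R" shows "module R (self_mod R)"
proof -
  interpret cring R by fact
  show ?thesis
    by (rule moduleI[OF is_cring abelian_groupI])
      (auto simp: a_ac l_distr r_distr m_assoc intro: bexI[of _ "\<ominus>\<^bsub>R\<^esub> _"] l_neg)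
qed

lemma prod_mod_simps [simp]:
  "x \<in> carrier (prod_mod F) \<longleftrightarrow> (\<forall>i. x i \<in> carrier (F i))"
  "\<zero>\<^bsub>prod_mod F\<^esub> = (\<lambda>i. \<zero>\<^bsub>F i\<^esub>)"
  "x \<oplus>\<^bsub>prod_mod F\<^esub> y = (\<lambda>i. x i \<oplus>\<^bsub>F i\<^esub> y i)" "r \<odot>\<^bsub>prod_mod F\<^esub> x = (\<lambda>i. r \<odot>\<^bsub>F i\<^esub> x i)"
  by (simp_all add: prod_mod_def)

lemma prod_mod_module:
  assumes "\<And>i. module R (F i)"
  shows "module R (prod_mod F)"
proof -
  interpret F: module R "F i" for i by (rule assms)
  show ?thesis
  proof (rule moduleI[OF F.R.is_cring abelian_groupI])
    show "\<exists>y\<in>carrier (prod_mod F). y \<oplus>\<^bsub>prod_mod F\<^esub> x = \<zero>\<^bsub>prod_mod F\<^esub>" if "x \<in> carrier (prod_mod F)" for x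
      using that by (intro bexI[of _ "\<lambda>i. \<ominus>\<^bsub>F i\<^esub> x i"]) (auto simp: F.M.l_neg)
  qed (auto simp: F.M.a_ac F.smult_l_distr F.smult_r_distr F.smult_assoc1)
qed

lemma dsum_mod_simps [simp]:
  "x \<in> carrier (dsum_mod F) \<longleftrightarrow> (\<forall>i. x i \<in> carrier (F i)) \<and> finite {i. x i \<noteq> \<zero>\<^bsub>F i\<^esub>}"
  "\<zero>\<^bsub>dsum_mod F\<^esub> = (\<lambda>i. \<zero>\<^bsub>F i\<^esub>)"
  "x \<oplus>\<^bsub>dsum_mod F\<^esub> y = (\<lambda>i. x i \<oplus>\<^bsub>F i\<^esub> y i)" "r \<odot>\<^bsub>dsum_mod F\<^esub> x = (\<lambda>i. r \<odot>\<^bsub>F i\<^esub> x i)"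
  by (simp_all add: dsum_mod_def)

lemma Hom_mod_simps [simp]:
  "carrier (Hom_mod R M N) = mod_hom R M N"
  "\<zero>\<^bsub>Hom_mod R M N\<^esub> = (\<lambda>x\<in>carrier M. \<zero>\<^bsub>N\<^esub>)"
  "f \<oplus>\<^bsub>Hom_mod R M N\<^esub> g = (\<lambda>x\<in>carrier M. f x \<oplus>\<^bsub>N\<^esub> g x)"
  "r \<odot>\<^bsub>Hom_mod R M N\<^esub> f = (\<lambda>x\<in>carrier M. r \<odot>\<^bsub>N\<^esub> f x)"
  by (simp_all add: Hom_mod_def)

text \<open>Extending a linear map by zero outside the carrier embeds \<open>Hom\<close> into a power of the target;
  this reduces the module axioms to closure under the operations.\<close>

lemma Hom_mod_module:
  assumes "module R M" "module R N"
  shows "module R (Hom_mod R M N)"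
proof -
  interpret M: module R M by fact
  interpret N: module R N by fact
  show ?thesis
  proof (rule module_of_injection[OF prod_mod_module[of R "\<lambda>x. N"],
        of "\<lambda>f x. if x \<in> carrier M then f x else \<zero>\<^bsub>N\<^esub>"])
    show "inj_on (\<lambda>f x. if x \<in> carrier M then f x else \<zero>\<^bsub>N\<^esub>) (carrier (Hom_mod R M N))"
      by (auto intro!: inj_onI ext simp: fun_eq_iff mod_hom_iff extensional_def) metis
  next
    fix f g assume fg: "f \<in> carrier (Hom_mod R M N)" "g \<in> carrier (Hom_mod R M N)"
    have f: "linear_map R M N f" and g: "linear_map R M N g" using fg by (auto simp: mod_homD)
    have "linear_map R M N (\<lambda>x. f x \<oplus>\<^bsub>N\<^esub> g x)"
      by (rule linear_mapI)
        (auto simp: linear_mapD[OF f] linear_mapD[OF g] N.M.a_ac N.smult_r_distr)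
    then show "f \<oplus>\<^bsub>Hom_mod R M N\<^esub> g \<in> carrier (Hom_mod R M N) \<and>
      (\<lambda>x. if x \<in> carrier M then (f \<oplus>\<^bsub>Hom_mod R M N\<^esub> g) x else \<zero>\<^bsub>N\<^esub>) =
      (\<lambda>x. if x \<in> carrier M then f x else \<zero>\<^bsub>N\<^esub>) \<oplus>\<^bsub>prod_mod (\<lambda>x. N)\<^esub>
      (\<lambda>x. if x \<in> carrier M then g x else \<zero>\<^bsub>N\<^esub>)"
      by (auto intro: restrict_mod_hom assms(1))
  next
    fix r f assume r: "r \<in> carrier R" and "f \<in> carrier (Hom_mod R M N)"
    then have f: "linear_map R M N f" by (auto simp: mod_homD)
    have "linear_map R M N (\<lambda>x. r \<odot>\<^bsub>N\<^esub> f x)"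
      by (rule linear_mapI)
        (use r in \<open>auto simp: linear_mapD[OF f] N.smult_r_distr N.smult_assoc1[symmetric] M.R.m_comm\<close>)
    then show "r \<odot>\<^bsub>Hom_mod R M N\<^esub> f \<in> carrier (Hom_mod R M N) \<and>
      (\<lambda>x. if x \<in> carrier M then (r \<odot>\<^bsub>Hom_mod R M N\<^esub> f) x else \<zero>\<^bsub>N\<^esub>) =
      r \<odot>\<^bsub>prod_mod (\<lambda>x. N)\<^esub> (\<lambda>x. if x \<in> carrier M then f x else \<zero>\<^bsub>N\<^esub>)"
      using r by (auto intro: restrict_mod_hom assms(1))
  next
    have "linear_map R M N (\<lambda>x. \<zero>\<^bsub>N\<^esub>)" by (rule linear_mapI) auto
    then show "\<zero>\<^bsub>Hom_mod R M N\<^esub> \<in> carrier (Hom_mod R M N) \<and>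
      (\<lambda>x. if x \<in> carrier M then \<zero>\<^bsub>Hom_mod R M N\<^esub> x else \<zero>\<^bsub>N\<^esub>) = \<zero>\<^bsub>prod_mod (\<lambda>x. N)\<^esub>"
      by (auto intro: restrict_mod_hom assms(1))
  qed (auto simp: assms dest!: mod_homD intro: linear_map_closed)
qed

lemma linear_map_cancel_injection:
  assumes "module R P" "module R Q" and i: "linear_map R Q N i" "inj_on i (carrier Q)"
    and closed: "\<And>x. x \<in> carrier P \<Longrightarrow> g x \<in> carrier Q"
    and lin: "linear_map R P N (\<lambda>x. i (g x))"
  shows "linear_map R P Q g"
proof -
  interpret P: module R P by fact
  interpret Q: module R Q by fact
  show ?thesis
  proof (rule linear_mapI)
    fix x y assume "x \<in> carrier P" "y \<in> carrier P"
    then show "g (x \<oplus>\<^bsub>P\<^esub> y) = g x \<oplus>\<^bsub>Q\<^esub> g y"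
      by (intro inj_onD[OF i(2)]) (simp_all add: closed linear_map_add[OF i(1)] linear_map_add[OF lin])
  next
    fix r x assume "r \<in> carrier R" "x \<in> carrier P"
    then show "g (r \<odot>\<^bsub>P\<^esub> x) = r \<odot>\<^bsub>Q\<^esub> g x"
      by (intro inj_onD[OF i(2)]) (simp_all add: closed linear_map_smult[OF i(1)] linear_map_smult[OF lin])
  qed (rule closed)
qed

lemma mod_hom_closed: "\<lbrakk>f \<in> mod_hom R M N; x \<in> carrier M\<rbrakk> \<Longrightarrow> f x \<in> carrier N"
  by (auto simp: mod_hom_iff linear_map_def)

lemma linear_map_cancel_surjection:
  assumes "module R M" and p: "linear_map R M P p" "carrier P = p ` carrier M"
    and lin: "linear_map R M N (\<lambda>x. g (p x))"
  shows "linear_map R P N g"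
proof -
  interpret M: module R M by fact
  show ?thesis
    by (rule linear_mapI)
      (auto simp: p(2) linear_mapD(2-3)[OF p(1), symmetric] linear_mapD[OF lin])
qed

section \<open>Quotient modules\<close>

lemma submodule_abelian_subgroup:
  assumes "module R M" "submodule H R M"
  shows "abelian_subgroup H M"
proof -
  interpret M: module R M by fact
  show ?thesis
    by (rule abelian_subgroupI3)
      (auto simp: additive_subgroup_def submodule.axioms(1)[OF assms(2)] M.M.abelian_group_axioms)
qed

text \<open>Cosets are compared through differences throughout, so this converts kernels into fibres.\<close>

lemma module_diff_eq_zero_iff:
  assumes "module R M" "x \<in> carrier M" "y \<in> carrier M"
  shows "x \<ominus>\<^bsub>M\<^esub> y = \<zero>\<^bsub>M\<^esub> \<longleftrightarrow> x = y"
proof -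
  interpret M: module R M by fact
  show ?thesis
    using assms(2,3) M.M.minus_equality[of x "\<ominus>\<^bsub>M\<^esub> y"] M.M.minus_minus
    by (auto simp: a_minus_def M.M.r_neg)
qed

lemma coset_eq_iff:
  assumes "module R M" "submodule H R M" "x \<in> carrier M" "y \<in> carrier M"
  shows "H +>\<^bsub>M\<^esub> x = H +>\<^bsub>M\<^esub> y \<longleftrightarrow> x \<ominus>\<^bsub>M\<^esub> y \<in> H"
proof -
  interpret abelian_subgroup H M by (rule submodule_abelian_subgroup) fact+
  show ?thesis
    using a_rcos_module[OF assms(4,3)] assms(3,4)
    by (metis a_minus_def a_repr_independence' a_repr_independenceD)
qed

lemma kernel_submodule:
  assumes "module R M" "module R N" "linear_map R M N f"
  shows "submodule {x \<in> carrier M. f x = \<zero>\<^bsub>N\<^esub>} R M"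
proof -
  interpret M: module R M by fact
  interpret N: module R N by fact
  show ?thesis
    by (rule M.submoduleI)
      (auto simp: linear_map_zero[OF assms] linear_map_neg[OF assms] linear_mapD[OF assms(3)])
qed

lemma equalizer_submodule:
  assumes "module R M" "module R N" "linear_map R M N f" "linear_map R M N g"
  shows "submodule {x \<in> carrier M. f x = g x} R M"
proof -
  interpret M: module R M by fact
  interpret N: module R N by fact
  show ?thesis
    by (rule M.submoduleI)
      (auto simp: linear_map_zero[OF assms(1-3)] linear_map_zero[OF assms(1,2,4)]
        linear_map_neg[OF assms(1-3)] linear_map_neg[OF assms(1,2,4)]
        linear_mapD[OF assms(3)] linear_mapD[OF assms(4)])
qed

lemma image_submodule:
  assumes "module R M" "module R N" "linear_map R M N f"
  shows "submodule (f ` carrier M) R N"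
proof -
  interpret M: module R M by fact
  interpret N: module R N by fact
  note s = linear_map_zero[OF assms, symmetric] linear_map_neg[OF assms, symmetric]
    linear_mapD(2-3)[OF assms(3), symmetric]
  show ?thesis
    by (rule N.submoduleI) (auto simp: s linear_mapD(1)[OF assms(3)])
qed

lemma preimage_submodule:
  assumes "module R M" "module R N" "linear_map R M N f" "submodule H R N"
  shows "submodule {x \<in> carrier M. f x \<in> H} R M"
proof -
  interpret M: module R M by fact
  interpret N: module R N by fact
  interpret H: submodule H R N by fact
  show ?thesis
    using N.submoduleE[OF assms(4)] H.one_closed
    by (intro M.submoduleI)
      (auto simp: linear_map_zero[OF assms(1-3)] linear_map_neg[OF assms(1-3)] linear_mapD[OF assms(3)])
qed

lemma span_mod_submodule:
  assumes "module R M" "S \<subseteq> carrier M"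
  shows "submodule (span_mod R M S) R M"
proof -
  interpret M: module R M by fact
  have mem: "x \<in> span_mod R M S \<longleftrightarrow> (\<forall>H. submodule H R M \<and> S \<subseteq> H \<longrightarrow> x \<in> H)" for x
    by (auto simp: span_mod_def hull_def)
  note E = M.submoduleE
  have z: "\<zero>\<^bsub>M\<^esub> \<in> H" if "submodule H R M" for H
  proof -
    interpret submodule H R M by fact
    show ?thesis using one_closed by simp
  qed
  show ?thesis
  proof (rule M.submoduleI)
    show "span_mod R M S \<subseteq> carrier M" using M.carrier_is_submodule assms(2) by (auto simp: mem)
  qed (auto simp: mem z E(3-5))
qed

lemma span_mod_superset: "S \<subseteq> span_mod R M S"
  unfolding span_mod_def by (rule hull_subset)

lemma span_mod_minimal: "\<lbrakk>S \<subseteq> H; submodule H R M\<rbrakk> \<Longrightarrow> span_mod R M S \<subseteq> H"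
  unfolding span_mod_def by (rule hull_minimal)

lemma quot_mod_carrier: "carrier (quot_mod R M H) = (\<lambda>x. H +>\<^bsub>M\<^esub> x) ` carrier M"
  by (auto simp: quot_mod_def A_RCOSETS_def' a_r_coset_def')

lemma quot_mod_ops:
  assumes "module R M" "submodule H R M"
  shows quot_mod_zero: "H +>\<^bsub>M\<^esub> \<zero>\<^bsub>M\<^esub> = \<zero>\<^bsub>quot_mod R M H\<^esub>"
    and quot_mod_add: "\<lbrakk>x \<in> carrier M; y \<in> carrier M\<rbrakk> \<Longrightarrow>
      H +>\<^bsub>M\<^esub> (x \<oplus>\<^bsub>M\<^esub> y) = (H +>\<^bsub>M\<^esub> x) \<oplus>\<^bsub>quot_mod R M H\<^esub> (H +>\<^bsub>M\<^esub> y)"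
    and quot_mod_smult: "\<lbrakk>r \<in> carrier R; x \<in> carrier M\<rbrakk> \<Longrightarrow>
      H +>\<^bsub>M\<^esub> (r \<odot>\<^bsub>M\<^esub> x) = r \<odot>\<^bsub>quot_mod R M H\<^esub> (H +>\<^bsub>M\<^esub> x)"
proof -
  interpret M: module R M by fact
  interpret abelian_subgroup H M by (rule submodule_abelian_subgroup) fact+
  interpret H: submodule H R M by fact
  show "H +>\<^bsub>M\<^esub> \<zero>\<^bsub>M\<^esub> = \<zero>\<^bsub>quot_mod R M H\<^esub>"
    by (simp add: quot_mod_def a_subset)
  show "H +>\<^bsub>M\<^esub> (x \<oplus>\<^bsub>M\<^esub> y) = (H +>\<^bsub>M\<^esub> x) \<oplus>\<^bsub>quot_mod R M H\<^esub> (H +>\<^bsub>M\<^esub> y)"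
    if "x \<in> carrier M" "y \<in> carrier M"
    using that by (simp add: quot_mod_def a_rcos_sum)
  show "H +>\<^bsub>M\<^esub> (r \<odot>\<^bsub>M\<^esub> x) = r \<odot>\<^bsub>quot_mod R M H\<^esub> (H +>\<^bsub>M\<^esub> x)" if r: "r \<in> carrier R" and x: "x \<in> carrier M"
  proof -
    have "H +>\<^bsub>M\<^esub> (r \<odot>\<^bsub>M\<^esub> y) = H +>\<^bsub>M\<^esub> (r \<odot>\<^bsub>M\<^esub> x)" if y: "y \<in> H +>\<^bsub>M\<^esub> x" for y
    proof -
      obtain h where h: "h \<in> H" "y = h \<oplus>\<^bsub>M\<^esub> x" using y by (auto simp: a_r_coset_def')
      have hM: "h \<in> carrier M" using h a_subset by auto
      have "r \<odot>\<^bsub>M\<^esub> y \<ominus>\<^bsub>M\<^esub> r \<odot>\<^bsub>M\<^esub> x = r \<odot>\<^bsub>M\<^esub> h"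
        using r x hM by (simp add: h M.smult_r_distr a_minus_def M.M.a_assoc M.M.r_neg)
      then show ?thesis
        using r x hM h by (subst coset_eq_iff[OF assms]) auto
    qed
    then have "(\<Union>y\<in>H +>\<^bsub>M\<^esub> x. H +>\<^bsub>M\<^esub> (r \<odot>\<^bsub>M\<^esub> y)) = (\<Union>y\<in>H +>\<^bsub>M\<^esub> x. H +>\<^bsub>M\<^esub> (r \<odot>\<^bsub>M\<^esub> x))"
      by (rule SUP_cong[OF refl])
    then show ?thesis using a_rcos_self[OF x] by (auto simp: quot_mod_def)
  qed
qed

lemma quot_mod_module:
  assumes "module R M" "submodule H R M"
  shows "module R (quot_mod R M H)"
  using module_of_surjection[OF assms(1) quot_mod_carrier quot_mod_add[OF assms]
      quot_mod_zero[OF assms] quot_mod_smult[OF assms]] by blast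

lemma quot_mod_proj:
  assumes "module R M" "submodule H R M"
  shows "linear_map R M (quot_mod R M H) (\<lambda>x. H +>\<^bsub>M\<^esub> x)"
  using quot_mod_ops[OF assms] by (auto intro!: linear_mapI simp: quot_mod_carrier)

lemma quot_mod_proj_eq_zero:
  assumes "module R M" "submodule H R M" "x \<in> carrier M"
  shows "H +>\<^bsub>M\<^esub> x = \<zero>\<^bsub>quot_mod R M H\<^esub> \<longleftrightarrow> x \<in> H"
proof -
  interpret M: module R M by fact
  have "x \<ominus>\<^bsub>M\<^esub> \<zero>\<^bsub>M\<^esub> = x"
    using assms(3) M.M.minus_equality[of "\<zero>\<^bsub>M\<^esub>" "\<zero>\<^bsub>M\<^esub>"] by (simp add: a_minus_def)
  then show ?thesis
    using coset_eq_iff[OF assms M.M.zero_closed] by (simp add: quot_mod_zero[OF assms(1,2)])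
qed

text \<open>The source of all maps out of \<open>M/H\<close>, \<open>R/J\<close> and a completion: a preimage is chosen for each
  element, and the value does not depend on the choice.\<close>

lemma descend_along_surjection:
  assumes "module R M" and p: "linear_map R M Q p" and surj: "carrier Q = p ` carrier M"
    and f: "linear_map R M N f"
    and ker: "\<And>x y. \<lbrakk>x \<in> carrier M; y \<in> carrier M; p x = p y\<rbrakk> \<Longrightarrow> f x = f y"
  obtains g where "g \<in> mod_hom R Q N" "\<And>x. x \<in> carrier M \<Longrightarrow> g (p x) = f x"
proof -
  interpret M: module R M by fact
  define g where "g = (\<lambda>X\<in>carrier Q. f (SOME x. x \<in> carrier M \<and> p x = X))"
  have g: "g (p x) = f x" if "x \<in> carrier M" for x
  proof -
    let ?x = "SOME y. y \<in> carrier M \<and> p y = p x"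
    have "?x \<in> carrier M \<and> p ?x = p x" by (rule someI[of _ x]) (use that in auto)
    then show ?thesis using that ker[of ?x x] surj by (auto simp: g_def)
  qed
  have "linear_map R Q N g"
    by (rule linear_mapI)
      (auto simp: surj g linear_mapD[OF f] linear_mapD(2-3)[OF p, symmetric])
  then have "g \<in> mod_hom R Q N" by (auto simp: mod_hom_iff g_def)
  then show ?thesis using g that by blast
qed

lemma quot_mod_lift:
  assumes "module R M" "submodule H R M" "module R N" and f: "linear_map R M N f"
    and ker: "\<And>h. h \<in> H \<Longrightarrow> f h = \<zero>\<^bsub>N\<^esub>"
  obtains g where "g \<in> mod_hom R (quot_mod R M H) N" "\<And>x. x \<in> carrier M \<Longrightarrow> g (H +>\<^bsub>M\<^esub> x) = f x"
proof (rule descend_along_surjection[OF assms(1) quot_mod_proj[OF assms(1,2)] quot_mod_carrier f])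
  fix x y assume xy: "x \<in> carrier M" "y \<in> carrier M" "H +>\<^bsub>M\<^esub> x = H +>\<^bsub>M\<^esub> y"
  interpret N: module R N by fact
  have "f x \<ominus>\<^bsub>N\<^esub> f y = \<zero>\<^bsub>N\<^esub>"
    using ker[of "x \<ominus>\<^bsub>M\<^esub> y"] xy coset_eq_iff[OF assms(1,2) xy(1,2)]
      linear_map_diff[OF assms(1,3) f xy(1,2)] by simp
  then show "f x = f y"
    using xy(1,2) linear_map_closed[OF f] module_diff_eq_zero_iff[OF assms(3)] by blast
qed (use that in blast)

subsection \<open>Cyclic modules R/J\<close>

lemma ideal_submodule_self:
  assumes "cring R" "ideal J R"
  shows "submodule J R (self_mod R)"
proof -
  interpret M: module R "self_mod R" using assms(1) by (rule self_mod_module)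
  interpret J: ideal J R by fact
  have neg: "\<ominus>\<^bsub>self_mod R\<^esub> x = \<ominus>\<^bsub>R\<^esub> x" for x
    by (simp add: a_inv_def self_mod_def m_inv_def)
  show ?thesis
    by (rule M.submoduleI) (use J.a_subset in \<open>auto simp: neg J.I_l_closed\<close>)
qed

lemma self_mod_coset [simp]: "H +>\<^bsub>self_mod R\<^esub> x = H +>\<^bsub>R\<^esub> x"
  by (simp add: a_r_coset_def' self_mod_def)

lemma quot_ring_mod_ops:
  assumes "cring R" "ideal J R"
  shows quot_ring_mod_carrier: "carrier (quot_ring_mod R J) = (\<lambda>r. J +>\<^bsub>R\<^esub> r) ` carrier R"
    and quot_ring_mod_zero: "J +>\<^bsub>R\<^esub> \<zero>\<^bsub>R\<^esub> = \<zero>\<^bsub>quot_ring_mod R J\<^esub>"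
    and quot_ring_mod_add: "\<lbrakk>x \<in> carrier R; y \<in> carrier R\<rbrakk> \<Longrightarrow>
      J +>\<^bsub>R\<^esub> (x \<oplus>\<^bsub>R\<^esub> y) = (J +>\<^bsub>R\<^esub> x) \<oplus>\<^bsub>quot_ring_mod R J\<^esub> (J +>\<^bsub>R\<^esub> y)"
    and quot_ring_mod_smult: "\<lbrakk>x \<in> carrier R; y \<in> carrier R\<rbrakk> \<Longrightarrow>
      J +>\<^bsub>R\<^esub> (x \<otimes>\<^bsub>R\<^esub> y) = x \<odot>\<^bsub>quot_ring_mod R J\<^esub> (J +>\<^bsub>R\<^esub> y)"
proof -
  interpret cring R by fact
  interpret J: ideal J R by fact
  show "carrier (quot_ring_mod R J) = (\<lambda>r. J +>\<^bsub>R\<^esub> r) ` carrier R"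
    by (auto simp: quot_ring_mod_def FactRing_def ring.defs module.defs A_RCOSETS_def' a_r_coset_def')
  show "J +>\<^bsub>R\<^esub> \<zero>\<^bsub>R\<^esub> = \<zero>\<^bsub>quot_ring_mod R J\<^esub>"
    by (simp add: quot_ring_mod_def FactRing_def ring.defs module.defs J.a_subset)
  show "J +>\<^bsub>R\<^esub> (x \<oplus>\<^bsub>R\<^esub> y) = (J +>\<^bsub>R\<^esub> x) \<oplus>\<^bsub>quot_ring_mod R J\<^esub> (J +>\<^bsub>R\<^esub> y)"
    if "x \<in> carrier R" "y \<in> carrier R"
    using that by (simp add: quot_ring_mod_def FactRing_def ring.defs module.defs J.a_rcos_sum)
  show "J +>\<^bsub>R\<^esub> (x \<otimes>\<^bsub>R\<^esub> y) = x \<odot>\<^bsub>quot_ring_mod R J\<^esub> (J +>\<^bsub>R\<^esub> y)"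
    if "x \<in> carrier R" "y \<in> carrier R"
    using that by (simp add: quot_ring_mod_def FactRing_def ring.defs module.defs J.rcoset_mult_add)
qed

lemma quot_ring_mod_proj:
  assumes "cring R" "ideal J R"
  shows "linear_map R (self_mod R) (quot_ring_mod R J) (\<lambda>r. J +>\<^bsub>R\<^esub> r)"
  using quot_ring_mod_ops[OF assms] by (auto intro!: linear_mapI)

lemma quot_ring_mod_module:
  assumes "cring R" "ideal J R"
  shows "module R (quot_ring_mod R J)"
  by (rule module_of_surjection[OF self_mod_module[OF assms(1)], of _ "\<lambda>r. J +>\<^bsub>R\<^esub> r"])
    (simp_all add: quot_ring_mod_ops[OF assms])

lemma quot_ring_mod_eq_iff:
  fixes R :: "'a ring"
  assumes "cring R" "ideal J R" "x \<in> carrier R" "y \<in> carrier R"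
  shows "J +>\<^bsub>R\<^esub> x = J +>\<^bsub>R\<^esub> y \<longleftrightarrow> x \<ominus>\<^bsub>R\<^esub> y \<in> J"
proof -
  have "\<ominus>\<^bsub>self_mod R\<^esub> x = \<ominus>\<^bsub>R\<^esub> x" for x
    by (simp add: a_inv_def self_mod_def m_inv_def)
  then show ?thesis
    using coset_eq_iff[OF self_mod_module[OF assms(1)] ideal_submodule_self[OF assms(1,2)], of x y] assms(3,4)
    by (simp add: a_minus_def)
qed

lemma quot_proj_coset:
  assumes "cring R" "ideal J R" "ideal K R" "K \<subseteq> J" "x \<in> carrier R"
  shows "quot_proj R J (K +>\<^bsub>R\<^esub> x) = J +>\<^bsub>R\<^esub> x"
proof -
  interpret cring R by fact
  interpret J: ideal J R by fact
  interpret K: ideal K R by fact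
  have "J <+>\<^bsub>R\<^esub> K = J"
  proof
    show "J <+>\<^bsub>R\<^esub> K \<subseteq> J" using assms(4) by (auto simp: set_add_def')
    show "J \<subseteq> J <+>\<^bsub>R\<^esub> K"
    proof
      fix j assume j: "j \<in> J"
      then have "j = j \<oplus>\<^bsub>R\<^esub> \<zero>\<^bsub>R\<^esub>" using J.a_subset by auto
      then show "j \<in> J <+>\<^bsub>R\<^esub> K" using j K.zero_closed unfolding set_add_def' by blast
    qed
  qed
  then show ?thesis
    unfolding quot_proj_def using a_setmult_rcos_assoc[OF J.a_subset K.a_subset assms(5)] by simp
qed

lemma quot_proj_linear:
  assumes "cring R" "ideal J R" "ideal K R" "K \<subseteq> J"
  shows "linear_map R (quot_ring_mod R K) (quot_ring_mod R J) (quot_proj R J)"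
  by (rule linear_mapI)
    (auto simp: quot_ring_mod_carrier[OF assms(1,2)] quot_ring_mod_carrier[OF assms(1,3)]
      quot_proj_coset[OF assms] quot_ring_mod_add[OF assms(1,3), symmetric]
      quot_ring_mod_smult[OF assms(1,3), symmetric]
      quot_ring_mod_add[OF assms(1,2)] quot_ring_mod_smult[OF assms(1,2)]
      cring.cring_simprules(1,5)[OF assms(1)])

section \<open>Tensor products\<close>

subsection \<open>Free modules\<close>

lemma free_mod_simps [simp]:
  "w \<in> carrier (free_mod R S) \<longleftrightarrow>
    (\<forall>p. w p \<in> carrier R) \<and> finite {p. w p \<noteq> \<zero>\<^bsub>R\<^esub>} \<and> {p. w p \<noteq> \<zero>\<^bsub>R\<^esub>} \<subseteq> S"
  "\<zero>\<^bsub>free_mod R S\<^esub> = (\<lambda>p. \<zero>\<^bsub>R\<^esub>)"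
  "v \<oplus>\<^bsub>free_mod R S\<^esub> w = (\<lambda>p. v p \<oplus>\<^bsub>R\<^esub> w p)" "r \<odot>\<^bsub>free_mod R S\<^esub> w = (\<lambda>p. r \<otimes>\<^bsub>R\<^esub> w p)"
  by (auto simp: free_mod_def)

lemma free_mod_module:
  assumes "cring R"
  shows "module R (free_mod R S)"
proof -
  interpret cring R by fact
  show ?thesis
  proof (rule module_of_injection[OF prod_mod_module[of R "\<lambda>_. self_mod R"], of "\<lambda>w. w"])
    fix v w assume "v \<in> carrier (free_mod R S)" "w \<in> carrier (free_mod R S)"
    moreover have "{p. v p \<oplus>\<^bsub>R\<^esub> w p \<noteq> \<zero>\<^bsub>R\<^esub>} \<subseteq> {p. v p \<noteq> \<zero>\<^bsub>R\<^esub>} \<union> {p. w p \<noteq> \<zero>\<^bsub>R\<^esub>}"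
      by auto
    ultimately show "v \<oplus>\<^bsub>free_mod R S\<^esub> w \<in> carrier (free_mod R S) \<and>
        v \<oplus>\<^bsub>free_mod R S\<^esub> w = v \<oplus>\<^bsub>prod_mod (\<lambda>_. self_mod R)\<^esub> w"
      by (auto intro: finite_subset)
  next
    fix r w assume "r \<in> carrier R" "w \<in> carrier (free_mod R S)"
    moreover from this have "{p. r \<otimes>\<^bsub>R\<^esub> w p \<noteq> \<zero>\<^bsub>R\<^esub>} \<subseteq> {p. w p \<noteq> \<zero>\<^bsub>R\<^esub>}" by auto
    ultimately show "r \<odot>\<^bsub>free_mod R S\<^esub> w \<in> carrier (free_mod R S) \<and>
        r \<odot>\<^bsub>free_mod R S\<^esub> w = r \<odot>\<^bsub>prod_mod (\<lambda>_. self_mod R)\<^esub> w"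
      by (auto intro: finite_subset)
  qed (auto intro: self_mod_module assms)
qed

lemma free_gen_closed:
  assumes "cring R" "p \<in> S"
  shows "free_gen R p \<in> carrier (free_mod R S)"
proof -
  interpret cring R by fact
  have "{q. free_gen R p q \<noteq> \<zero>\<^bsub>R\<^esub>} \<subseteq> {p}" by (auto simp: free_gen_def)
  moreover have "free_gen R p q \<in> carrier R" for q by (simp add: free_gen_def)
  ultimately show ?thesis using assms(2) by (auto intro: finite_subset)
qed

text \<open>Induction on the support: splitting off one coordinate writes a vector as a sum of a vector with
  smaller support and a multiple of a generator.\<close>

lemma free_mod_induct:
  assumes "cring R" and H: "submodule H R (free_mod R S)"
    and gen: "\<And>p. p \<in> S \<Longrightarrow> free_gen R p \<in> H"
  shows "carrier (free_mod R S) \<subseteq> H"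
proof -
  interpret cring R by fact
  interpret F: module R "free_mod R S" using assms(1) by (rule free_mod_module)
  note HE = F.submoduleE[OF H]
  interpret H: submodule H R "free_mod R S" by fact
  have "\<forall>w. w \<in> carrier (free_mod R S) \<and> {p. w p \<noteq> \<zero>\<^bsub>R\<^esub>} \<subseteq> T \<longrightarrow> w \<in> H" if "finite T" "T \<subseteq> S" for T
    using that
  proof (induction T)
    case empty
    have "w = \<zero>\<^bsub>free_mod R S\<^esub>" if "{p. w p \<noteq> \<zero>\<^bsub>R\<^esub>} \<subseteq> {}" for w using that by auto
    moreover have "\<zero>\<^bsub>free_mod R S\<^esub> \<in> H" using H.one_closed by simp
    ultimately show ?case by metis
  next
    case (insert q T)
    show ?case
    proof (intro allI impI)
      fix w assume w: "w \<in> carrier (free_mod R S) \<and> {p. w p \<noteq> \<zero>\<^bsub>R\<^esub>} \<subseteq> insert q T"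
      define v where "v = w(q := \<zero>\<^bsub>R\<^esub>)"
      have "{p. v p \<noteq> \<zero>\<^bsub>R\<^esub>} \<subseteq> {p. w p \<noteq> \<zero>\<^bsub>R\<^esub>}" by (auto simp: v_def)
      then have "finite {p. v p \<noteq> \<zero>\<^bsub>R\<^esub>}" "{p. v p \<noteq> \<zero>\<^bsub>R\<^esub>} \<subseteq> S"
        using w by (auto intro: finite_subset)
      moreover have "{p. v p \<noteq> \<zero>\<^bsub>R\<^esub>} \<subseteq> T" using w by (auto simp: v_def)
      moreover have "v p \<in> carrier R" for p using w by (simp add: v_def)
      ultimately have "v \<in> H" using insert by auto
      moreover have "w q \<odot>\<^bsub>free_mod R S\<^esub> free_gen R q \<in> H"
        using w gen[of q] insert.prems by (intro HE(4)) auto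
      moreover have "w = v \<oplus>\<^bsub>free_mod R S\<^esub> (w q \<odot>\<^bsub>free_mod R S\<^esub> free_gen R q)"
        using w by (auto simp: v_def free_gen_def)
      ultimately show "w \<in> H" using HE(5) by metis
    qed
  qed
  then show ?thesis by auto
qed

lemma free_mod_lift:
  assumes "cring R" "module R N" and e: "\<And>p. p \<in> S \<Longrightarrow> e p \<in> carrier N"
  obtains L where "linear_map R (free_mod R S) N L" "\<And>p. p \<in> S \<Longrightarrow> L (free_gen R p) = e p"
proof -
  interpret cring R by fact
  interpret N: module R N by fact
  define L where "L w = (\<Oplus>\<^bsub>N\<^esub>p\<in>{p. w p \<noteq> \<zero>\<^bsub>R\<^esub>}. w p \<odot>\<^bsub>N\<^esub> e p)" for w
  \<comment> \<open>The support may be enlarged, so that two vectors can be compared over a common index set.\<close>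
  have L: "L w = (\<Oplus>\<^bsub>N\<^esub>p\<in>T. w p \<odot>\<^bsub>N\<^esub> e p)"
    if "w \<in> carrier (free_mod R S)" "finite T" "{p. w p \<noteq> \<zero>\<^bsub>R\<^esub>} \<subseteq> T" "T \<subseteq> S" for w T
    unfolding L_def
    by (rule N.M.add.finprod_mono_neutral_cong_left) (use that e in \<open>auto simp: subset_iff\<close>)
  have "linear_map R (free_mod R S) N L"
  proof (rule linear_mapI)
    fix v w assume v: "v \<in> carrier (free_mod R S)" and w: "w \<in> carrier (free_mod R S)"
    interpret F: module R "free_mod R S" using assms(1) by (rule free_mod_module)
    let ?T = "{p. v p \<noteq> \<zero>\<^bsub>R\<^esub>} \<union> {p. w p \<noteq> \<zero>\<^bsub>R\<^esub>}"
    have T: "finite ?T" "?T \<subseteq> S" using v w by auto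
    have "L (v \<oplus>\<^bsub>free_mod R S\<^esub> w) = (\<Oplus>\<^bsub>N\<^esub>p\<in>?T. (v p \<oplus>\<^bsub>R\<^esub> w p) \<odot>\<^bsub>N\<^esub> e p)"
    proof -
      have "{p. (v \<oplus>\<^bsub>free_mod R S\<^esub> w) p \<noteq> \<zero>\<^bsub>R\<^esub>} \<subseteq> ?T" by auto
      then show ?thesis using L[OF F.M.add.m_closed[OF v w] T(1) _ T(2)] by simp
    qed
    also have "\<dots> = (\<Oplus>\<^bsub>N\<^esub>p\<in>?T. v p \<odot>\<^bsub>N\<^esub> e p \<oplus>\<^bsub>N\<^esub> w p \<odot>\<^bsub>N\<^esub> e p)"
      by (rule N.M.add.finprod_cong') (use v w T e in \<open>auto simp: N.smult_l_distr subset_iff\<close>)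
    also have "\<dots> = L v \<oplus>\<^bsub>N\<^esub> L w"
      using L[OF v T(1) _ T(2)] L[OF w T(1) _ T(2)] v w T e
      by (subst N.M.finsum_addf) (auto simp: subset_iff)
    finally show "L (v \<oplus>\<^bsub>free_mod R S\<^esub> w) = L v \<oplus>\<^bsub>N\<^esub> L w" .
  next
    fix r w assume r: "r \<in> carrier R" and w: "w \<in> carrier (free_mod R S)"
    interpret F: module R "free_mod R S" using assms(1) by (rule free_mod_module)
    let ?T = "{p. w p \<noteq> \<zero>\<^bsub>R\<^esub>}"
    have T: "finite ?T" "?T \<subseteq> S" using w by auto
    have "L (r \<odot>\<^bsub>free_mod R S\<^esub> w) = (\<Oplus>\<^bsub>N\<^esub>p\<in>?T. (r \<otimes>\<^bsub>R\<^esub> w p) \<odot>\<^bsub>N\<^esub> e p)"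
    proof -
      have "{p. (r \<odot>\<^bsub>free_mod R S\<^esub> w) p \<noteq> \<zero>\<^bsub>R\<^esub>} \<subseteq> ?T" using r by auto
      then show ?thesis using L[OF F.smult_closed[OF r w] T(1) _ T(2)] by simp
    qed
    also have "\<dots> = (\<Oplus>\<^bsub>N\<^esub>p\<in>?T. r \<odot>\<^bsub>N\<^esub> (w p \<odot>\<^bsub>N\<^esub> e p))"
      by (rule N.M.add.finprod_cong') (use r w T e in \<open>auto simp: N.smult_assoc1 subset_iff\<close>)
    also have "\<dots> = r \<odot>\<^bsub>N\<^esub> L w"
      unfolding L_def by (rule N.finsum_smult_ldistr[symmetric]) (use r w T e in \<open>auto simp: subset_iff\<close>)
    finally show "L (r \<odot>\<^bsub>free_mod R S\<^esub> w) = r \<odot>\<^bsub>N\<^esub> L w" .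
  next
    fix w assume "w \<in> carrier (free_mod R S)"
    then show "L w \<in> carrier N"
      unfolding L_def by (intro N.M.finsum_closed) (use e in \<open>auto simp: subset_iff\<close>)
  qed
  moreover have "L (free_gen R p) = e p" if "p \<in> S" for p
  proof -
    have "L (free_gen R p) = (\<Oplus>\<^bsub>N\<^esub>q\<in>{p}. free_gen R p q \<odot>\<^bsub>N\<^esub> e q)"
      by (rule L[OF free_gen_closed[OF assms(1) that]]) (use that in \<open>auto simp: free_gen_def\<close>)
    also have "\<dots> = e p" using e[OF that] by (simp add: free_gen_def)
    finally show ?thesis .
  qed
  ultimately show ?thesis by (rule that)
qed

subsection \<open>The universal property\<close>

text \<open>Linearity in each argument is exactly the four families of relations that define the tensor product.\<close>

definition bilinear_map ::
    "'a ring \<Rightarrow> ('a, 'm) module \<Rightarrow> ('a, 'n) module \<Rightarrow> ('a, 'p) module \<Rightarrow> ('m \<Rightarrow> 'n \<Rightarrow> 'p) \<Rightarrow> bool" where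
  "bilinear_map R M N P b \<longleftrightarrow>
    (\<forall>y\<in>carrier N. linear_map R M P (\<lambda>x. b x y)) \<and> (\<forall>x\<in>carrier M. linear_map R N P (b x))"

lemma tensor_rel_submodule:
  assumes "module R M" "module R N"
  shows "submodule (tensor_rel R M N) R (free_mod R (carrier M \<times> carrier N))"
proof -
  interpret M: module R M by fact
  interpret N: module R N by fact
  interpret F: module R "free_mod R (carrier M \<times> carrier N)"
    by (rule free_mod_module[OF M.R.is_cring])
  note g = free_gen_closed[OF M.R.is_cring]
  show ?thesis
    unfolding tensor_rel_def Let_def
    by (rule span_mod_submodule[OF F.module_axioms])
      (auto simp del: free_mod_simps intro!: F.M.minus_closed F.M.add.m_closed F.smult_closed g)
qed

lemma tensor_mod_module:
  assumes "module R M" "module R N"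
  shows "module R (tensor_mod R M N)"
  unfolding tensor_mod_def
  by (rule quot_mod_module[OF free_mod_module tensor_rel_submodule[OF assms]])
    (use assms in \<open>simp add: module_def\<close>)

lemma pure_tensor_bilinear:
  assumes "module R M" "module R N"
  shows "bilinear_map R M N (tensor_mod R M N) (pure_tensor R M N)"
proof -
  interpret M: module R M by fact
  interpret N: module R N by fact
  let ?F = "free_mod R (carrier M \<times> carrier N)"
  let ?H = "tensor_rel R M N"
  interpret F: module R ?F by (rule free_mod_module[OF M.R.is_cring])
  note g = free_gen_closed[OF M.R.is_cring]
  note H = tensor_rel_submodule[OF assms]
  note ce = coset_eq_iff[OF F.module_axioms H]
  note ops = quot_mod_ops[OF F.module_axioms H, symmetric]
  note [simp del] = free_mod_simps
  have rels:
    "\<lbrakk>x \<in> carrier M; x' \<in> carrier M; y \<in> carrier N\<rbrakk> \<Longrightarrow>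
      free_gen R (x \<oplus>\<^bsub>M\<^esub> x', y) \<ominus>\<^bsub>?F\<^esub> (free_gen R (x, y) \<oplus>\<^bsub>?F\<^esub> free_gen R (x', y)) \<in> ?H"
    "\<lbrakk>x \<in> carrier M; y \<in> carrier N; y' \<in> carrier N\<rbrakk> \<Longrightarrow>
      free_gen R (x, y \<oplus>\<^bsub>N\<^esub> y') \<ominus>\<^bsub>?F\<^esub> (free_gen R (x, y) \<oplus>\<^bsub>?F\<^esub> free_gen R (x, y')) \<in> ?H"
    "\<lbrakk>r \<in> carrier R; x \<in> carrier M; y \<in> carrier N\<rbrakk> \<Longrightarrow>
      free_gen R (r \<odot>\<^bsub>M\<^esub> x, y) \<ominus>\<^bsub>?F\<^esub> (r \<odot>\<^bsub>?F\<^esub> free_gen R (x, y)) \<in> ?H"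
    "\<lbrakk>r \<in> carrier R; x \<in> carrier M; y \<in> carrier N\<rbrakk> \<Longrightarrow>
      free_gen R (x, r \<odot>\<^bsub>N\<^esub> y) \<ominus>\<^bsub>?F\<^esub> (r \<odot>\<^bsub>?F\<^esub> free_gen R (x, y)) \<in> ?H"
    for x x' y y' r
    unfolding tensor_rel_def Let_def by (rule subsetD[OF span_mod_superset], blast)+
  have cl: "pure_tensor R M N x y \<in> carrier (tensor_mod R M N)"
    if "x \<in> carrier M" "y \<in> carrier N" for x y
    unfolding pure_tensor_def tensor_mod_def quot_mod_carrier using that by (intro imageI g) auto
  show ?thesis
    unfolding bilinear_map_def
  proof (intro conjI ballI)
    fix y assume y: "y \<in> carrier N"
    show "linear_map R M (tensor_mod R M N) (\<lambda>x. pure_tensor R M N x y)"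
    proof (rule linear_mapI)
      show "pure_tensor R M N x y \<in> carrier (tensor_mod R M N)" if "x \<in> carrier M" for x
        using that y by (rule cl)
      show "pure_tensor R M N (x \<oplus>\<^bsub>M\<^esub> x') y =
        pure_tensor R M N x y \<oplus>\<^bsub>tensor_mod R M N\<^esub> pure_tensor R M N x' y"
        if x: "x \<in> carrier M" "x' \<in> carrier M" for x x'
        unfolding pure_tensor_def tensor_mod_def
        using x y by (subst ops) (simp_all add: g ce rels)
      show "pure_tensor R M N (r \<odot>\<^bsub>M\<^esub> x) y = r \<odot>\<^bsub>tensor_mod R M N\<^esub> pure_tensor R M N x y"
        if "r \<in> carrier R" "x \<in> carrier M" for r x
        unfolding pure_tensor_def tensor_mod_def
        using that y by (subst ops) (simp_all add: g ce rels)
    qed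
  next
    fix x assume x: "x \<in> carrier M"
    show "linear_map R N (tensor_mod R M N) (pure_tensor R M N x)"
    proof (rule linear_mapI)
      show "pure_tensor R M N x y \<in> carrier (tensor_mod R M N)" if "y \<in> carrier N" for y
        using x that by (rule cl)
      show "pure_tensor R M N x (y \<oplus>\<^bsub>N\<^esub> y') =
        pure_tensor R M N x y \<oplus>\<^bsub>tensor_mod R M N\<^esub> pure_tensor R M N x y'"
        if "y \<in> carrier N" "y' \<in> carrier N" for y y'
        unfolding pure_tensor_def tensor_mod_def
        using x that by (subst ops) (simp_all add: g ce rels)
      show "pure_tensor R M N x (r \<odot>\<^bsub>N\<^esub> y) = r \<odot>\<^bsub>tensor_mod R M N\<^esub> pure_tensor R M N x y"
        if "r \<in> carrier R" "y \<in> carrier N" for r y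
        unfolding pure_tensor_def tensor_mod_def
        using x that by (subst ops) (simp_all add: g ce rels)
    qed
  qed
qed

lemmas pure_tensor_left = pure_tensor_bilinear[unfolded bilinear_map_def, THEN conjunct1, rule_format]
lemmas pure_tensor_right = pure_tensor_bilinear[unfolded bilinear_map_def, THEN conjunct2, rule_format]

text \<open>Pulled back to the free module, \<open>H\<close> is a submodule that contains all generators.\<close>

lemma tensor_induct:
  assumes "module R M" "module R N" and H: "submodule H R (tensor_mod R M N)"
    and pure: "\<And>x y. \<lbrakk>x \<in> carrier M; y \<in> carrier N\<rbrakk> \<Longrightarrow> pure_tensor R M N x y \<in> H"
  shows "carrier (tensor_mod R M N) \<subseteq> H"
proof -
  interpret M: module R M by fact
  let ?F = "free_mod R (carrier M \<times> carrier N)"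
  let ?p = "\<lambda>w. tensor_rel R M N +>\<^bsub>?F\<^esub> w"
  have F: "module R ?F" by (rule free_mod_module[OF M.R.is_cring])
  have p: "linear_map R ?F (tensor_mod R M N) ?p"
    unfolding tensor_mod_def by (rule quot_mod_proj[OF F tensor_rel_submodule[OF assms(1,2)]])
  have "carrier ?F \<subseteq> {w \<in> carrier ?F. ?p w \<in> H}"
    by (rule free_mod_induct[OF M.R.is_cring preimage_submodule[OF F tensor_mod_module[OF assms(1,2)] p H]])
      (use pure in \<open>auto simp: pure_tensor_def simp del: free_mod_simps intro!: free_gen_closed M.R.is_cring\<close>)
  then show ?thesis unfolding tensor_mod_def quot_mod_carrier by blast
qed

lemma tensor_hom_eqI:
  assumes "module R M" "module R N" "module R P"
    and f: "f \<in> mod_hom R (tensor_mod R M N) P" and g: "g \<in> mod_hom R (tensor_mod R M N) P"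
    and eq: "\<And>x y. \<lbrakk>x \<in> carrier M; y \<in> carrier N\<rbrakk> \<Longrightarrow> f (pure_tensor R M N x y) = g (pure_tensor R M N x y)"
  shows "f = g"
proof -
  let ?H = "{t \<in> carrier (tensor_mod R M N). f t = g t}"
  have "carrier (tensor_mod R M N) \<subseteq> ?H"
    by (rule tensor_induct[OF assms(1,2) equalizer_submodule[OF tensor_mod_module[OF assms(1,2)] assms(3)
            mod_homD[OF f] mod_homD[OF g]]])
      (auto simp: eq linear_map_closed[OF pure_tensor_left[OF assms(1,2)]])
  then show ?thesis by (intro mod_hom_eqI[OF f g]) auto
qed

text \<open>The linear extension of \<open>b\<close> to the free module kills the defining relations because \<open>b\<close> is bilinear,
  hence factors through the quotient.\<close>

lemma tensor_lift:
  assumes "module R M" "module R N" "module R P" and b: "bilinear_map R M N P b"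
  obtains h where "h \<in> mod_hom R (tensor_mod R M N) P"
    "\<And>x y. \<lbrakk>x \<in> carrier M; y \<in> carrier N\<rbrakk> \<Longrightarrow> h (pure_tensor R M N x y) = b x y"
proof -
  interpret M: module R M by fact
  interpret N: module R N by fact
  interpret P: module R P by fact
  let ?F = "free_mod R (carrier M \<times> carrier N)"
  interpret F: module R ?F by (rule free_mod_module[OF M.R.is_cring])
  note g = free_gen_closed[OF M.R.is_cring]
  note bl = b[unfolded bilinear_map_def, THEN conjunct1, rule_format]
  note br = b[unfolded bilinear_map_def, THEN conjunct2, rule_format]
  have bc: "b x y \<in> carrier P" if "x \<in> carrier M" "y \<in> carrier N" for x y
    using linear_map_closed[OF bl[OF that(2)] that(1)] .
  obtain L where L: "linear_map R ?F P L"
    and Lg: "\<And>p. p \<in> carrier M \<times> carrier N \<Longrightarrow> L (free_gen R p) = b (fst p) (snd p)"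
    using free_mod_lift[OF M.R.is_cring assms(3), of "carrier M \<times> carrier N" "\<lambda>p. b (fst p) (snd p)"]
      bc by (metis mem_Times_iff)
  note Ld = linear_map_diff[OF F.module_axioms assms(3) L]
  note [simp del] = free_mod_simps
  have diff: "u \<ominus>\<^bsub>?F\<^esub> v \<in> carrier ?F \<and> L (u \<ominus>\<^bsub>?F\<^esub> v) = \<zero>\<^bsub>P\<^esub>"
    if "u \<in> carrier ?F" "v \<in> carrier ?F" "L u = L v" for u v
    using that Ld[of u v] module_diff_eq_zero_iff[OF assms(3)] linear_map_closed[OF L]
    by simp
  have "tensor_rel R M N \<subseteq> {x \<in> carrier ?F. L x = \<zero>\<^bsub>P\<^esub>}"
    unfolding tensor_rel_def Let_def
  proof (rule span_mod_minimal[OF _ kernel_submodule[OF F.module_axioms assms(3) L]], intro Un_least subsetI)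
    fix x assume "x \<in> {free_gen R (x \<oplus>\<^bsub>M\<^esub> x', y) \<ominus>\<^bsub>?F\<^esub> (free_gen R (x, y) \<oplus>\<^bsub>?F\<^esub> free_gen R (x', y)) | x x' y.
          x \<in> carrier M \<and> x' \<in> carrier M \<and> y \<in> carrier N}"
    then show "x \<in> {x \<in> carrier ?F. L x = \<zero>\<^bsub>P\<^esub>}"
      by clarify (rule diff; simp add: g Lg linear_map_add[OF L] linear_map_add[OF bl])
  next
    fix x assume "x \<in> {free_gen R (x, y \<oplus>\<^bsub>N\<^esub> y') \<ominus>\<^bsub>?F\<^esub> (free_gen R (x, y) \<oplus>\<^bsub>?F\<^esub> free_gen R (x, y')) | x y y'.
          x \<in> carrier M \<and> y \<in> carrier N \<and> y' \<in> carrier N}"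
    then show "x \<in> {x \<in> carrier ?F. L x = \<zero>\<^bsub>P\<^esub>}"
      by clarify (rule diff; simp add: g Lg linear_map_add[OF L] linear_map_add[OF br])
  next
    fix x assume "x \<in> {free_gen R (r \<odot>\<^bsub>M\<^esub> x, y) \<ominus>\<^bsub>?F\<^esub> (r \<odot>\<^bsub>?F\<^esub> free_gen R (x, y)) | r x y.
          r \<in> carrier R \<and> x \<in> carrier M \<and> y \<in> carrier N}"
    then show "x \<in> {x \<in> carrier ?F. L x = \<zero>\<^bsub>P\<^esub>}"
      by clarify (rule diff; simp add: g Lg linear_map_smult[OF L] linear_map_smult[OF bl])
  next
    fix x assume "x \<in> {free_gen R (x, r \<odot>\<^bsub>N\<^esub> y) \<ominus>\<^bsub>?F\<^esub> (r \<odot>\<^bsub>?F\<^esub> free_gen R (x, y)) | r x y.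
          r \<in> carrier R \<and> x \<in> carrier M \<and> y \<in> carrier N}"
    then show "x \<in> {x \<in> carrier ?F. L x = \<zero>\<^bsub>P\<^esub>}"
      by clarify (rule diff; simp add: g Lg linear_map_smult[OF L] linear_map_smult[OF br])
  qed
  then have "L h = \<zero>\<^bsub>P\<^esub>" if "h \<in> tensor_rel R M N" for h using that by auto
  then obtain h where h: "h \<in> mod_hom R (tensor_mod R M N) P"
    and hL: "\<And>w. w \<in> carrier ?F \<Longrightarrow> h (tensor_rel R M N +>\<^bsub>?F\<^esub> w) = L w"
    using quot_mod_lift[OF F.module_axioms tensor_rel_submodule[OF assms(1,2)] assms(3) L]
    unfolding tensor_mod_def by metis
  show ?thesis
    by (rule that[OF h]) (simp add: pure_tensor_def hL g Lg)
qed

text \<open>Existence comes from the universal property and uniqueness from the fact that pure tensors generate;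
  together they justify the definite description by which \<open>f \<otimes> g\<close> is defined.\<close>

lemma tensor_map_props:
  assumes "module R M" "module R N" "module R M'" "module R N'"
    and f: "linear_map R M M' f" and g: "linear_map R N N' g"
  shows tensor_map_hom: "tensor_map R M N M' N' f g \<in> mod_hom R (tensor_mod R M N) (tensor_mod R M' N')"
    and tensor_map_pure: "\<lbrakk>x \<in> carrier M; y \<in> carrier N\<rbrakk> \<Longrightarrow>
      tensor_map R M N M' N' f g (pure_tensor R M N x y) = pure_tensor R M' N' (f x) (g y)"
proof -
  let ?P = "\<lambda>h. h \<in> mod_hom R (tensor_mod R M N) (tensor_mod R M' N') \<and>
      (\<forall>x\<in>carrier M. \<forall>y\<in>carrier N.
        h (pure_tensor R M N x y) = pure_tensor R M' N' (f x) (g y))"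
  have "bilinear_map R M N (tensor_mod R M' N') (\<lambda>x y. pure_tensor R M' N' (f x) (g y))"
    unfolding bilinear_map_def
    by (auto intro!: linear_map_comp[OF f pure_tensor_left[OF assms(3,4)]]
        linear_map_comp[OF g pure_tensor_right[OF assms(3,4)]] linear_map_closed[OF f] linear_map_closed[OF g])
  then obtain h where h: "?P h"
    using tensor_lift[OF assms(1,2) tensor_mod_module[OF assms(3,4)]] by metis
  have "?P (tensor_map R M N M' N' f g)"
    unfolding tensor_map_def
  proof (rule theI[where P = ?P, OF h])
    fix k assume k: "?P k"
    show "k = h"
      by (rule tensor_hom_eqI[OF assms(1,2) tensor_mod_module[OF assms(3,4)]]) (use h k in auto)
  qed
  then show "tensor_map R M N M' N' f g \<in> mod_hom R (tensor_mod R M N) (tensor_mod R M' N')"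
    and "\<lbrakk>x \<in> carrier M; y \<in> carrier N\<rbrakk> \<Longrightarrow>
      tensor_map R M N M' N' f g (pure_tensor R M N x y) = pure_tensor R M' N' (f x) (g y)"
    by auto
qed

section \<open>Powers of an ideal, reduced and coreduced modules\<close>

lemma ideals_set_simps [simp]:
  "\<one>\<^bsub>ideals_set R\<^esub> = carrier R" "I \<otimes>\<^bsub>ideals_set R\<^esub> J = ideal_prod R I J"
  by (simp_all add: ideals_set_def)

lemma ideal_pow_0: "ideal_pow R I 0 = carrier R"
  and ideal_pow_Suc: "ideal_pow R I (Suc k) = ideal_prod R (ideal_pow R I k) I"
  by (simp_all add: nat_pow_def ideals_set_def)

lemma ideal_pow_ideal:
  assumes "cring R" "ideal I R"
  shows "ideal (ideal_pow R I k) R"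
proof -
  interpret cring R by fact
  show ?thesis
    by (induction k) (auto simp: ideal_pow_0 ideal_pow_Suc oneideal assms(2) intro: ideal_prod_is_ideal)
qed

lemma ideal_pow_1:
  assumes "cring R" "ideal I R"
  shows "ideal_pow R I (Suc 0) = I"
proof -
  interpret cring R by fact
  show ?thesis
    using ideal_prod_one[OF assms(2)] ideal_prod_commute[OF assms(2) oneideal]
    by (simp add: ideal_pow_0 ideal_pow_Suc)
qed

lemma ideal_pow_2:
  assumes "cring R" "ideal I R"
  shows "ideal_pow R I 2 = ideal_prod R I I"
  unfolding numeral_2_eq_2 ideal_pow_Suc[of _ _ "Suc 0"] ideal_pow_1[OF assms] ..

lemma ideal_pow_antimono:
  assumes "cring R" "ideal I R" "k \<le> l"
  shows "ideal_pow R I l \<subseteq> ideal_pow R I k"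
  using assms(3)
proof (induction l rule: dec_induct)
  case (step n)
  interpret cring R by fact
  show ?case
    using ideal_prod_inter[OF ideal_pow_ideal[OF assms(1,2)] assms(2), of n] step.IH
    by (auto simp: ideal_pow_Suc)
qed auto

subsection \<open>Torsion elements\<close>

definition annihilated_elements :: "'a set \<Rightarrow> ('a, 'm) module \<Rightarrow> 'm set" where
  "annihilated_elements J M = {m \<in> carrier M. \<forall>x\<in>J. x \<odot>\<^bsub>M\<^esub> m = \<zero>\<^bsub>M\<^esub>}"

lemma annihilated_elements_antimono: "J \<subseteq> K \<Longrightarrow> annihilated_elements K M \<subseteq> annihilated_elements J M"
  by (auto simp: annihilated_elements_def)

lemma annihilated_by_product_iff:
  assumes "module R M" "ideal J R" "ideal K R" "m \<in> carrier M"
  shows "m \<in> annihilated_elements (ideal_prod R J K) M \<longleftrightarrow>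
    (\<forall>j\<in>J. \<forall>k\<in>K. (j \<otimes>\<^bsub>R\<^esub> k) \<odot>\<^bsub>M\<^esub> m = \<zero>\<^bsub>M\<^esub>)"
proof -
  interpret M: module R M by fact
  have "x \<odot>\<^bsub>M\<^esub> m = \<zero>\<^bsub>M\<^esub>" if jk: "\<forall>j\<in>J. \<forall>k\<in>K. (j \<otimes>\<^bsub>R\<^esub> k) \<odot>\<^bsub>M\<^esub> m = \<zero>\<^bsub>M\<^esub>" and "x \<in> ideal_prod R J K" for x
    using that(2)
  proof induction
    case (sum s t)
    then have "s \<in> carrier R" "t \<in> carrier R"
      using M.R.ideal_prod_in_carrier[OF assms(2,3)] by auto
    then show ?case using sum assms(4) by (simp add: M.smult_l_distr)
  qed (use jk in auto)
  then show ?thesis using assms(4) by (auto simp: annihilated_elements_def intro: ideal_prod.prod)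
qed

text \<open>Suppose \<open>I\<^sup>k\<^sup>+\<^sup>2m = 0\<close> and let \<open>j \<in> I\<^sup>k\<close>. For \<open>b, c \<in> I\<close> the product \<open>jbc\<close> lies in \<open>I\<^sup>k\<^sup>+\<^sup>2\<close>, so
  \<open>I\<^sup>2(jm) = 0\<close>; as \<open>M\<close> is reduced, \<open>I(jm) = 0\<close>. The products \<open>ja\<close> with \<open>a \<in> I\<close> generate \<open>I\<^sup>k\<^sup>+\<^sup>1\<close>.\<close>

lemma annihilated_by_power_Suc_Suc:
  assumes "module R M" "ideal I R" "reduced_mod R I M"
  shows "annihilated_elements (ideal_pow R I (Suc (Suc k))) M \<subseteq> annihilated_elements (ideal_pow R I (Suc k)) M"
proof
  interpret M: module R M by fact
  interpret I: ideal I R by fact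
  note R = M.R.is_cring
  interpret K: ideal "ideal_pow R I k" R by (rule ideal_pow_ideal[OF R assms(2)])
  fix m assume m: "m \<in> annihilated_elements (ideal_pow R I (Suc (Suc k))) M"
  then have mM: "m \<in> carrier M" by (simp add: annihilated_elements_def)
  show "m \<in> annihilated_elements (ideal_pow R I (Suc k)) M"
    unfolding ideal_pow_Suc annihilated_by_product_iff[OF assms(1) K.ideal_axioms assms(2) mM]
  proof (intro ballI)
    fix j a assume j: "j \<in> ideal_pow R I k" and a: "a \<in> I"
    have jR: "j \<in> carrier R" and aR: "a \<in> carrier R" using j a K.a_subset I.a_subset by auto
    have jm: "j \<odot>\<^bsub>M\<^esub> m \<in> carrier M" using jR mM by simp
    have "j \<odot>\<^bsub>M\<^esub> m \<in> annihilated_elements (ideal_pow R I 2) M"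
      unfolding ideal_pow_2[OF R assms(2)] annihilated_by_product_iff[OF assms(1,2,2) jm]
    proof (intro ballI)
      fix b c assume b: "b \<in> I" and c: "c \<in> I"
      have bR: "b \<in> carrier R" and cR: "c \<in> carrier R" using b c I.a_subset by auto
      have "(j \<otimes>\<^bsub>R\<^esub> b) \<otimes>\<^bsub>R\<^esub> c \<in> ideal_pow R I (Suc (Suc k))"
        unfolding ideal_pow_Suc using j b c by (intro ideal_prod.prod)
      then have "((j \<otimes>\<^bsub>R\<^esub> b) \<otimes>\<^bsub>R\<^esub> c) \<odot>\<^bsub>M\<^esub> m = \<zero>\<^bsub>M\<^esub>" using m by (simp add: annihilated_elements_def)
      moreover have "(j \<otimes>\<^bsub>R\<^esub> b) \<otimes>\<^bsub>R\<^esub> c = (b \<otimes>\<^bsub>R\<^esub> c) \<otimes>\<^bsub>R\<^esub> j"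
        using jR bR cR by (simp add: M.R.m_ac)
      ultimately show "(b \<otimes>\<^bsub>R\<^esub> c) \<odot>\<^bsub>M\<^esub> (j \<odot>\<^bsub>M\<^esub> m) = \<zero>\<^bsub>M\<^esub>"
        using jR bR cR mM by (simp add: M.smult_assoc1)
    qed
    then have "a \<odot>\<^bsub>M\<^esub> (j \<odot>\<^bsub>M\<^esub> m) = \<zero>\<^bsub>M\<^esub>"
      using assms(3) jm a by (auto simp: reduced_mod_def annihilated_elements_def)
    then show "(j \<otimes>\<^bsub>R\<^esub> a) \<odot>\<^bsub>M\<^esub> m = \<zero>\<^bsub>M\<^esub>"
      using jR aR mM by (simp add: M.smult_assoc1[symmetric] M.R.m_comm)
  qed
qed

lemma annihilated_by_power:
  assumes "module R M" "ideal I R" "reduced_mod R I M"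
  shows "annihilated_elements (ideal_pow R I k) M \<subseteq> annihilated_elements I M"
proof -
  interpret M: module R M by fact
  have "annihilated_elements (ideal_pow R I (Suc k)) M \<subseteq> annihilated_elements I M"
    using annihilated_by_power_Suc_Suc[OF assms] ideal_pow_1[OF M.R.is_cring assms(2)]
    by (induction k) (auto simp del: One_nat_def)
  moreover have "annihilated_elements (ideal_pow R I k) M \<subseteq> annihilated_elements (ideal_pow R I (Suc k)) M"
    by (intro annihilated_elements_antimono ideal_pow_antimono M.R.is_cring assms(2)) auto
  ultimately show ?thesis by blast
qed

text \<open>Together with its counterpart for coreduced modules this is how torsion lands in the coreduced and
  completion in the reduced complexes: both produce modules killed by \<open>I\<close>.\<close>

lemma annihilated_imp_reduced: "carrier M \<subseteq> annihilated_elements I M \<Longrightarrow> reduced_mod R I M"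
  by (auto simp: annihilated_elements_def reduced_mod_def)

subsection \<open>The submodules JM\<close>

lemma ideal_smult_submodule:
  assumes "module R M" "J \<subseteq> carrier R"
  shows "submodule (ideal_smult R J M) R M"
proof -
  interpret M: module R M by fact
  show ?thesis
    unfolding ideal_smult_def by (rule span_mod_submodule[OF assms(1)]) (use assms(2) in auto)
qed

lemma ideal_smult_memI: "\<lbrakk>x \<in> J; m \<in> carrier M\<rbrakk> \<Longrightarrow> x \<odot>\<^bsub>M\<^esub> m \<in> ideal_smult R J M"
  unfolding ideal_smult_def by (rule subsetD[OF span_mod_superset]) auto

lemma ideal_smult_least:
  assumes "submodule H R M" "\<And>x m. \<lbrakk>x \<in> J; m \<in> carrier M\<rbrakk> \<Longrightarrow> x \<odot>\<^bsub>M\<^esub> m \<in> H"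
  shows "ideal_smult R J M \<subseteq> H"
  unfolding ideal_smult_def by (rule span_mod_minimal[OF _ assms(1)]) (use assms(2) in auto)

lemma ideal_smult_mono:
  assumes "module R M" "J \<subseteq> K" "K \<subseteq> carrier R"
  shows "ideal_smult R J M \<subseteq> ideal_smult R K M"
  by (rule ideal_smult_least[OF ideal_smult_submodule[OF assms(1,3)]])
    (use assms(2) in \<open>auto intro: ideal_smult_memI\<close>)

text \<open>The elements that \<open>j\<close> multiplies into \<open>KJM\<close> form a submodule, and it contains \<open>km\<close> for \<open>k \<in> K\<close>.\<close>

lemma ideal_smult_product:
  assumes "module R M" "ideal J R" "ideal K R" "j \<in> J" "m \<in> ideal_smult R K M"
  shows "j \<odot>\<^bsub>M\<^esub> m \<in> ideal_smult R (ideal_prod R K J) M"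
proof -
  interpret M: module R M by fact
  interpret J: ideal J R by fact
  interpret K: ideal K R by fact
  let ?S = "ideal_smult R (ideal_prod R K J) M"
  have jR: "j \<in> carrier R" using assms(4) J.a_subset by auto
  have "linear_map R M M (\<lambda>x. j \<odot>\<^bsub>M\<^esub> x)"
    by (rule linear_mapI)
      (use jR in \<open>auto simp: M.smult_r_distr M.smult_assoc1[symmetric] M.R.m_comm\<close>)
  then have "submodule {x \<in> carrier M. j \<odot>\<^bsub>M\<^esub> x \<in> ?S} R M"
    by (intro preimage_submodule[OF assms(1,1)] ideal_smult_submodule assms(1)
        M.R.ideal_prod_in_carrier assms(2,3))
  moreover have "j \<odot>\<^bsub>M\<^esub> (k \<odot>\<^bsub>M\<^esub> x) \<in> ?S" if "k \<in> K" "x \<in> carrier M" for k x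
  proof -
    have "k \<in> carrier R" using that K.a_subset by auto
    then have "j \<odot>\<^bsub>M\<^esub> (k \<odot>\<^bsub>M\<^esub> x) = (k \<otimes>\<^bsub>R\<^esub> j) \<odot>\<^bsub>M\<^esub> x"
      using jR that by (simp add: M.smult_assoc1[symmetric] M.R.m_comm)
    then show ?thesis using that assms(4) by (auto intro: ideal_smult_memI ideal_prod.prod)
  qed
  ultimately have "ideal_smult R K M \<subseteq> {x \<in> carrier M. j \<odot>\<^bsub>M\<^esub> x \<in> ?S}"
    using K.a_subset by (intro ideal_smult_least) auto
  then show ?thesis using assms(5) by auto
qed

text \<open>By induction, \<open>IM = I\<^sup>2M = I(IM) \<subseteq> I(I\<^sup>k\<^sup>+\<^sup>1M) \<subseteq> I\<^sup>k\<^sup>+\<^sup>2M\<close>.\<close>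

lemma ideal_smult_power_Suc:
  assumes "module R M" "ideal I R" "coreduced_mod R I M"
  shows "ideal_smult R I M \<subseteq> ideal_smult R (ideal_pow R I (Suc k)) M"
proof (induction k)
  interpret M: module R M by fact
  note R = M.R.is_cring
  case 0
  show ?case using ideal_pow_1[OF R assms(2)] by simp
  case (Suc k)
  interpret K: ideal "ideal_pow R I (Suc k)" R by (rule ideal_pow_ideal[OF R assms(2)])
  interpret K': ideal "ideal_pow R I (Suc (Suc k))" R by (rule ideal_pow_ideal[OF R assms(2)])
  interpret I: ideal I R by fact
  let ?S = "ideal_smult R (ideal_pow R I (Suc (Suc k))) M"
  note S = ideal_smult_submodule[OF assms(1) K'.a_subset]
  have "x \<odot>\<^bsub>M\<^esub> m \<in> ?S" if "x \<in> ideal_prod R I I" and m: "m \<in> carrier M" for x m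
    using that(1)
  proof induction
    case (prod a b)
    then have "b \<odot>\<^bsub>M\<^esub> m \<in> ideal_smult R (ideal_pow R I (Suc k)) M"
      using Suc.IH m by (auto intro: ideal_smult_memI)
    then have "a \<odot>\<^bsub>M\<^esub> (b \<odot>\<^bsub>M\<^esub> m) \<in> ?S"
      using ideal_smult_product[OF assms(1,2) K.ideal_axioms prod(1)] by (simp only: ideal_pow_Suc)
    moreover have "a \<in> carrier R" "b \<in> carrier R" using prod I.a_subset by auto
    ultimately show ?case using m by (simp add: M.smult_assoc1)
  next
    case (sum s t)
    then have "s \<in> carrier R" "t \<in> carrier R"
      using M.R.ideal_prod_in_carrier[OF assms(2,2)] by auto
    then show ?case using sum m M.submoduleE(5)[OF S] by (simp add: M.smult_l_distr)
  qed
  then have "ideal_smult R (ideal_prod R I I) M \<subseteq> ?S"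
    by (rule ideal_smult_least[OF S])
  then show ?case using assms(3) by (simp add: coreduced_mod_def ideal_pow_2[OF R assms(2)])
qed

lemma annihilated_imp_ideal_smult_zero:
  assumes "module R M" "carrier M \<subseteq> annihilated_elements J M"
  shows "ideal_smult R J M = {\<zero>\<^bsub>M\<^esub>}"
proof
  interpret M: module R M by fact
  have z: "submodule {\<zero>\<^bsub>M\<^esub>} R M"
    using module_diff_eq_zero_iff[OF assms(1)] M.M.minus_equality[of "\<zero>\<^bsub>M\<^esub>" "\<zero>\<^bsub>M\<^esub>"]
    by (intro M.submoduleI) auto
  show "ideal_smult R J M \<subseteq> {\<zero>\<^bsub>M\<^esub>}"
    by (rule ideal_smult_least[OF z]) (use assms(2) in \<open>auto simp: annihilated_elements_def\<close>)
  have "\<zero>\<^bsub>M\<^esub> \<in> H" if "submodule H R M" for H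
  proof -
    interpret submodule H R M by fact
    show ?thesis using one_closed by simp
  qed
  then show "{\<zero>\<^bsub>M\<^esub>} \<subseteq> ideal_smult R J M"
    by (auto simp: ideal_smult_def span_mod_def hull_def)
qed

lemma annihilated_imp_coreduced:
  assumes "module R M" "ideal I R" "carrier M \<subseteq> annihilated_elements I M"
  shows "coreduced_mod R I M"
proof -
  interpret M: module R M by fact
  have "ideal_pow R I 2 \<subseteq> I"
    using ideal_pow_antimono[OF M.R.is_cring assms(2), of "Suc 0" 2] ideal_pow_1[OF M.R.is_cring assms(2)]
    by simp
  then have "carrier M \<subseteq> annihilated_elements (ideal_pow R I 2) M"
    by (rule order_trans[OF assms(3) annihilated_elements_antimono])
  then show ?thesis
    using annihilated_imp_ideal_smult_zero[OF assms(1)] assms(3) by (simp add: coreduced_mod_def)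
qed

section \<open>Homomorphisms from R/J and tensor products with R/J\<close>

abbreviation quot_one :: "'a ring \<Rightarrow> 'a set \<Rightarrow> 'a set" where
  "quot_one R J \<equiv> J +>\<^bsub>R\<^esub> \<one>\<^bsub>R\<^esub>"

lemma quot_one_generates:
  assumes "cring R" "ideal J R" "r \<in> carrier R"
  shows "J +>\<^bsub>R\<^esub> r = r \<odot>\<^bsub>quot_ring_mod R J\<^esub> quot_one R J"
proof -
  interpret cring R by fact
  show ?thesis using quot_ring_mod_smult[OF assms(1,2,3) one_closed] assms(3) by simp
qed

lemma quot_one_closed:
  assumes "cring R" "ideal J R"
  shows "quot_one R J \<in> carrier (quot_ring_mod R J)"
proof -
  interpret cring R by fact
  show ?thesis by (simp add: quot_ring_mod_carrier[OF assms])
qed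

lemma quot_one_annihilated:
  assumes "cring R" "ideal J R" "x \<in> J"
  shows "x \<odot>\<^bsub>quot_ring_mod R J\<^esub> quot_one R J = \<zero>\<^bsub>quot_ring_mod R J\<^esub>"
proof -
  interpret cring R by fact
  interpret J: ideal J R by fact
  have x: "x \<in> carrier R" using J.a_subset assms(3) by auto
  show ?thesis
    using assms(3) by (simp add: quot_one_generates[OF assms(1,2) x, symmetric]
        quot_ring_mod_zero[OF assms(1,2), symmetric] J.a_rcos_const J.a_subset)
qed

lemma eval_one_linear:
  assumes "module R M" "ideal J R"
  shows "linear_map R (Hom_mod R (quot_ring_mod R J) M) M (\<lambda>h. h (quot_one R J))"
proof -
  interpret M: module R M by fact
  show ?thesis
    using quot_one_closed[OF M.R.is_cring assms(2)]
    by (intro linear_mapI) (auto dest!: mod_homD intro: linear_map_closed)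
qed

lemma eval_one_inj:
  assumes "module R M" "ideal J R"
  shows "inj_on (\<lambda>h. h (quot_one R J)) (mod_hom R (quot_ring_mod R J) M)"
proof (rule inj_onI)
  interpret M: module R M by fact
  note R = M.R.is_cring
  fix g h assume g: "g \<in> mod_hom R (quot_ring_mod R J) M" and h: "h \<in> mod_hom R (quot_ring_mod R J) M"
    and eq: "g (quot_one R J) = h (quot_one R J)"
  show "g = h"
  proof (rule mod_hom_eqI[OF g h])
    fix X assume "X \<in> carrier (quot_ring_mod R J)"
    then obtain r where r: "r \<in> carrier R" "X = J +>\<^bsub>R\<^esub> r" by (auto simp: quot_ring_mod_carrier[OF R assms(2)])
    then show "g X = h X"
      using linear_map_smult[OF mod_homD[OF g] r(1) quot_one_closed[OF R assms(2)]]
        linear_map_smult[OF mod_homD[OF h] r(1) quot_one_closed[OF R assms(2)]] eq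
      by (simp add: quot_one_generates[OF R assms(2) r(1)])
  qed
qed

text \<open>An element \<open>x\<close> of \<open>J\<close> kills the generator \<open>1\<close> of \<open>R/J\<close>, hence kills \<open>h 1\<close>. Conversely, if \<open>J\<close> kills
  \<open>m\<close>, then \<open>r \<mapsto> rm\<close> factors through \<open>R/J\<close>.\<close>

lemma eval_one_image:
  assumes "module R M" "ideal J R"
  shows "(\<lambda>h. h (quot_one R J)) ` mod_hom R (quot_ring_mod R J) M = annihilated_elements J M"
proof (intro equalityI subsetI)
  interpret M: module R M by fact
  interpret J: ideal J R by fact
  note R = M.R.is_cring
  note q1 = quot_one_closed[OF R assms(2)]
  fix m assume "m \<in> (\<lambda>h. h (quot_one R J)) ` mod_hom R (quot_ring_mod R J) M"
  then obtain h where h: "linear_map R (quot_ring_mod R J) M h" and m: "m = h (quot_one R J)"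
    by (auto dest: mod_homD)
  have "x \<odot>\<^bsub>M\<^esub> m = \<zero>\<^bsub>M\<^esub>" if x: "x \<in> J" for x
  proof -
    have "x \<in> carrier R" using x J.a_subset by auto
    from linear_map_smult[OF h this q1]
    have "x \<odot>\<^bsub>M\<^esub> m = h \<zero>\<^bsub>quot_ring_mod R J\<^esub>" by (simp add: m quot_one_annihilated[OF R assms(2) x])
    then show ?thesis
      using linear_map_zero[OF quot_ring_mod_module[OF R assms(2)] assms(1) h] by simp
  qed
  then show "m \<in> annihilated_elements J M"
    using linear_map_closed[OF h q1] by (auto simp: annihilated_elements_def m)
next
  interpret M: module R M by fact
  interpret J: ideal J R by fact
  note R = M.R.is_cring
  fix m assume "m \<in> annihilated_elements J M"
  then have m: "m \<in> carrier M" and ann: "\<And>x. x \<in> J \<Longrightarrow> x \<odot>\<^bsub>M\<^esub> m = \<zero>\<^bsub>M\<^esub>"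
    by (auto simp: annihilated_elements_def)
  have lin: "linear_map R (self_mod R) M (\<lambda>r. r \<odot>\<^bsub>M\<^esub> m)"
    using m by (intro linear_mapI) (auto simp: M.smult_l_distr M.smult_assoc1)
  have "x \<odot>\<^bsub>M\<^esub> m = y \<odot>\<^bsub>M\<^esub> m" if "x \<in> carrier R" "y \<in> carrier R" "J +>\<^bsub>R\<^esub> x = J +>\<^bsub>R\<^esub> y" for x y
  proof -
    have "x \<odot>\<^bsub>M\<^esub> m \<ominus>\<^bsub>M\<^esub> y \<odot>\<^bsub>M\<^esub> m = (x \<ominus>\<^bsub>R\<^esub> y) \<odot>\<^bsub>M\<^esub> m"
      using that m by (simp add: a_minus_def M.smult_l_distr M.smult_l_minus)
    also have "\<dots> = \<zero>\<^bsub>M\<^esub>" using quot_ring_mod_eq_iff[OF R assms(2)] that by (auto intro: ann)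
    finally show ?thesis using module_diff_eq_zero_iff[OF assms(1)] that m by simp
  qed
  note const = this
  obtain h where h: "h \<in> mod_hom R (quot_ring_mod R J) M"
    "\<And>r. r \<in> carrier (self_mod R) \<Longrightarrow> h (J +>\<^bsub>R\<^esub> r) = r \<odot>\<^bsub>M\<^esub> m"
  proof (rule descend_along_surjection[OF self_mod_module[OF R] quot_ring_mod_proj[OF R assms(2)] _ lin])
    show "carrier (quot_ring_mod R J) = (\<lambda>r. J +>\<^bsub>R\<^esub> r) ` carrier (self_mod R)"
      by (simp add: quot_ring_mod_carrier[OF R assms(2)])
    show "x \<odot>\<^bsub>M\<^esub> m = y \<odot>\<^bsub>M\<^esub> m"
      if "x \<in> carrier (self_mod R)" "y \<in> carrier (self_mod R)" "J +>\<^bsub>R\<^esub> x = J +>\<^bsub>R\<^esub> y" for x y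
      by (rule const) (use that in simp_all)
  qed blast
  have "h (quot_one R J) = m" using h(2)[of "\<one>\<^bsub>R\<^esub>"] m by simp
  then show "m \<in> (\<lambda>h. h (quot_one R J)) ` mod_hom R (quot_ring_mod R J) M"
    using h(1) by blast
qed

definition one_tensor :: "'a ring \<Rightarrow> 'a set \<Rightarrow> ('a, 'm) module \<Rightarrow> 'm \<Rightarrow> ('a set \<times> 'm \<Rightarrow> 'a) set" where
  "one_tensor R J M = pure_tensor R (quot_ring_mod R J) M (quot_one R J)"

lemma one_tensor_linear:
  assumes "module R M" "ideal J R"
  shows "linear_map R M (tensor_mod R (quot_ring_mod R J) M) (one_tensor R J M)"
proof -
  interpret M: module R M by fact
  note R = M.R.is_cring
  show ?thesis
    unfolding one_tensor_def
    by (rule pure_tensor_right[OF quot_ring_mod_module[OF R assms(2)] assms(1) quot_one_closed[OF R assms(2)]])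
qed

lemma pure_tensor_smult_move:
  assumes "module R M" "module R N" "r \<in> carrier R" "x \<in> carrier M" "y \<in> carrier N"
  shows "pure_tensor R M N (r \<odot>\<^bsub>M\<^esub> x) y = pure_tensor R M N x (r \<odot>\<^bsub>N\<^esub> y)"
  using linear_map_smult[OF pure_tensor_left[OF assms(1,2,5)] assms(3,4)]
    linear_map_smult[OF pure_tensor_right[OF assms(1,2,4)] assms(3,5)] by simp

text \<open>Scalars move across the tensor sign, so \<open>(J + r) \<otimes> m = 1 \<otimes> rm\<close>.\<close>

lemma one_tensor_surj:
  assumes "module R M" "ideal J R"
  shows "carrier (tensor_mod R (quot_ring_mod R J) M) = one_tensor R J M ` carrier M"
proof
  interpret M: module R M by fact
  note R = M.R.is_cring
  note Q = quot_ring_mod_module[OF R assms(2)]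
  show "one_tensor R J M ` carrier M \<subseteq> carrier (tensor_mod R (quot_ring_mod R J) M)"
    using linear_map_closed[OF one_tensor_linear[OF assms]] by auto
  show "carrier (tensor_mod R (quot_ring_mod R J) M) \<subseteq> one_tensor R J M ` carrier M"
  proof (rule tensor_induct[OF Q assms(1) image_submodule[OF assms(1) tensor_mod_module[OF Q assms(1)] one_tensor_linear[OF assms]]])
    fix X m assume X: "X \<in> carrier (quot_ring_mod R J)" and m: "m \<in> carrier M"
    obtain r where r: "r \<in> carrier R" "X = J +>\<^bsub>R\<^esub> r" using X by (auto simp: quot_ring_mod_carrier[OF R assms(2)])
    have "pure_tensor R (quot_ring_mod R J) M X m = one_tensor R J M (r \<odot>\<^bsub>M\<^esub> m)"
      unfolding r(2) quot_one_generates[OF R assms(2) r(1)] one_tensor_def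
      by (rule pure_tensor_smult_move[OF Q assms(1) r(1) quot_one_closed[OF R assms(2)] m])
    then show "pure_tensor R (quot_ring_mod R J) M X m \<in> one_tensor R J M ` carrier M"
      using r(1) m by auto
  qed
qed

text \<open>If \<open>x \<in> J\<close>, then \<open>1 \<otimes> xm = x1 \<otimes> m = 0\<close>. The converse needs a map that detects \<open>M/JM\<close>.\<close>

lemma one_tensor_eq_zero_iff:
  assumes "module R M" "ideal J R" "m \<in> carrier M"
  shows "one_tensor R J M m = \<zero>\<^bsub>tensor_mod R (quot_ring_mod R J) M\<^esub> \<longleftrightarrow> m \<in> ideal_smult R J M"
proof
  interpret M: module R M by fact
  interpret J: ideal J R by fact
  note R = M.R.is_cring
  note Q = quot_ring_mod_module[OF R assms(2)]
  note T = tensor_mod_module[OF Q assms(1)]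
  note one = one_tensor_linear[OF assms(1,2)]
  let ?T = "tensor_mod R (quot_ring_mod R J) M"
  let ?H = "ideal_smult R J M"
  note H = ideal_smult_submodule[OF assms(1) J.a_subset]
  note HE = M.submoduleE[OF H]
  {
    assume "m \<in> ?H"
    moreover have "?H \<subseteq> {x \<in> carrier M. one_tensor R J M x = \<zero>\<^bsub>?T\<^esub>}"
    proof (rule ideal_smult_least[OF kernel_submodule[OF assms(1) T one]])
      fix x y assume x: "x \<in> J" and y: "y \<in> carrier M"
      have xR: "x \<in> carrier R" using x J.a_subset by auto
      have "one_tensor R J M (x \<odot>\<^bsub>M\<^esub> y) = pure_tensor R (quot_ring_mod R J) M \<zero>\<^bsub>quot_ring_mod R J\<^esub> y"
        unfolding one_tensor_def
        using pure_tensor_smult_move[OF Q assms(1) xR quot_one_closed[OF R assms(2)] y]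
        by (simp add: quot_one_annihilated[OF R assms(2) x])
      then show "x \<odot>\<^bsub>M\<^esub> y \<in> {x \<in> carrier M. one_tensor R J M x = \<zero>\<^bsub>?T\<^esub>}"
        using xR y linear_map_zero[OF Q T pure_tensor_left[OF Q assms(1) y]] by simp
    qed
    ultimately show "one_tensor R J M m = \<zero>\<^bsub>?T\<^esub>" by auto
  }
  {
    \<comment> \<open>The bilinear map \<open>(J + r, y) \<mapsto> ry + JM\<close> induces \<open>R/J \<otimes> M \<rightarrow> M/JM\<close>, which sends
      \<open>1 \<otimes> m\<close> to the class of \<open>m\<close>.\<close>
    let ?q = "\<lambda>x. ?H +>\<^bsub>M\<^esub> x"
    let ?M' = "quot_mod R M ?H"
    define b where "b X y = ?q ((SOME r. r \<in> carrier R \<and> X = J +>\<^bsub>R\<^esub> r) \<odot>\<^bsub>M\<^esub> y)" for X y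
    note M' = quot_mod_module[OF assms(1) H]
    note q = quot_mod_proj[OF assms(1) H]
    interpret M': module R ?M' by (rule M')
    have b: "b (J +>\<^bsub>R\<^esub> r) y = ?q (r \<odot>\<^bsub>M\<^esub> y)" if r: "r \<in> carrier R" and y: "y \<in> carrier M" for r y
    proof -
      let ?s = "SOME s. s \<in> carrier R \<and> J +>\<^bsub>R\<^esub> r = J +>\<^bsub>R\<^esub> s"
      have s: "?s \<in> carrier R \<and> J +>\<^bsub>R\<^esub> r = J +>\<^bsub>R\<^esub> ?s" by (rule someI[of _ r]) (use r in auto)
      then have "?s \<ominus>\<^bsub>R\<^esub> r \<in> J" using quot_ring_mod_eq_iff[OF R assms(2), of ?s r] r by simp
      then have "(?s \<ominus>\<^bsub>R\<^esub> r) \<odot>\<^bsub>M\<^esub> y \<in> ?H" using y by (rule ideal_smult_memI)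
      moreover have "(?s \<ominus>\<^bsub>R\<^esub> r) \<odot>\<^bsub>M\<^esub> y = ?s \<odot>\<^bsub>M\<^esub> y \<ominus>\<^bsub>M\<^esub> r \<odot>\<^bsub>M\<^esub> y"
        using s r y by (simp add: a_minus_def M.smult_l_distr M.smult_l_minus)
      ultimately show ?thesis
        unfolding b_def using s r y by (subst coset_eq_iff[OF assms(1) H]) auto
    qed
    have "bilinear_map R (quot_ring_mod R J) M ?M' b"
      unfolding bilinear_map_def
    proof (intro conjI ballI)
      fix y assume y: "y \<in> carrier M"
      show "linear_map R (quot_ring_mod R J) ?M' (\<lambda>X. b X y)"
        by (rule linear_mapI)
          (use y in \<open>auto simp: quot_ring_mod_carrier[OF R assms(2)] b M.smult_l_distr M.smult_assoc1
            linear_mapD[OF q] quot_ring_mod_add[OF R assms(2), symmetric]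
            quot_ring_mod_smult[OF R assms(2), symmetric]\<close>)
    next
      fix X assume "X \<in> carrier (quot_ring_mod R J)"
      then obtain r where r: "r \<in> carrier R" "X = J +>\<^bsub>R\<^esub> r" by (auto simp: quot_ring_mod_carrier[OF R assms(2)])
      have comm: "r \<odot>\<^bsub>M\<^esub> (s \<odot>\<^bsub>M\<^esub> y) = s \<odot>\<^bsub>M\<^esub> (r \<odot>\<^bsub>M\<^esub> y)" if "s \<in> carrier R" "y \<in> carrier M" for s y
        using r(1) that by (simp add: M.smult_assoc1[symmetric] M.R.m_comm)
      show "linear_map R M ?M' (b X)"
        unfolding r(2)
        by (rule linear_mapI)
          (use r(1) in \<open>auto simp: b M.smult_r_distr comm linear_mapD[OF q]\<close>)
    qed
    then obtain g where g: "g \<in> mod_hom R ?T ?M'"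
      and gb: "\<And>X y. \<lbrakk>X \<in> carrier (quot_ring_mod R J); y \<in> carrier M\<rbrakk> \<Longrightarrow>
        g (pure_tensor R (quot_ring_mod R J) M X y) = b X y"
      using tensor_lift[OF Q assms(1) M'] by metis
    assume "one_tensor R J M m = \<zero>\<^bsub>?T\<^esub>"
    then have "g (one_tensor R J M m) = \<zero>\<^bsub>?M'\<^esub>" using linear_map_zero[OF T M' mod_homD[OF g]] by simp
    moreover have "g (one_tensor R J M m) = ?q m"
      unfolding one_tensor_def
      using gb[OF quot_one_closed[OF R assms(2)] assms(3)] b[OF M.R.one_closed assms(3)] assms(3) by simp
    ultimately show "m \<in> ?H" using quot_mod_proj_eq_zero[OF assms(1) H assms(3)] by simp
  }
qed

lemma one_tensor_eq_iff:
  assumes "module R M" "ideal J R" "x \<in> carrier M" "y \<in> carrier M"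
  shows "one_tensor R J M x = one_tensor R J M y \<longleftrightarrow> x \<ominus>\<^bsub>M\<^esub> y \<in> ideal_smult R J M"
proof -
  interpret M: module R M by fact
  note T = tensor_mod_module[OF quot_ring_mod_module[OF M.R.is_cring assms(2)] assms(1)]
  note p = one_tensor_linear[OF assms(1,2)]
  have "one_tensor R J M x = one_tensor R J M y \<longleftrightarrow>
      one_tensor R J M (x \<ominus>\<^bsub>M\<^esub> y) = \<zero>\<^bsub>tensor_mod R (quot_ring_mod R J) M\<^esub>"
    using module_diff_eq_zero_iff[OF T linear_map_closed[OF p assms(3)] linear_map_closed[OF p assms(4)]]
      linear_map_diff[OF assms(1) T p assms(3,4)] by simp
  also have "\<dots> \<longleftrightarrow> x \<ominus>\<^bsub>M\<^esub> y \<in> ideal_smult R J M"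
    using assms(3,4) by (intro one_tensor_eq_zero_iff assms(1,2)) simp
  finally show ?thesis .
qed

section \<open>The torsion functor on modules\<close>

subsection \<open>Direct limits of submodules\<close>

text \<open>A direct system whose members embed compatibly in one module \<open>M\<close>. A class is then determined by its
  image in \<open>M\<close>, so the direct limit can be handled as the union of the images.\<close>

locale direct_system_in =
  fixes R :: "'a ring" and M :: "('a, 'm) module" and G :: "nat \<Rightarrow> ('a, 'g) module"
    and t :: "nat \<Rightarrow> nat \<Rightarrow> 'g \<Rightarrow> 'g" and e :: "nat \<Rightarrow> 'g \<Rightarrow> 'm"
  assumes M: "module R M" and G: "module R (G k)"
    and e: "linear_map R (G k) M (e k)"
    and e_inj: "inj_on (e k) (carrier (G k))"
    and t_closed: "\<lbrakk>k \<le> l; x \<in> carrier (G k)\<rbrakk> \<Longrightarrow> t k l x \<in> carrier (G l)"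
    and e_t: "\<lbrakk>k \<le> l; x \<in> carrier (G k)\<rbrakk> \<Longrightarrow> e l (t k l x) = e k x"
begin

sublocale G: module R "G k" for k by (rule G)

text \<open>Two representatives with the same image in \<open>M\<close> already agree at the later of their two stages,
  because the embedding of that stage is injective.\<close>

lemma dlim_class_eq:
  assumes "x \<in> carrier (G k)"
  shows "dlim_class G t (k, x) = {(l, y). y \<in> carrier (G l) \<and> e l y = e k x}"
proof -
  have "(\<exists>m. k \<le> m \<and> l \<le> m \<and> t k m x = t l m y) \<longleftrightarrow> e l y = e k x" if y: "y \<in> carrier (G l)" for l y
  proof
    assume "\<exists>m. k \<le> m \<and> l \<le> m \<and> t k m x = t l m y"
    then obtain m where m: "k \<le> m" "l \<le> m" "t k m x = t l m y" by blast
    have "e m (t k m x) = e k x" using m(1) assms by (rule e_t)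
    moreover have "e m (t l m y) = e l y" using m(2) y by (rule e_t)
    ultimately show "e l y = e k x" using m(3) by simp
  next
    assume eq: "e l y = e k x"
    have "t k (max k l) x = t l (max k l) y"
      by (rule inj_onD[OF e_inj[of "max k l"]]) (simp_all add: e_t t_closed assms y eq)
    then show "\<exists>m. k \<le> m \<and> l \<le> m \<and> t k m x = t l m y" by (intro exI[of _ "max k l"]) auto
  qed
  then show ?thesis by (auto simp: dlim_class_def)
qed

lemma dlim_class_self: "x \<in> carrier (G k) \<Longrightarrow> (k, x) \<in> dlim_class G t (k, x)"
  by (simp add: dlim_class_eq)

lemma dlim_class_memD:
  assumes "(l, y) \<in> dlim_class G t (k, x)" "x \<in> carrier (G k)"
  shows "y \<in> carrier (G l)" "e l y = e k x"
  using assms by (auto simp: dlim_class_eq)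

lemma dlim_class_cong:
  assumes "x \<in> carrier (G k)" "y \<in> carrier (G l)" "e k x = e l y"
  shows "dlim_class G t (k, x) = dlim_class G t (l, y)"
  using assms by (simp add: dlim_class_eq)

text \<open>All representatives of a class have the same image, so any of them may be chosen.\<close>

definition dlim_incl :: "(nat \<times> 'g) set \<Rightarrow> 'm" where
  "dlim_incl X = (case SOME p. p \<in> X of (k, x) \<Rightarrow> e k x)"

lemma dlim_incl_class:
  assumes "x \<in> carrier (G k)"
  shows "dlim_incl (dlim_class G t (k, x)) = e k x"
proof -
  have "(SOME p. p \<in> dlim_class G t (k, x)) \<in> dlim_class G t (k, x)"
    using dlim_class_self[OF assms] by (rule someI)
  then show ?thesis
    using dlim_class_memD(2)[OF _ assms] by (auto simp: dlim_incl_def split: prod.split)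
qed

lemma dlim_carrierE:
  assumes "X \<in> carrier (dlim_mod G t)"
  obtains k x where "x \<in> carrier (G k)" "X = dlim_class G t (k, x)"
  using assms by (auto simp: dlim_mod_def)

lemma dlim_class_closed: "x \<in> carrier (G k) \<Longrightarrow> dlim_class G t (k, x) \<in> carrier (dlim_mod G t)"
  by (auto simp: dlim_mod_def)

text \<open>An operation on classes defined by a union over representatives has a single value as soon as
  its image in the ambient module depends only on the images of the arguments.\<close>

lemma UN_dlim_class:
  assumes "x \<in> carrier (G k)"
    and "\<And>l y. \<lbrakk>y \<in> carrier (G l); e l y = e k x\<rbrakk> \<Longrightarrow> F l y = S"
  shows "(\<Union>(l, y)\<in>dlim_class G t (k, x). F l y) = S"
proof -
  have "(\<Union>(l, y)\<in>dlim_class G t (k, x). F l y) = (\<Union>p\<in>dlim_class G t (k, x). S)"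
    by (intro SUP_cong refl) (use assms in \<open>auto simp: dlim_class_eq\<close>)
  then show ?thesis using dlim_class_self[OF assms(1)] by auto
qed

lemma dlim_add:
  assumes x: "x \<in> carrier (G k)" and y: "y \<in> carrier (G l)"
  shows "dlim_class G t (k, x) \<oplus>\<^bsub>dlim_mod G t\<^esub> dlim_class G t (l, y) =
    dlim_class G t (max k l, t k (max k l) x \<oplus>\<^bsub>G (max k l)\<^esub> t l (max k l) y)"
proof -
  have "(\<Union>(l', y')\<in>dlim_class G t (l, y).
      dlim_class G t (max k' l', t k' (max k' l') x' \<oplus>\<^bsub>G (max k' l')\<^esub> t l' (max k' l') y')) =
    dlim_class G t (max k l, t k (max k l) x \<oplus>\<^bsub>G (max k l)\<^esub> t l (max k l) y)"
    if x': "x' \<in> carrier (G k')" "e k' x' = e k x" for k' x'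
    by (rule UN_dlim_class[OF y], rule dlim_class_cong)
      (use x y x' in \<open>simp_all add: t_closed e_t linear_map_add[OF e]\<close>)
  then have "(\<Union>(k', x')\<in>dlim_class G t (k, x). \<Union>(l', y')\<in>dlim_class G t (l, y).
      dlim_class G t (max k' l', t k' (max k' l') x' \<oplus>\<^bsub>G (max k' l')\<^esub> t l' (max k' l') y')) =
    dlim_class G t (max k l, t k (max k l) x \<oplus>\<^bsub>G (max k l)\<^esub> t l (max k l) y)"
    by (intro UN_dlim_class[OF x])
  then show ?thesis by (simp add: dlim_mod_def)
qed

lemma dlim_smult:
  assumes r: "r \<in> carrier R" and x: "x \<in> carrier (G k)"
  shows "r \<odot>\<^bsub>dlim_mod G t\<^esub> dlim_class G t (k, x) = dlim_class G t (k, r \<odot>\<^bsub>G k\<^esub> x)"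
proof -
  have "(\<Union>(l, y)\<in>dlim_class G t (k, x). dlim_class G t (l, r \<odot>\<^bsub>G l\<^esub> y)) = dlim_class G t (k, r \<odot>\<^bsub>G k\<^esub> x)"
    by (rule UN_dlim_class[OF x], rule dlim_class_cong)
      (use r x in \<open>simp_all add: linear_map_smult[OF e]\<close>)
  then show ?thesis by (simp add: dlim_mod_def)
qed

lemma dlim_incl_inj: "inj_on dlim_incl (carrier (dlim_mod G t))"
proof (rule inj_onI)
  fix X Y assume X: "X \<in> carrier (dlim_mod G t)" and Y: "Y \<in> carrier (dlim_mod G t)"
    and eq: "dlim_incl X = dlim_incl Y"
  obtain k x where x: "x \<in> carrier (G k)" "X = dlim_class G t (k, x)" using X by (rule dlim_carrierE)
  obtain l y where y: "y \<in> carrier (G l)" "Y = dlim_class G t (l, y)" using Y by (rule dlim_carrierE)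
  show "X = Y"
    using eq unfolding x(2) y(2) dlim_incl_class[OF x(1)] dlim_incl_class[OF y(1)]
    by (rule dlim_class_cong[OF x(1) y(1)])
qed

lemma dlim_mod_module: "module R (dlim_mod G t)"
proof (rule module_of_injection[OF M dlim_incl_inj])
  show "dlim_incl X \<in> carrier M" if "X \<in> carrier (dlim_mod G t)" for X
    using that by (auto elim!: dlim_carrierE simp: dlim_incl_class linear_map_closed[OF e])
  show "X \<oplus>\<^bsub>dlim_mod G t\<^esub> Y \<in> carrier (dlim_mod G t) \<and>
      dlim_incl (X \<oplus>\<^bsub>dlim_mod G t\<^esub> Y) = dlim_incl X \<oplus>\<^bsub>M\<^esub> dlim_incl Y"
    if "X \<in> carrier (dlim_mod G t)" "Y \<in> carrier (dlim_mod G t)" for X Y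
    using that
    by (auto elim!: dlim_carrierE simp: dlim_add dlim_class_closed t_closed dlim_incl_class
        linear_map_add[OF e] e_t)
  have "\<zero>\<^bsub>dlim_mod G t\<^esub> = dlim_class G t (0, \<zero>\<^bsub>G 0\<^esub>)" by (simp add: dlim_mod_def)
  then show "\<zero>\<^bsub>dlim_mod G t\<^esub> \<in> carrier (dlim_mod G t) \<and> dlim_incl \<zero>\<^bsub>dlim_mod G t\<^esub> = \<zero>\<^bsub>M\<^esub>"
    by (simp add: dlim_class_closed dlim_incl_class linear_map_zero[OF G M e])
  show "r \<odot>\<^bsub>dlim_mod G t\<^esub> X \<in> carrier (dlim_mod G t) \<and>
      dlim_incl (r \<odot>\<^bsub>dlim_mod G t\<^esub> X) = r \<odot>\<^bsub>M\<^esub> dlim_incl X"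
    if "r \<in> carrier R" "X \<in> carrier (dlim_mod G t)" for r X
    using that
    by (auto elim!: dlim_carrierE simp: dlim_smult dlim_class_closed dlim_incl_class linear_map_smult[OF e])
qed

lemma dlim_incl_linear: "linear_map R (dlim_mod G t) M dlim_incl"
  by (rule linear_mapI)
    (auto elim!: dlim_carrierE simp: dlim_add dlim_smult dlim_incl_class t_closed e_t
      linear_mapD[OF e])

lemma dlim_incl_image: "dlim_incl ` carrier (dlim_mod G t) = (\<Union>k. e k ` carrier (G k))"
proof -
  have "carrier (dlim_mod G t) = (\<Union>k. (\<lambda>x. dlim_class G t (k, x)) ` carrier (G k))"
    by (auto simp: dlim_mod_def)
  then show ?thesis by (simp add: image_UN image_image dlim_incl_class)
qed

end

subsection \<open>Torsion as a submodule\<close>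

abbreviation eval_power :: "'a ring \<Rightarrow> 'a set \<Rightarrow> nat \<Rightarrow> ('a set \<Rightarrow> 'm) \<Rightarrow> 'm" where
  "eval_power R I k h \<equiv> h (quot_one R (ideal_pow R I k))"

text \<open>The transition maps precompose with projections \<open>R/I\<^sup>l \<rightarrow> R/I\<^sup>k\<close>, which send \<open>1\<close> to \<open>1\<close>; hence they do
  not change the value at \<open>1\<close>.\<close>

lemma tors_system_embedded:
  assumes "module R M" "ideal I R"
  shows "direct_system_in R M (tors_system R I M) (tors_trans R I) (eval_power R I)"
proof -
  interpret M: module R M by fact
  note R = M.R.is_cring
  note P = ideal_pow_ideal[OF R assms(2)]
  note Q = quot_ring_mod_module[OF R P]
  note qp = quot_proj_coset[OF R P P ideal_pow_antimono[OF R assms(2)]]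
  have proj: "linear_map R (quot_ring_mod R (ideal_pow R I l)) (quot_ring_mod R (ideal_pow R I k))
      (quot_proj R (ideal_pow R I k))" if "k \<le> l" for k l
    by (rule quot_proj_linear[OF R P P ideal_pow_antimono[OF R assms(2) that]])
  show ?thesis
  proof (rule direct_system_in.intro)
    show "linear_map R (tors_system R I M k) M (eval_power R I k)" for k
      unfolding tors_system_def by (rule eval_one_linear[OF assms(1) P])
    show "inj_on (eval_power R I k) (carrier (tors_system R I M k))" for k
      using eval_one_inj[OF assms(1) P] by (simp add: tors_system_def)
    show "module R (tors_system R I M k)" for k
      unfolding tors_system_def by (rule Hom_mod_module[OF Q assms(1)])
    fix k l :: nat and h
    assume kl: "k \<le> l" and "h \<in> carrier (tors_system R I M k)"
    then have h: "linear_map R (quot_ring_mod R (ideal_pow R I k)) M h"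
      by (auto simp: tors_system_def mod_homD)
    show "tors_trans R I k l h \<in> carrier (tors_system R I M l)"
      using restrict_mod_hom[OF Q linear_map_comp[OF proj[OF kl] h]]
      by (simp add: tors_system_def tors_trans_def)
    show "eval_power R I l (tors_trans R I k l h) = eval_power R I k h"
      by (simp add: tors_trans_def quot_one_closed[OF R P] qp[OF kl])
  qed (rule assms(1))
qed

text \<open>The choice of a representative involves only evaluation at \<open>1\<close>, so the inclusion is given by the same
  formula for every module \<open>M\<close>.\<close>

definition tors_incl :: "'a ring \<Rightarrow> 'a set \<Rightarrow> (nat \<times> ('a set \<Rightarrow> 'm)) set \<Rightarrow> 'm" where
  "tors_incl R I = direct_system_in.dlim_incl (eval_power R I)"

lemma tors_mod_module:
  assumes "module R M" "ideal I R"
  shows "module R (tors_mod R I M)"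
  unfolding tors_mod_def by (rule direct_system_in.dlim_mod_module[OF tors_system_embedded[OF assms]])

lemma tors_incl_linear:
  assumes "module R M" "ideal I R"
  shows "linear_map R (tors_mod R I M) M (tors_incl R I)"
  unfolding tors_mod_def tors_incl_def
  by (rule direct_system_in.dlim_incl_linear[OF tors_system_embedded[OF assms]])

lemma tors_incl_inj:
  assumes "module R M" "ideal I R"
  shows "inj_on (tors_incl R I) (carrier (tors_mod R I M))"
  unfolding tors_mod_def tors_incl_def
  by (rule direct_system_in.dlim_incl_inj[OF tors_system_embedded[OF assms]])

lemma tors_incl_image:
  assumes "module R M" "ideal I R" "reduced_mod R I M"
  shows "tors_incl R I ` carrier (tors_mod R I M) = annihilated_elements I M"
proof -
  interpret M: module R M by fact
  note R = M.R.is_cring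
  have "tors_incl R I ` carrier (tors_mod R I M) = (\<Union>k. annihilated_elements (ideal_pow R I k) M)"
    unfolding tors_mod_def tors_incl_def direct_system_in.dlim_incl_image[OF tors_system_embedded[OF assms(1,2)]]
    using eval_one_image[OF assms(1) ideal_pow_ideal[OF R assms(2)]] by (simp add: tors_system_def)
  also have "\<dots> = annihilated_elements I M"
  proof
    show "(\<Union>k. annihilated_elements (ideal_pow R I k) M) \<subseteq> annihilated_elements I M"
      by (rule UN_least) (rule annihilated_by_power[OF assms])
    have "annihilated_elements (ideal_pow R I (Suc 0)) M \<subseteq> (\<Union>k. annihilated_elements (ideal_pow R I k) M)"
      by (rule UN_upper) simp
    then show "annihilated_elements I M \<subseteq> (\<Union>k. annihilated_elements (ideal_pow R I k) M)"
      unfolding ideal_pow_1[OF R assms(2)] .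
  qed
  finally show ?thesis .
qed

lemma tors_mod_annihilated:
  assumes "module R M" "ideal I R" "reduced_mod R I M"
  shows "carrier (tors_mod R I M) \<subseteq> annihilated_elements I (tors_mod R I M)"
proof
  interpret M: module R M by fact
  interpret I: ideal I R by fact
  note T = tors_mod_module[OF assms(1,2)]
  interpret T: module R "tors_mod R I M" by (rule T)
  note i = tors_incl_linear[OF assms(1,2)]
  fix X assume X: "X \<in> carrier (tors_mod R I M)"
  have "x \<odot>\<^bsub>tors_mod R I M\<^esub> X = \<zero>\<^bsub>tors_mod R I M\<^esub>" if x: "x \<in> I" for x
  proof (rule inj_onD[OF tors_incl_inj[OF assms(1,2)]])
    have xR: "x \<in> carrier R" using x I.a_subset by auto
    then show "x \<odot>\<^bsub>tors_mod R I M\<^esub> X \<in> carrier (tors_mod R I M)" using X by simp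
    have "tors_incl R I X \<in> annihilated_elements I M" using X tors_incl_image[OF assms] by blast
    then show "tors_incl R I (x \<odot>\<^bsub>tors_mod R I M\<^esub> X) = tors_incl R I \<zero>\<^bsub>tors_mod R I M\<^esub>"
      using x linear_map_smult[OF i xR X] linear_map_zero[OF T assms(1) i]
      by (simp add: annihilated_elements_def)
  qed simp
  then show "X \<in> annihilated_elements I (tors_mod R I M)" using X by (simp add: annihilated_elements_def)
qed

text \<open>On representatives the functor composes with \<open>f\<close>, and evaluation at \<open>1\<close> turns this into application of
  \<open>f\<close>. Linearity follows since the inclusion is injective and linear.\<close>

lemma tors_map_props:
  assumes "module R M" "module R N" "ideal I R" and f: "linear_map R M N f"
  shows tors_map_hom: "tors_map R I M N f \<in> mod_hom R (tors_mod R I M) (tors_mod R I N)"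
    and tors_incl_natural: "X \<in> carrier (tors_mod R I M) \<Longrightarrow>
      tors_incl R I (tors_map R I M N f X) = f (tors_incl R I X)"
proof -
  interpret M: module R M by fact
  note R = M.R.is_cring
  note P = ideal_pow_ideal[OF R assms(3)]
  note Q = quot_ring_mod_module[OF R P]
  interpret DM: direct_system_in R M "tors_system R I M" "tors_trans R I" "eval_power R I"
    by (rule tors_system_embedded[OF assms(1,3)])
  interpret DN: direct_system_in R N "tors_system R I N" "tors_trans R I" "eval_power R I"
    by (rule tors_system_embedded[OF assms(2,3)])
  have *: "compose (carrier (quot_ring_mod R (ideal_pow R I k))) f h \<in> carrier (tors_system R I N k)"
    "eval_power R I k (compose (carrier (quot_ring_mod R (ideal_pow R I k))) f h) = f (eval_power R I k h)"
    if "h \<in> carrier (tors_system R I M k)" for k h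
    using compose_mod_hom[OF Q _ f, of k h] that quot_one_closed[OF R P]
    by (auto simp: tors_system_def compose_def dest: mod_homD)
  have **: "tors_map R I M N f X \<in> carrier (tors_mod R I N) \<and>
      tors_incl R I (tors_map R I M N f X) = f (tors_incl R I X)"
    if X: "X \<in> carrier (tors_mod R I M)" for X
  proof -
    obtain k h where h: "h \<in> carrier (tors_system R I M k)"
      and Xh: "X = dlim_class (tors_system R I M) (tors_trans R I) (k, h)"
      using X unfolding tors_mod_def by (rule DM.dlim_carrierE)
    have "tors_map R I M N f X = dlim_class (tors_system R I N) (tors_trans R I)
        (k, compose (carrier (quot_ring_mod R (ideal_pow R I k))) f h)"
      using X unfolding tors_map_def Xh
      by simp (rule DM.UN_dlim_class[OF h], rule DN.dlim_class_cong, use h * in auto)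
    then show ?thesis
      using h DN.dlim_class_closed[OF *(1)[OF h]] DN.dlim_incl_class[OF *(1)[OF h]] DM.dlim_incl_class[OF h] *(2)[OF h]
      by (simp add: tors_mod_def tors_incl_def Xh)
  qed
  then show "X \<in> carrier (tors_mod R I M) \<Longrightarrow> tors_incl R I (tors_map R I M N f X) = f (tors_incl R I X)"
    by blast
  note TM = tors_mod_module[OF assms(1,3)] and TN = tors_mod_module[OF assms(2,3)]
  note iM = tors_incl_linear[OF assms(1,3)] and iN = tors_incl_linear[OF assms(2,3)]
  have "linear_map R (tors_mod R I M) N (\<lambda>X. tors_incl R I (tors_map R I M N f X))"
    by (rule linear_map_cong[OF TM linear_map_comp[OF iM f]]) (simp add: **)
  then have "linear_map R (tors_mod R I M) (tors_mod R I N) (tors_map R I M N f)"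
    by (rule linear_map_cancel_injection[OF TM TN iN tors_incl_inj[OF assms(2,3)] _, rotated]) (simp add: **)
  then show "tors_map R I M N f \<in> mod_hom R (tors_mod R I M) (tors_mod R I N)"
    by (rule mod_homI) (simp add: tors_map_def)
qed

section \<open>The completion functor on modules\<close>

definition compl_proj ::
    "'a ring \<Rightarrow> 'a set \<Rightarrow> ('a, 'm) module \<Rightarrow> 'm \<Rightarrow> nat \<Rightarrow> ('a set \<times> 'm \<Rightarrow> 'a) set" where
  "compl_proj R I M m = (\<lambda>k. one_tensor R (ideal_pow R I k) M m)"

lemma compl_mod_simps:
  "x \<in> carrier (compl_mod R I M) \<longleftrightarrow> (\<forall>k. x k \<in> carrier (compl_system R I M k)) \<and>
    (\<forall>k l. k \<le> l \<longrightarrow> compl_trans R I M k l (x l) = x k)"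
  "\<zero>\<^bsub>compl_mod R I M\<^esub> = (\<lambda>k. \<zero>\<^bsub>compl_system R I M k\<^esub>)"
  "x \<oplus>\<^bsub>compl_mod R I M\<^esub> y = (\<lambda>k. x k \<oplus>\<^bsub>compl_system R I M k\<^esub> y k)"
  "r \<odot>\<^bsub>compl_mod R I M\<^esub> x = (\<lambda>k. r \<odot>\<^bsub>compl_system R I M k\<^esub> x k)"
  by (auto simp: compl_mod_def ilim_mod_def)

lemma compl_system_linear:
  assumes "module R M" "ideal I R"
  shows "linear_map R M (compl_system R I M k) (\<lambda>m. compl_proj R I M m k)"
proof -
  interpret M: module R M by fact
  show ?thesis
    unfolding compl_proj_def compl_system_def
    by (rule one_tensor_linear[OF assms(1) ideal_pow_ideal[OF M.R.is_cring assms(2)]])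
qed

lemma compl_system_module:
  assumes "module R M" "ideal I R"
  shows "module R (compl_system R I M k)"
proof -
  interpret M: module R M by fact
  show ?thesis
    unfolding compl_system_def
    by (intro tensor_mod_module quot_ring_mod_module ideal_pow_ideal M.R.is_cring assms)
qed

lemma compl_trans_proj:
  assumes "module R M" "ideal I R" "k \<le> l" "m \<in> carrier M"
  shows "compl_trans R I M k l (compl_proj R I M m l) = compl_proj R I M m k"
proof -
  interpret M: module R M by fact
  note R = M.R.is_cring
  note P = ideal_pow_ideal[OF R assms(2)]
  note Q = quot_ring_mod_module[OF R P]
  note qp = quot_proj_coset[OF R P P ideal_pow_antimono[OF R assms(2,3)]]
  have proj: "linear_map R (quot_ring_mod R (ideal_pow R I l)) (quot_ring_mod R (ideal_pow R I k))
      (quot_proj R (ideal_pow R I k))"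
    by (rule quot_proj_linear[OF R P P ideal_pow_antimono[OF R assms(2,3)]])
  have "linear_map R M M id" by (rule linear_mapI) auto
  from tensor_map_pure[OF Q assms(1) Q assms(1) proj this quot_one_closed[OF R P] assms(4)]
  show ?thesis
    by (simp add: compl_trans_def compl_proj_def one_tensor_def qp)
qed

lemma compl_proj_eq_iff:
  assumes "module R M" "ideal I R" "x \<in> carrier M" "y \<in> carrier M"
  shows "compl_proj R I M x k = compl_proj R I M y k \<longleftrightarrow>
    x \<ominus>\<^bsub>M\<^esub> y \<in> ideal_smult R (ideal_pow R I k) M"
proof -
  interpret M: module R M by fact
  show ?thesis
    unfolding compl_proj_def
    by (rule one_tensor_eq_iff[OF assms(1) ideal_pow_ideal[OF M.R.is_cring assms(2)] assms(3,4)])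
qed

text \<open>For a coreduced module the tower \<open>M/I\<^sup>kM\<close> is constant from \<open>k = 1\<close> on, so a compatible
  sequence is determined by its entry at \<open>k = 1\<close>; the entry at \<open>k = 0\<close> is carried along by the
  transition map.\<close>

lemma compl_proj_surj:
  assumes "module R M" "ideal I R" "coreduced_mod R I M"
  shows "carrier (compl_mod R I M) = compl_proj R I M ` carrier M"
proof (intro equalityI subsetI)
  interpret M: module R M by fact
  fix x assume "x \<in> compl_proj R I M ` carrier M"
  then show "x \<in> carrier (compl_mod R I M)"
    using linear_map_closed[OF compl_system_linear[OF assms(1,2)]]
    by (auto simp: compl_mod_simps compl_trans_proj[OF assms(1,2)])
next
  interpret M: module R M by fact
  note R = M.R.is_cring
  note P = ideal_pow_ideal[OF R assms(2)]
  fix x assume "x \<in> carrier (compl_mod R I M)"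
  then have closed: "\<And>k. x k \<in> carrier (compl_system R I M k)"
    and trans: "\<And>k l. k \<le> l \<Longrightarrow> compl_trans R I M k l (x l) = x k"
    by (auto simp: compl_mod_simps)
  have surj: "\<exists>m\<in>carrier M. x k = compl_proj R I M m k" for k
    using closed[of k] one_tensor_surj[OF assms(1) P] by (auto simp: compl_system_def compl_proj_def)
  obtain m where m: "m \<in> carrier M" "x 1 = compl_proj R I M m 1" using surj[of 1] by auto
  have "x k = compl_proj R I M m k" for k
  proof (cases k)
    case 0
    then show ?thesis
      using trans[of 0 1] compl_trans_proj[OF assms(1,2) _ m(1), of 0 1] m(2) by simp
  next
    case (Suc j)
    obtain n where n: "n \<in> carrier M" "x k = compl_proj R I M n k" using surj by auto
    have "compl_proj R I M n 1 = compl_proj R I M m 1"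
      using trans[of 1 k] compl_trans_proj[OF assms(1,2) _ n(1), of 1 k] m(2) n(2) Suc by simp
    then have "n \<ominus>\<^bsub>M\<^esub> m \<in> ideal_smult R I M"
      unfolding compl_proj_eq_iff[OF assms(1,2) n(1) m(1)] One_nat_def ideal_pow_1[OF R assms(2)] .
    then have "n \<ominus>\<^bsub>M\<^esub> m \<in> ideal_smult R (ideal_pow R I k) M"
      using ideal_smult_power_Suc[OF assms] unfolding Suc by (rule subsetD[rotated])
    then show ?thesis
      using compl_proj_eq_iff[OF assms(1,2) n(1) m(1)] n(2) by simp
  qed
  then have "x = compl_proj R I M m" by auto
  then show "x \<in> compl_proj R I M ` carrier M" using m(1) by simp
qed

lemma compl_mod_module:
  assumes "module R M" "ideal I R" "coreduced_mod R I M"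
  shows "module R (compl_mod R I M)"
proof -
  note p = compl_system_linear[OF assms(1,2)]
  show ?thesis
    by (rule module_of_surjection[OF assms(1) compl_proj_surj[OF assms]])
      (auto simp: compl_mod_simps fun_eq_iff linear_map_add[OF p] linear_map_smult[OF p]
        linear_map_zero[OF assms(1) compl_system_module[OF assms(1,2)] p])
qed

lemma compl_proj_linear:
  assumes "module R M" "ideal I R" "coreduced_mod R I M"
  shows "linear_map R M (compl_mod R I M) (compl_proj R I M)"
proof -
  note p = compl_system_linear[OF assms(1,2)]
  show ?thesis
    by (rule linear_mapI)
      (auto simp: compl_proj_surj[OF assms] compl_mod_simps(2-4) fun_eq_iff linear_map_add[OF p] linear_map_smult[OF p])
qed

lemma compl_proj_kernel:
  assumes "module R M" "ideal I R" "coreduced_mod R I M" "x \<in> carrier M" "y \<in> carrier M"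
  shows "compl_proj R I M x = compl_proj R I M y \<longleftrightarrow> x \<ominus>\<^bsub>M\<^esub> y \<in> ideal_smult R I M"
proof -
  interpret M: module R M by fact
  interpret I: ideal I R by fact
  note R = M.R.is_cring
  have "ideal_smult R I M \<subseteq> ideal_smult R (ideal_pow R I k) M" for k
  proof (cases k)
    case 0
    then show ?thesis using ideal_smult_mono[OF assms(1) I.a_subset] by (simp add: ideal_pow_0)
  next
    case (Suc j)
    then show ?thesis using ideal_smult_power_Suc[OF assms(1-3), of j] by simp
  qed
  then have "(\<forall>k. x \<ominus>\<^bsub>M\<^esub> y \<in> ideal_smult R (ideal_pow R I k) M) \<longleftrightarrow> x \<ominus>\<^bsub>M\<^esub> y \<in> ideal_smult R I M"
    using ideal_pow_1[OF R assms(2)] by (metis subsetD)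
  then show ?thesis by (simp add: fun_eq_iff compl_proj_eq_iff[OF assms(1,2,4,5)])
qed

text \<open>For a coreduced module the completion is the quotient of \<open>M\<close> by \<open>IM\<close>.\<close>

lemma compl_mod_annihilated:
  assumes "module R M" "ideal I R" "coreduced_mod R I M"
  shows "carrier (compl_mod R I M) \<subseteq> annihilated_elements I (compl_mod R I M)"
proof
  interpret M: module R M by fact
  interpret I: ideal I R by fact
  note C = compl_mod_module[OF assms]
  note p = compl_proj_linear[OF assms]
  fix X assume X: "X \<in> carrier (compl_mod R I M)"
  then obtain m where m: "m \<in> carrier M" "X = compl_proj R I M m" by (auto simp: compl_proj_surj[OF assms])
  have "x \<odot>\<^bsub>compl_mod R I M\<^esub> X = \<zero>\<^bsub>compl_mod R I M\<^esub>" if x: "x \<in> I" for x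
  proof -
    have xR: "x \<in> carrier R" using x I.a_subset by auto
    have "x \<odot>\<^bsub>M\<^esub> m \<ominus>\<^bsub>M\<^esub> \<zero>\<^bsub>M\<^esub> = x \<odot>\<^bsub>M\<^esub> m"
      using xR m M.M.minus_equality[of "\<zero>\<^bsub>M\<^esub>" "\<zero>\<^bsub>M\<^esub>"] by (simp add: a_minus_def)
    then have "compl_proj R I M (x \<odot>\<^bsub>M\<^esub> m) = compl_proj R I M \<zero>\<^bsub>M\<^esub>"
      using xR m(1) x by (subst compl_proj_kernel[OF assms]) (auto intro: ideal_smult_memI)
    then show ?thesis
      using linear_map_smult[OF p xR m(1)] linear_map_zero[OF assms(1) C p] m(2) by simp
  qed
  then show "X \<in> annihilated_elements I (compl_mod R I M)" using X by (simp add: annihilated_elements_def)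
qed

text \<open>Both claims only need the values on the classes of elements of \<open>M\<close>, since these exhaust the completion.\<close>

lemma compl_map_props:
  assumes "module R M" "module R N" "ideal I R" "coreduced_mod R I M" "coreduced_mod R I N"
    and f: "linear_map R M N f"
  shows compl_map_hom: "compl_map R I M N f \<in> mod_hom R (compl_mod R I M) (compl_mod R I N)"
    and compl_proj_natural: "m \<in> carrier M \<Longrightarrow>
      compl_map R I M N f (compl_proj R I M m) = compl_proj R I N (f m)"
proof -
  interpret M: module R M by fact
  note R = M.R.is_cring
  note P = ideal_pow_ideal[OF R assms(3)]
  note Q = quot_ring_mod_module[OF R P]
  note pM = compl_proj_linear[OF assms(1,3,4)] and pN = compl_proj_linear[OF assms(2,3,5)]
  note sM = compl_proj_surj[OF assms(1,3,4)]
  have id: "linear_map R (quot_ring_mod R J) (quot_ring_mod R J) id" if "ideal J R" for J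
  proof -
    interpret Q: module R "quot_ring_mod R J" by (rule quot_ring_mod_module[OF R that])
    show ?thesis by (rule linear_mapI) auto
  qed
  have *: "compl_map R I M N f (compl_proj R I M m) = compl_proj R I N (f m)" if m: "m \<in> carrier M" for m
  proof -
    have "tensor_map R (quot_ring_mod R (ideal_pow R I k)) M (quot_ring_mod R (ideal_pow R I k)) N id f
        (compl_proj R I M m k) = compl_proj R I N (f m) k" for k
      using tensor_map_pure[OF Q assms(1) Q assms(2) id[OF P] f quot_one_closed[OF R P] m]
      by (simp add: compl_proj_def one_tensor_def)
    then show ?thesis
      using linear_map_closed[OF pM m] by (simp add: compl_map_def)
  qed
  then show "m \<in> carrier M \<Longrightarrow> compl_map R I M N f (compl_proj R I M m) = compl_proj R I N (f m)" .
  have "linear_map R (compl_mod R I M) (compl_mod R I N) (compl_map R I M N f)"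
    by (rule linear_map_cancel_surjection[OF assms(1) pM sM])
      (rule linear_map_cong[OF assms(1) linear_map_comp[OF f pN]], rule *)
  then show "compl_map R I M N f \<in> mod_hom R (compl_mod R I M) (compl_mod R I N)"
    by (rule mod_homI) (simp add: compl_map_def)
qed

section \<open>Complexes\<close>

lemma complexesD:
  assumes "M \<in> complexes R"
  shows complexes_module: "module R (obj M n)"
    and complexes_diff: "diff M n \<in> mod_hom R (obj M n) (obj M (n + 1))"
    and complexes_diff_diff: "x \<in> carrier (obj M n) \<Longrightarrow>
      diff M (n + 1) (diff M n x) = \<zero>\<^bsub>obj M (n + 1 + 1)\<^esub>"
  using assms by (auto simp: complexes_def)

lemma complex_of_injection:
  assumes M: "M \<in> complexes R" and P: "\<And>n. module R (obj P n)"
    and d: "\<And>n. diff P n \<in> mod_hom R (obj P n) (obj P (n + 1))"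
    and u: "\<And>n. linear_map R (obj P n) (obj M n) (u n)" "\<And>n. inj_on (u n) (carrier (obj P n))"
    and comm: "\<And>n x. x \<in> carrier (obj P n) \<Longrightarrow> u (n + 1) (diff P n x) = diff M n (u n x)"
  shows "P \<in> complexes R"
proof -
  have "diff P (n + 1) (diff P n x) = \<zero>\<^bsub>obj P (n + 1 + 1)\<^esub>" if x: "x \<in> carrier (obj P n)" for n x
  proof (rule inj_onD[OF u(2)])
    have dx: "diff P n x \<in> carrier (obj P (n + 1))" by (rule mod_hom_closed[OF d x])
    interpret P: module R "obj P (n + 1 + 1)" by (rule P)
    show "u (n + 1 + 1) (diff P (n + 1) (diff P n x)) = u (n + 1 + 1) \<zero>\<^bsub>obj P (n + 1 + 1)\<^esub>"
      unfolding comm[OF dx] comm[OF x] linear_map_zero[OF P complexes_module[OF M] u(1)]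
      by (rule complexes_diff_diff[OF M linear_map_closed[OF u(1) x]])
    show "diff P (n + 1) (diff P n x) \<in> carrier (obj P (n + 1 + 1))"
      by (rule mod_hom_closed[OF d dx])
    show "\<zero>\<^bsub>obj P (n + 1 + 1)\<^esub> \<in> carrier (obj P (n + 1 + 1))" by (rule P.M.zero_closed)
  qed
  then show ?thesis using P d by (auto simp: complexes_def)
qed

lemma complex_of_surjection:
  assumes M: "M \<in> complexes R" and P: "\<And>n. module R (obj P n)"
    and d: "\<And>n. diff P n \<in> mod_hom R (obj P n) (obj P (n + 1))"
    and p: "\<And>n. linear_map R (obj M n) (obj P n) (p n)" "\<And>n. carrier (obj P n) = p n ` carrier (obj M n)"
    and comm: "\<And>n x. x \<in> carrier (obj M n) \<Longrightarrow> diff P n (p n x) = p (n + 1) (diff M n x)"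
  shows "P \<in> complexes R"
proof -
  have "diff P (n + 1) (diff P n y) = \<zero>\<^bsub>obj P (n + 1 + 1)\<^esub>" if y: "y \<in> carrier (obj P n)" for n y
  proof -
    obtain x where x: "x \<in> carrier (obj M n)" "y = p n x" using y p(2) by auto
    have dx: "diff M n x \<in> carrier (obj M (n + 1))"
      by (rule mod_hom_closed[OF complexes_diff[OF M] x(1)])
    show ?thesis
      unfolding x(2) comm[OF x(1)] comm[OF dx] complexes_diff_diff[OF M x(1)]
      by (rule linear_map_zero[OF complexes_module[OF M] P p(1)])
  qed
  then show ?thesis using P d by (auto simp: complexes_def)
qed

text \<open>The isomorphism is \<open>u\<close> followed by the inverse of \<open>v\<close> on the common image. It is linear and commutes with
  differentials because this can be checked after applying \<open>v\<close>.\<close>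

lemma cpx_iso_of_injections:
  assumes P: "P \<in> complexes R" and Q: "Q \<in> complexes R"
    and u: "\<And>n. linear_map R (obj P n) (obj M n) (u n)" "\<And>n. inj_on (u n) (carrier (obj P n))"
      "\<And>n x. x \<in> carrier (obj P n) \<Longrightarrow> u (n + 1) (diff P n x) = diff M n (u n x)"
    and v: "\<And>n. linear_map R (obj Q n) (obj M n) (v n)" "\<And>n. inj_on (v n) (carrier (obj Q n))"
      "\<And>n x. x \<in> carrier (obj Q n) \<Longrightarrow> v (n + 1) (diff Q n x) = diff M n (v n x)"
    and img: "\<And>n. u n ` carrier (obj P n) = v n ` carrier (obj Q n)"
  shows "cpx_iso R P Q"
proof -
  define f where "f n = (\<lambda>x\<in>carrier (obj P n). inv_into (carrier (obj Q n)) (v n) (u n x))" for n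
  have vf: "v n (f n x) = u n x" and fc: "f n x \<in> carrier (obj Q n)" if x: "x \<in> carrier (obj P n)" for n x
  proof -
    have "u n x \<in> v n ` carrier (obj Q n)" using x img by blast
    then show "v n (f n x) = u n x" "f n x \<in> carrier (obj Q n)"
      using x by (auto simp: f_def f_inv_into_f inv_into_into)
  qed
  have lin: "f n \<in> mod_hom R (obj P n) (obj Q n)" for n
  proof (rule mod_homI)
    show "linear_map R (obj P n) (obj Q n) (f n)"
      by (rule linear_map_cancel_injection[OF complexes_module[OF P] complexes_module[OF Q] v(1) v(2)])
        (simp_all add: fc linear_map_cong[OF complexes_module[OF P] u(1) vf])
    show "f n \<in> extensional (carrier (obj P n))" by (simp add: f_def)
  qed
  have dP: "diff P n x \<in> carrier (obj P (n + 1))" if "x \<in> carrier (obj P n)" for n x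
    using mod_hom_closed[OF complexes_diff[OF P] that] .
  have dQ: "diff Q n x \<in> carrier (obj Q (n + 1))" if "x \<in> carrier (obj Q n)" for n x
    using mod_hom_closed[OF complexes_diff[OF Q] that] .
  have "f \<in> chain_maps R P Q"
    unfolding chain_maps_def
  proof (intro CollectI conjI allI ballI)
    fix n x assume x: "x \<in> carrier (obj P n)"
    show "diff Q n (f n x) = f (n + 1) (diff P n x)"
    proof (rule inj_onD[OF v(2)])
      show "v (n + 1) (diff Q n (f n x)) = v (n + 1) (f (n + 1) (diff P n x))"
        unfolding v(3)[OF fc[OF x]] vf[OF x] vf[OF dP[OF x]] u(3)[OF x] ..
    qed (intro dQ fc dP x)+
  qed (rule lin)
  moreover have "bij_betw (f n) (carrier (obj P n)) (carrier (obj Q n))" for n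
  proof (rule bij_betw_imageI)
    show "inj_on (f n) (carrier (obj P n))"
    proof (rule inj_onI)
      fix x y assume xy: "x \<in> carrier (obj P n)" "y \<in> carrier (obj P n)" "f n x = f n y"
      then have "u n x = u n y" using vf[of x n] vf[of y n] by simp
      then show "x = y" using xy(1,2) u(2) by (auto dest: inj_onD)
    qed
    show "f n ` carrier (obj P n) = carrier (obj Q n)"
    proof
      show "f n ` carrier (obj P n) \<subseteq> carrier (obj Q n)" using fc by auto
      show "carrier (obj Q n) \<subseteq> f n ` carrier (obj P n)"
      proof
        fix y assume y: "y \<in> carrier (obj Q n)"
        then have "v n y \<in> u n ` carrier (obj P n)" using img by blast
        then obtain x where x: "x \<in> carrier (obj P n)" "v n y = u n x" by auto
        have "f n x = y" by (rule inj_onD[OF v(2)]) (use x y fc vf in auto)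
        then show "y \<in> f n ` carrier (obj P n)" using x(1) by auto
      qed
    qed
  qed
  ultimately show ?thesis using P Q by (auto simp: cpx_iso_def)
qed

lemma cpx_iso_of_surjections:
  assumes M: "M \<in> complexes R" and P: "P \<in> complexes R" and Q: "Q \<in> complexes R"
    and p: "\<And>n. linear_map R (obj M n) (obj P n) (p n)" "\<And>n. carrier (obj P n) = p n ` carrier (obj M n)"
      "\<And>n x. x \<in> carrier (obj M n) \<Longrightarrow> diff P n (p n x) = p (n + 1) (diff M n x)"
    and q: "\<And>n. linear_map R (obj M n) (obj Q n) (q n)" "\<And>n. carrier (obj Q n) = q n ` carrier (obj M n)"
      "\<And>n x. x \<in> carrier (obj M n) \<Longrightarrow> diff Q n (q n x) = q (n + 1) (diff M n x)"
    and ker: "\<And>n x y. \<lbrakk>x \<in> carrier (obj M n); y \<in> carrier (obj M n)\<rbrakk> \<Longrightarrow> p n x = p n y \<longleftrightarrow> q n x = q n y"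
  shows "cpx_iso R P Q"
proof -
  have "\<exists>g. g \<in> mod_hom R (obj P n) (obj Q n) \<and> (\<forall>x\<in>carrier (obj M n). g (p n x) = q n x)" for n
    by (rule descend_along_surjection[OF complexes_module[OF M] p(1) p(2) q(1)]) (use ker in blast)+
  then obtain f where f: "\<And>n. f n \<in> mod_hom R (obj P n) (obj Q n)"
    and fp: "\<And>n x. x \<in> carrier (obj M n) \<Longrightarrow> f n (p n x) = q n x"
    by metis
  have dM: "diff M n x \<in> carrier (obj M (n + 1))" if "x \<in> carrier (obj M n)" for n x
    using mod_hom_closed[OF complexes_diff[OF M] that] .
  have "f \<in> chain_maps R P Q"
    using f by (auto simp: chain_maps_def p(2,3) q(3) fp dM)
  moreover have "bij_betw (f n) (carrier (obj P n)) (carrier (obj Q n))" for n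
  proof (rule bij_betw_imageI)
    show "inj_on (f n) (carrier (obj P n))"
      unfolding p(2) by (rule inj_onI) (auto simp: fp ker)
    show "f n ` carrier (obj P n) = carrier (obj Q n)"
      by (simp add: p(2) q(2) image_image fp)
  qed
  ultimately show ?thesis using P Q by (auto simp: cpx_iso_def)
qed

lemma chain_id_mod_hom:
  assumes "M \<in> complexes R"
  shows "chain_id M n \<in> mod_hom R (obj M n) (obj M n)"
  unfolding chain_id_def
  by (rule restrict_mod_hom[OF complexes_module[OF assms]]) (rule linear_mapI; simp)

lemma chain_comp_mod_hom:
  assumes "L \<in> complexes R" "f n \<in> mod_hom R (obj L n) (obj M n)" "g n \<in> mod_hom R (obj M n) (obj N n)"
  shows "chain_comp L g f n \<in> mod_hom R (obj L n) (obj N n)"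
  unfolding chain_comp_def
  by (rule compose_mod_hom[OF complexes_module[OF assms(1)] mod_homD[OF assms(2)] mod_homD[OF assms(3)]])

text \<open>Every functor law is an equation between maps into \<open>F N\<close>, and can be checked after the natural
  injection \<open>u\<close> into \<open>N\<close>, where it becomes a law for composition of the given chain maps.\<close>

lemma cpx_functor_of_injection:
  assumes C: "\<C> \<subseteq> complexes R" and F: "\<And>M. M \<in> \<C> \<Longrightarrow> F M \<in> \<D>" and D: "\<D> \<subseteq> complexes R"
    and u: "\<And>M n. M \<in> \<C> \<Longrightarrow> inj_on (u M n) (carrier (obj (F M) n))"
      "\<And>M n x. \<lbrakk>M \<in> \<C>; x \<in> carrier (obj (F M) n)\<rbrakk> \<Longrightarrow> u M n x \<in> carrier (obj M n)"
      "\<And>M n x. \<lbrakk>M \<in> \<C>; x \<in> carrier (obj (F M) n)\<rbrakk> \<Longrightarrow> u M (n + 1) (diff (F M) n x) = diff M n (u M n x)"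
    and \<phi>: "\<And>M N f n. \<lbrakk>M \<in> \<C>; N \<in> \<C>; \<And>n. f n \<in> mod_hom R (obj M n) (obj N n)\<rbrakk> \<Longrightarrow>
        \<phi> M N f n \<in> mod_hom R (obj (F M) n) (obj (F N) n)"
      "\<And>M N f n x. \<lbrakk>M \<in> \<C>; N \<in> \<C>; \<And>n. f n \<in> mod_hom R (obj M n) (obj N n); x \<in> carrier (obj (F M) n)\<rbrakk> \<Longrightarrow>
        u N n (\<phi> M N f n x) = f n (u M n x)"
  shows "cpx_functor R \<C> \<D> F \<phi>"
  unfolding cpx_functor_def
proof (intro conjI ballI)
  have cm: "M \<in> \<C> \<Longrightarrow> M \<in> complexes R" "M \<in> \<C> \<Longrightarrow> F M \<in> complexes R" for M using C F D by auto
  have dF: "diff (F M) n x \<in> carrier (obj (F M) (n + 1))" if "M \<in> \<C>" "x \<in> carrier (obj (F M) n)" for M n x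
    using mod_hom_closed[OF complexes_diff[OF cm(2)[OF that(1)]] that(2)] .
  have eqI: "f = g" if M: "M \<in> \<C>" and N: "N \<in> \<C>"
    and f: "\<And>n. f n \<in> mod_hom R (obj (F M) n) (obj (F N) n)"
    and g: "\<And>n. g n \<in> mod_hom R (obj (F M) n) (obj (F N) n)"
    and eq: "\<And>n x. x \<in> carrier (obj (F M) n) \<Longrightarrow> u N n (f n x) = u N n (g n x)" for M N f g
  proof
    fix n show "f n = g n"
    proof (rule mod_hom_eqI[OF f g])
      fix x assume x: "x \<in> carrier (obj (F M) n)"
      show "f n x = g n x"
        by (rule inj_onD[OF u(1)[OF N, of n]])
          (rule eq[OF x] mod_hom_closed[OF f x] mod_hom_closed[OF g x])+
    qed
  qed
  show "F M \<in> \<D>" if "M \<in> \<C>" for M using F that .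
  show "\<phi> M N f \<in> chain_maps R (F M) (F N)" if M: "M \<in> \<C>" and N: "N \<in> \<C>" and f: "f \<in> chain_maps R M N" for M N f
    unfolding chain_maps_def
  proof (intro CollectI conjI allI ballI)
    have fh: "\<And>n. f n \<in> mod_hom R (obj M n) (obj N n)"
      and fd: "\<And>n x. x \<in> carrier (obj M n) \<Longrightarrow> diff N n (f n x) = f (n + 1) (diff M n x)"
      using f by (auto simp: chain_maps_def)
    note ph = \<phi>(1)[OF M N fh]
    show "\<phi> M N f n \<in> mod_hom R (obj (F M) n) (obj (F N) n)" for n by (rule ph)
    fix n x assume x: "x \<in> carrier (obj (F M) n)"
    have px: "\<phi> M N f n x \<in> carrier (obj (F N) n)" by (rule mod_hom_closed[OF ph x])
    show "diff (F N) n (\<phi> M N f n x) = \<phi> M N f (n + 1) (diff (F M) n x)"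
    proof (rule inj_onD[OF u(1)[OF N]])
      show "u N (n + 1) (diff (F N) n (\<phi> M N f n x)) = u N (n + 1) (\<phi> M N f (n + 1) (diff (F M) n x))"
        unfolding u(3)[OF N px] \<phi>(2)[OF M N fh x] \<phi>(2)[OF M N fh dF[OF M x]] u(3)[OF M x]
        by (rule fd[OF u(2)[OF M x]])
    qed (use dF[OF N px] mod_hom_closed[OF ph dF[OF M x]] in auto)
  qed
  show "\<phi> M M (chain_id M) = chain_id (F M)" if M: "M \<in> \<C>" for M
  proof (rule eqI[OF M M])
    note ih = chain_id_mod_hom[OF cm(1)[OF M]]
    show "\<phi> M M (chain_id M) n \<in> mod_hom R (obj (F M) n) (obj (F M) n)" for n by (rule \<phi>(1)[OF M M ih])
    show "chain_id (F M) n \<in> mod_hom R (obj (F M) n) (obj (F M) n)" for n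
      by (rule chain_id_mod_hom[OF cm(2)[OF M]])
    show "u M n (\<phi> M M (chain_id M) n x) = u M n (chain_id (F M) n x)" if "x \<in> carrier (obj (F M) n)" for n x
      using \<phi>(2)[OF M M ih that] that u(2)[OF M that] by (simp add: chain_id_def)
  qed
  show "\<phi> L N (chain_comp L g f) = chain_comp (F L) (\<phi> M N g) (\<phi> L M f)"
    if L: "L \<in> \<C>" and M: "M \<in> \<C>" and N: "N \<in> \<C>" and f: "f \<in> chain_maps R L M" and g: "g \<in> chain_maps R M N"
    for L M N f g
  proof (rule eqI[OF L N])
    have fh: "\<And>n. f n \<in> mod_hom R (obj L n) (obj M n)" and gh: "\<And>n. g n \<in> mod_hom R (obj M n) (obj N n)"
      using f g by (auto simp: chain_maps_def)
    have ch: "chain_comp L g f n \<in> mod_hom R (obj L n) (obj N n)" for n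
      by (rule chain_comp_mod_hom[OF cm(1)[OF L] fh gh])
    show "\<phi> L N (chain_comp L g f) n \<in> mod_hom R (obj (F L) n) (obj (F N) n)" for n
      by (rule \<phi>(1)[OF L N ch])
    show "chain_comp (F L) (\<phi> M N g) (\<phi> L M f) n \<in> mod_hom R (obj (F L) n) (obj (F N) n)" for n
      by (rule chain_comp_mod_hom[OF cm(2)[OF L] \<phi>(1)[OF L M fh] \<phi>(1)[OF M N gh]])
    fix n x assume x: "x \<in> carrier (obj (F L) n)"
    have px: "\<phi> L M f n x \<in> carrier (obj (F M) n)"
      by (rule mod_hom_closed[OF \<phi>(1)[OF L M fh] x])
    show "u N n (\<phi> L N (chain_comp L g f) n x) = u N n (chain_comp (F L) (\<phi> M N g) (\<phi> L M f) n x)"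
      using \<phi>(2)[OF L N ch x] \<phi>(2)[OF M N gh px] \<phi>(2)[OF L M fh x] x u(2)[OF L x]
      by (simp add: chain_comp_def compose_def)
  qed
qed

text \<open>Dually, every functor law is an equation between maps out of \<open>F M\<close>, and can be checked after the
  natural surjection \<open>p\<close> from \<open>M\<close>.\<close>

lemma cpx_functor_of_surjection:
  assumes C: "\<C> \<subseteq> complexes R" and F: "\<And>M. M \<in> \<C> \<Longrightarrow> F M \<in> \<D>" and D: "\<D> \<subseteq> complexes R"
    and p: "\<And>M n. M \<in> \<C> \<Longrightarrow> carrier (obj (F M) n) = p M n ` carrier (obj M n)"
      "\<And>M n x. \<lbrakk>M \<in> \<C>; x \<in> carrier (obj M n)\<rbrakk> \<Longrightarrow> diff (F M) n (p M n x) = p M (n + 1) (diff M n x)"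
    and \<phi>: "\<And>M N f n. \<lbrakk>M \<in> \<C>; N \<in> \<C>; \<And>n. f n \<in> mod_hom R (obj M n) (obj N n)\<rbrakk> \<Longrightarrow>
        \<phi> M N f n \<in> mod_hom R (obj (F M) n) (obj (F N) n)"
      "\<And>M N f n x. \<lbrakk>M \<in> \<C>; N \<in> \<C>; \<And>n. f n \<in> mod_hom R (obj M n) (obj N n); x \<in> carrier (obj M n)\<rbrakk> \<Longrightarrow>
        \<phi> M N f n (p M n x) = p N n (f n x)"
  shows "cpx_functor R \<C> \<D> F \<phi>"
  unfolding cpx_functor_def
proof (intro conjI ballI)
  have cm: "M \<in> \<C> \<Longrightarrow> M \<in> complexes R" "M \<in> \<C> \<Longrightarrow> F M \<in> complexes R" for M using C F D by auto
  have dM: "diff M n x \<in> carrier (obj M (n + 1))" if "M \<in> \<C>" "x \<in> carrier (obj M n)" for M n x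
    using mod_hom_closed[OF complexes_diff[OF cm(1)[OF that(1)]] that(2)] .
  have eqI: "f = g" if M: "M \<in> \<C>"
    and f: "\<And>n. f n \<in> mod_hom R (obj (F M) n) (obj (F N) n)"
    and g: "\<And>n. g n \<in> mod_hom R (obj (F M) n) (obj (F N) n)"
    and eq: "\<And>n x. x \<in> carrier (obj M n) \<Longrightarrow> f n (p M n x) = g n (p M n x)" for M N f g
  proof
    fix n show "f n = g n"
      by (rule mod_hom_eqI[OF f g]) (use eq in \<open>auto simp: p(1)[OF M]\<close>)
  qed
  show "F M \<in> \<D>" if "M \<in> \<C>" for M using F that .
  show "\<phi> M N f \<in> chain_maps R (F M) (F N)" if M: "M \<in> \<C>" and N: "N \<in> \<C>" and f: "f \<in> chain_maps R M N" for M N f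
    unfolding chain_maps_def
  proof (intro CollectI conjI allI ballI)
    have fh: "\<And>n. f n \<in> mod_hom R (obj M n) (obj N n)"
      and fd: "\<And>n x. x \<in> carrier (obj M n) \<Longrightarrow> diff N n (f n x) = f (n + 1) (diff M n x)"
      using f by (auto simp: chain_maps_def)
    show "\<phi> M N f n \<in> mod_hom R (obj (F M) n) (obj (F N) n)" for n by (rule \<phi>(1)[OF M N fh])
    fix n y assume "y \<in> carrier (obj (F M) n)"
    then obtain x where x: "x \<in> carrier (obj M n)" "y = p M n x" by (auto simp: p(1)[OF M])
    have fx: "f n x \<in> carrier (obj N n)" by (rule mod_hom_closed[OF fh x(1)])
    show "diff (F N) n (\<phi> M N f n y) = \<phi> M N f (n + 1) (diff (F M) n y)"
      unfolding x(2) \<phi>(2)[OF M N fh x(1)] p(2)[OF N fx] p(2)[OF M x(1)] \<phi>(2)[OF M N fh dM[OF M x(1)]] fd[OF x(1)] ..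
  qed
  show "\<phi> M M (chain_id M) = chain_id (F M)" if M: "M \<in> \<C>" for M
  proof (rule eqI[OF M])
    note ih = chain_id_mod_hom[OF cm(1)[OF M]]
    show "\<phi> M M (chain_id M) n \<in> mod_hom R (obj (F M) n) (obj (F M) n)" for n by (rule \<phi>(1)[OF M M ih])
    show "chain_id (F M) n \<in> mod_hom R (obj (F M) n) (obj (F M) n)" for n
      by (rule chain_id_mod_hom[OF cm(2)[OF M]])
    show "\<phi> M M (chain_id M) n (p M n x) = chain_id (F M) n (p M n x)" if "x \<in> carrier (obj M n)" for n x
      using \<phi>(2)[OF M M ih that] that by (simp add: chain_id_def p(1)[OF M])
  qed
  show "\<phi> L N (chain_comp L g f) = chain_comp (F L) (\<phi> M N g) (\<phi> L M f)"
    if L: "L \<in> \<C>" and M: "M \<in> \<C>" and N: "N \<in> \<C>" and f: "f \<in> chain_maps R L M" and g: "g \<in> chain_maps R M N"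
    for L M N f g
  proof (rule eqI[OF L])
    have fh: "\<And>n. f n \<in> mod_hom R (obj L n) (obj M n)" and gh: "\<And>n. g n \<in> mod_hom R (obj M n) (obj N n)"
      using f g by (auto simp: chain_maps_def)
    have ch: "chain_comp L g f n \<in> mod_hom R (obj L n) (obj N n)" for n
      by (rule chain_comp_mod_hom[OF cm(1)[OF L] fh gh])
    show "\<phi> L N (chain_comp L g f) n \<in> mod_hom R (obj (F L) n) (obj (F N) n)" for n
      by (rule \<phi>(1)[OF L N ch])
    show "chain_comp (F L) (\<phi> M N g) (\<phi> L M f) n \<in> mod_hom R (obj (F L) n) (obj (F N) n)" for n
      by (rule chain_comp_mod_hom[OF cm(2)[OF L] \<phi>(1)[OF L M fh] \<phi>(1)[OF M N gh]])
    fix n x assume x: "x \<in> carrier (obj L n)"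
    have fx: "f n x \<in> carrier (obj M n)" by (rule mod_hom_closed[OF fh x])
    show "\<phi> L N (chain_comp L g f) n (p L n x) = chain_comp (F L) (\<phi> M N g) (\<phi> L M f) n (p L n x)"
      using \<phi>(2)[OF L N ch x] \<phi>(2)[OF M N gh fx] \<phi>(2)[OF L M fh x] x
      by (simp add: chain_comp_def compose_def p(1)[OF L])
  qed
qed

subsection \<open>Hom complexes\<close>

lemma Hom_cpx_obj: "obj (Hom_cpx R M N) n = prod_mod (\<lambda>i. Hom_mod R (obj M i) (obj N (i + n)))"
  by (simp add: Hom_cpx_def Let_def)

lemma Hom_cpx_carrier: "f \<in> carrier (obj (Hom_cpx R M N) n) \<longleftrightarrow> (\<forall>i. f i \<in> mod_hom R (obj M i) (obj N (i + n)))"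
  by (simp add: Hom_cpx_obj)

lemma Hom_cpx_diff:
  assumes "f \<in> carrier (obj (Hom_cpx R M N) n)" "x \<in> carrier (obj M i)"
  shows "diff (Hom_cpx R M N) n f i x = diff N (i + n) (f i x)
    \<ominus>\<^bsub>obj N (i + n + 1)\<^esub> signed (obj N (i + n + 1)) n (f (i + 1) (diff M i x))"
  using assms by (simp add: Hom_cpx_def Let_def)

lemma Hom_cpx_diff_extensional:
  "f \<in> carrier (obj (Hom_cpx R M N) n) \<Longrightarrow> diff (Hom_cpx R M N) n f i \<in> extensional (carrier (obj M i))"
  "diff (Hom_cpx R M N) n \<in> extensional (carrier (obj (Hom_cpx R M N) n))"
  by (simp_all add: Hom_cpx_def Let_def)

lemma signed_linear:
  assumes "module R M"
  shows "linear_map R M M (signed M n)"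
proof -
  interpret M: module R M by fact
  show ?thesis
    by (rule linear_mapI) (auto simp: signed_def M.M.minus_add M.smult_r_minus)
qed

lemma signed_natural:
  assumes "module R M" "module R N" "linear_map R M N f" "x \<in> carrier M"
  shows "f (signed M n x) = signed N n (f x)"
  using linear_map_neg[OF assms] by (simp add: signed_def)

text \<open>The pattern of \<open>dd\<close> in a Hom complex: the two mixed terms carry the signs of degrees \<open>n\<close> and \<open>n + 1\<close>,
  which are opposite.\<close>

lemma signed_cancel:
  assumes "module R M" "x \<in> carrier M"
  shows "(\<zero>\<^bsub>M\<^esub> \<ominus>\<^bsub>M\<^esub> signed M n x) \<ominus>\<^bsub>M\<^esub> signed M (n + 1) (x \<ominus>\<^bsub>M\<^esub> signed M n \<zero>\<^bsub>M\<^esub>) = \<zero>\<^bsub>M\<^esub>"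
proof -
  interpret M: module R M by fact
  have z: "\<ominus>\<^bsub>M\<^esub> \<zero>\<^bsub>M\<^esub> = \<zero>\<^bsub>M\<^esub>" by (rule M.M.minus_equality) simp_all
  show ?thesis using assms(2) by (simp add: z signed_def a_minus_def M.M.l_neg M.M.r_neg)
qed

lemma linear_map_minus:
  assumes "module R M" "module R N" "linear_map R M N f" "linear_map R M N g"
  shows "linear_map R M N (\<lambda>x. f x \<ominus>\<^bsub>N\<^esub> g x)"
proof -
  interpret M: module R M by fact
  interpret N: module R N by fact
  show ?thesis
    unfolding a_minus_def
    by (rule linear_mapI)
      (auto simp: linear_mapD[OF assms(3)] linear_mapD[OF assms(4)] N.M.minus_add N.M.a_ac
        N.smult_r_distr N.smult_r_minus)
qed

lemma Hom_cpx_module: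
  assumes "\<And>n. module R (obj M n)" "\<And>n. module R (obj N n)"
  shows "module R (obj (Hom_cpx R M N) n)"
  unfolding Hom_cpx_obj by (intro prod_mod_module Hom_mod_module assms)

lemma Hom_cpx_diff_closed:
  assumes M: "M \<in> complexes R" and N: "N \<in> complexes R" and f: "f \<in> carrier (obj (Hom_cpx R M N) n)"
  shows "diff (Hom_cpx R M N) n f \<in> carrier (obj (Hom_cpx R M N) (n + 1))"
  unfolding Hom_cpx_carrier
proof
  fix i
  note mM = complexes_module[OF M] and mN = complexes_module[OF N]
  have fh: "linear_map R (obj M i) (obj N (i + n)) (f i)" for i
    using f by (auto simp: Hom_cpx_carrier mod_homD)
  have fh': "linear_map R (obj M (i + 1)) (obj N (i + n + 1)) (f (i + 1))"
    using fh[of "i + 1"] by (simp add: ac_simps)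
  have "linear_map R (obj M i) (obj N (i + n + 1)) (\<lambda>x. diff N (i + n) (f i x)
    \<ominus>\<^bsub>obj N (i + n + 1)\<^esub> signed (obj N (i + n + 1)) n (f (i + 1) (diff M i x)))"
    by (intro linear_map_minus mM mN linear_map_comp[OF fh mod_homD[OF complexes_diff[OF N]]]
        linear_map_comp[OF linear_map_comp[OF mod_homD[OF complexes_diff[OF M]] fh'] signed_linear])
  then have "linear_map R (obj M i) (obj N (i + n + 1)) (diff (Hom_cpx R M N) n f i)"
    by (rule linear_map_cong[OF mM]) (rule Hom_cpx_diff[OF f])
  then have "diff (Hom_cpx R M N) n f i \<in> mod_hom R (obj M i) (obj N (i + n + 1))"
    by (rule mod_homI) (rule Hom_cpx_diff_extensional(1)[OF f])
  then show "diff (Hom_cpx R M N) n f i \<in> mod_hom R (obj M i) (obj N (i + (n + 1)))"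
    by (simp add: ac_simps)
qed

lemma Hom_cpx_eqI:
  assumes "f \<in> carrier (obj (Hom_cpx R M N) n)" "g \<in> carrier (obj (Hom_cpx R M N) n)"
    and "\<And>i x. x \<in> carrier (obj M i) \<Longrightarrow> f i x = g i x"
  shows "f = g"
proof
  fix i show "f i = g i"
    using assms(1,2) by (intro mod_hom_eqI[of "f i" R "obj M i" "obj N (i + n)" "g i"] assms(3))
      (auto simp: Hom_cpx_carrier)
qed

lemma Hom_cpx_ops:
  assumes "x \<in> carrier (obj M i)"
  shows "(f \<oplus>\<^bsub>obj (Hom_cpx R M N) n\<^esub> g) i x = f i x \<oplus>\<^bsub>obj N (i + n)\<^esub> g i x"
    and "(r \<odot>\<^bsub>obj (Hom_cpx R M N) n\<^esub> f) i x = r \<odot>\<^bsub>obj N (i + n)\<^esub> f i x"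
    and "\<zero>\<^bsub>obj (Hom_cpx R M N) n\<^esub> i x = \<zero>\<^bsub>obj N (i + n)\<^esub>"
  using assms by (simp_all add: Hom_cpx_obj)

lemma Hom_cpx_diff_linear:
  assumes M: "M \<in> complexes R" and N: "N \<in> complexes R"
  shows "diff (Hom_cpx R M N) n \<in> mod_hom R (obj (Hom_cpx R M N) n) (obj (Hom_cpx R M N) (n + 1))"
proof (rule mod_homI)
  note mM = complexes_module[OF M] and mN = complexes_module[OF N]
  note dM = mod_hom_closed[OF complexes_diff[OF M]] and dN = mod_homD[OF complexes_diff[OF N]]
  interpret H: module R "obj (Hom_cpx R M N) d" for d by (rule Hom_cpx_module[OF mM mN])
  interpret N: module R "obj N d" for d by (rule mN)
  note cl = Hom_cpx_diff_closed[OF M N]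
  have fc: "f i x \<in> carrier (obj N (i + n))" "f (i + 1) (diff M i x) \<in> carrier (obj N (i + n + 1))"
    if "f \<in> carrier (obj (Hom_cpx R M N) n)" "x \<in> carrier (obj M i)" for f i x
  proof -
    have h: "f i \<in> mod_hom R (obj M i) (obj N (i + n))" for i using that(1) by (simp add: Hom_cpx_carrier)
    show "f i x \<in> carrier (obj N (i + n))" by (rule mod_hom_closed[OF h that(2)])
    show "f (i + 1) (diff M i x) \<in> carrier (obj N (i + n + 1))"
      using mod_hom_closed[OF h dM[OF that(2)]] by (simp add: ac_simps)
  qed
  have ix: "i + 1 + n = i + n + 1" "i + (n + 1) = i + n + 1" for i by simp_all
  show "linear_map R (obj (Hom_cpx R M N) n) (obj (Hom_cpx R M N) (n + 1)) (diff (Hom_cpx R M N) n)"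
  proof (rule linear_mapI)
    fix f g assume f: "f \<in> carrier (obj (Hom_cpx R M N) n)" and g: "g \<in> carrier (obj (Hom_cpx R M N) n)"
    note fg = H.M.add.m_closed[OF f g]
    show "diff (Hom_cpx R M N) n (f \<oplus>\<^bsub>obj (Hom_cpx R M N) n\<^esub> g) =
      diff (Hom_cpx R M N) n f \<oplus>\<^bsub>obj (Hom_cpx R M N) (n + 1)\<^esub> diff (Hom_cpx R M N) n g"
    proof (rule Hom_cpx_eqI[OF cl[OF fg] H.M.add.m_closed[OF cl[OF f] cl[OF g]]])
      fix i x assume x: "x \<in> carrier (obj M i)"
      show "diff (Hom_cpx R M N) n (f \<oplus>\<^bsub>obj (Hom_cpx R M N) n\<^esub> g) i x =
        (diff (Hom_cpx R M N) n f \<oplus>\<^bsub>obj (Hom_cpx R M N) (n + 1)\<^esub> diff (Hom_cpx R M N) n g) i x"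
        unfolding Hom_cpx_ops[OF x] Hom_cpx_ops[OF dM[OF x]] Hom_cpx_diff[OF f x] Hom_cpx_diff[OF g x]
          Hom_cpx_diff[OF fg x] ix
        using fc[OF f x] fc[OF g x] linear_mapD[OF dN] linear_mapD[OF signed_linear[OF mN]]
        by (simp add: a_minus_def N.M.minus_add N.M.a_ac)
    qed
  next
    fix r f assume r: "r \<in> carrier R" and f: "f \<in> carrier (obj (Hom_cpx R M N) n)"
    note rf = H.smult_closed[OF r f]
    show "diff (Hom_cpx R M N) n (r \<odot>\<^bsub>obj (Hom_cpx R M N) n\<^esub> f) =
      r \<odot>\<^bsub>obj (Hom_cpx R M N) (n + 1)\<^esub> diff (Hom_cpx R M N) n f"
    proof (rule Hom_cpx_eqI[OF cl[OF rf] H.smult_closed[OF r cl[OF f]]])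
      fix i x assume x: "x \<in> carrier (obj M i)"
      show "diff (Hom_cpx R M N) n (r \<odot>\<^bsub>obj (Hom_cpx R M N) n\<^esub> f) i x =
        (r \<odot>\<^bsub>obj (Hom_cpx R M N) (n + 1)\<^esub> diff (Hom_cpx R M N) n f) i x"
        unfolding Hom_cpx_ops[OF x] Hom_cpx_ops[OF dM[OF x]] Hom_cpx_diff[OF f x] Hom_cpx_diff[OF rf x] ix
        using r fc[OF f x] linear_mapD[OF dN] linear_mapD[OF signed_linear[OF mN]]
        by (simp add: a_minus_def N.smult_r_distr N.smult_r_minus)
    qed
  qed (rule cl)
qed (rule Hom_cpx_diff_extensional(2))

lemma Hom_cpx_complex:
  assumes M: "M \<in> complexes R" and N: "N \<in> complexes R"
  shows "Hom_cpx R M N \<in> complexes R"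
proof -
  note mM = complexes_module[OF M] and mN = complexes_module[OF N]
  note dM = mod_hom_closed[OF complexes_diff[OF M]] and dN = mod_homD[OF complexes_diff[OF N]]
  note cl = Hom_cpx_diff_closed[OF M N]
  have "diff (Hom_cpx R M N) (n + 1) (diff (Hom_cpx R M N) n f) = \<zero>\<^bsub>obj (Hom_cpx R M N) (n + 1 + 1)\<^esub>"
    if f: "f \<in> carrier (obj (Hom_cpx R M N) n)" for n f
  proof (rule Hom_cpx_eqI[OF cl[OF cl[OF f]]])
    interpret H: module R "obj (Hom_cpx R M N) d" for d by (rule Hom_cpx_module[OF mM mN])
    show "\<zero>\<^bsub>obj (Hom_cpx R M N) (n + 1 + 1)\<^esub> \<in> carrier (obj (Hom_cpx R M N) (n + 1 + 1))"
      by (rule H.M.zero_closed)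
    fix i x assume x: "x \<in> carrier (obj M i)"
    \<comment> \<open>Indices such as \<open>i + 1 + n\<close> and \<open>i + (n + 1)\<close> are equal integers but different terms; all are
      expressed through \<open>k\<close>.\<close>
    define k where "k = i + n"
    have ix: "i + 1 + 1 + n = k + 1 + 1" "i + 1 + n = k + 1" "i + n = k"
      "i + (n + 1) = k + 1" "i + (n + 1 + 1) = k + 1 + 1" by (simp_all add: k_def)
    have fh: "f j \<in> mod_hom R (obj M j) (obj N (j + n))" for j using f by (simp add: Hom_cpx_carrier)
    define y where "y = f (i + 1) (diff M i x)"
    define a where "a = f i x"
    have a: "a \<in> carrier (obj N k)" using mod_hom_closed[OF fh x] by (simp add: a_def k_def)
    have y: "y \<in> carrier (obj N (k + 1))"
      using mod_hom_closed[OF fh dM[OF x]] unfolding ix y_def .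
    have y2: "f (i + 1 + 1) (diff M (i + 1) (diff M i x)) = \<zero>\<^bsub>obj N (k + 1 + 1)\<^esub>"
      using linear_map_zero[OF mM mN mod_homD[OF fh], of "i + 1 + 1"]
      unfolding complexes_diff_diff[OF M x] ix .
    note dy = linear_map_closed[OF dN y]
    note daN = linear_map_closed[OF dN a]
    have sy: "signed (obj N (k + 1)) n y \<in> carrier (obj N (k + 1))"
      by (rule linear_map_closed[OF signed_linear[OF mN] y])
    have "diff (Hom_cpx R M N) (n + 1) (diff (Hom_cpx R M N) n f) i x =
      diff N (k + 1) (diff N k a \<ominus>\<^bsub>obj N (k + 1)\<^esub> signed (obj N (k + 1)) n y)
      \<ominus>\<^bsub>obj N (k + 1 + 1)\<^esub> signed (obj N (k + 1 + 1)) (n + 1)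
        (diff N (k + 1) y \<ominus>\<^bsub>obj N (k + 1 + 1)\<^esub>
          signed (obj N (k + 1 + 1)) n (f (i + 1 + 1) (diff M (i + 1) (diff M i x))))"
      unfolding Hom_cpx_diff[OF cl[OF f] x] Hom_cpx_diff[OF f x] Hom_cpx_diff[OF f dM[OF x]] ix y_def a_def ..
    also have "\<dots> = (\<zero>\<^bsub>obj N (k + 1 + 1)\<^esub> \<ominus>\<^bsub>obj N (k + 1 + 1)\<^esub> signed (obj N (k + 1 + 1)) n (diff N (k + 1) y))
      \<ominus>\<^bsub>obj N (k + 1 + 1)\<^esub> signed (obj N (k + 1 + 1)) (n + 1)
        (diff N (k + 1) y \<ominus>\<^bsub>obj N (k + 1 + 1)\<^esub> signed (obj N (k + 1 + 1)) n \<zero>\<^bsub>obj N (k + 1 + 1)\<^esub>)"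
      unfolding y2 linear_map_diff[OF mN mN dN daN sy] complexes_diff_diff[OF N a] signed_natural[OF mN mN dN y] ..
    also have "\<dots> = \<zero>\<^bsub>obj N (k + 1 + 1)\<^esub>"
      by (rule signed_cancel[OF mN dy])
    finally show "diff (Hom_cpx R M N) (n + 1) (diff (Hom_cpx R M N) n f) i x =
        \<zero>\<^bsub>obj (Hom_cpx R M N) (n + 1 + 1)\<^esub> i x"
      unfolding Hom_cpx_ops[OF x] ix .
  qed
  then show ?thesis
    using Hom_cpx_module[OF mM mN] Hom_cpx_diff_linear[OF M N] by (auto simp: complexes_def)
qed

text \<open>The composites are restricted to the carrier because members of a Hom complex are extensional.\<close>

definition Hom_cpx_pre :: "('a, 'm) cpx \<Rightarrow> (int \<Rightarrow> 'm \<Rightarrow> 'p) \<Rightarrow> (int \<Rightarrow> 'p \<Rightarrow> 'n) \<Rightarrow> int \<Rightarrow> 'm \<Rightarrow> 'n" where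
  "Hom_cpx_pre M p f = (\<lambda>i. compose (carrier (obj M i)) (f i) (p i))"

definition Hom_cpx_post :: "('a, 'm) cpx \<Rightarrow> (int \<Rightarrow> 'p \<Rightarrow> 'n) \<Rightarrow> int \<Rightarrow> (int \<Rightarrow> 'm \<Rightarrow> 'p) \<Rightarrow> int \<Rightarrow> 'm \<Rightarrow> 'n" where
  "Hom_cpx_post M q n f = (\<lambda>i. compose (carrier (obj M i)) (q (i + n)) (f i))"

lemma Hom_cpx_pre_props:
  assumes M: "M \<in> complexes R" and P: "P \<in> complexes R" and N: "N \<in> complexes R"
    and p: "\<And>n. linear_map R (obj M n) (obj P n) (p n)"
    and comm: "\<And>n x. x \<in> carrier (obj M n) \<Longrightarrow> diff P n (p n x) = p (n + 1) (diff M n x)"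
  shows Hom_cpx_pre_linear: "linear_map R (obj (Hom_cpx R P N) n) (obj (Hom_cpx R M N) n) (Hom_cpx_pre M p)"
    and Hom_cpx_pre_diff: "f \<in> carrier (obj (Hom_cpx R P N) n) \<Longrightarrow>
      Hom_cpx_pre M p (diff (Hom_cpx R P N) n f) = diff (Hom_cpx R M N) n (Hom_cpx_pre M p f)"
proof -
  note mM = complexes_module[OF M] and mN = complexes_module[OF N] and mP = complexes_module[OF P]
  note dM = mod_hom_closed[OF complexes_diff[OF M]]
  interpret HM: module R "obj (Hom_cpx R M N) d" for d by (rule Hom_cpx_module[OF mM mN])
  interpret HP: module R "obj (Hom_cpx R P N) d" for d by (rule Hom_cpx_module[OF mP mN])
  have cl: "Hom_cpx_pre M p f \<in> carrier (obj (Hom_cpx R M N) n)"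
    if "f \<in> carrier (obj (Hom_cpx R P N) n)" for f n
    using that compose_mod_hom[OF mM p] unfolding Hom_cpx_carrier Hom_cpx_pre_def by (blast dest: mod_homD)
  have ev: "Hom_cpx_pre M p f i x = f i (p i x)" if "x \<in> carrier (obj M i)" for f i x
    using that by (simp add: Hom_cpx_pre_def compose_def)
  note px = linear_map_closed[OF p]
  show "linear_map R (obj (Hom_cpx R P N) n) (obj (Hom_cpx R M N) n) (Hom_cpx_pre M p)"
  proof (rule linear_mapI)
    fix f g assume f: "f \<in> carrier (obj (Hom_cpx R P N) n)" and g: "g \<in> carrier (obj (Hom_cpx R P N) n)"
    show "Hom_cpx_pre M p (f \<oplus>\<^bsub>obj (Hom_cpx R P N) n\<^esub> g) =
        Hom_cpx_pre M p f \<oplus>\<^bsub>obj (Hom_cpx R M N) n\<^esub> Hom_cpx_pre M p g"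
      by (rule Hom_cpx_eqI[OF cl[OF HP.M.add.m_closed[OF f g]] HM.M.add.m_closed[OF cl[OF f] cl[OF g]]])
        (simp add: ev Hom_cpx_ops px)
  next
    fix r f assume r: "r \<in> carrier R" and f: "f \<in> carrier (obj (Hom_cpx R P N) n)"
    show "Hom_cpx_pre M p (r \<odot>\<^bsub>obj (Hom_cpx R P N) n\<^esub> f) = r \<odot>\<^bsub>obj (Hom_cpx R M N) n\<^esub> Hom_cpx_pre M p f"
      by (rule Hom_cpx_eqI[OF cl[OF HP.smult_closed[OF r f]] HM.smult_closed[OF r cl[OF f]]])
        (simp add: ev Hom_cpx_ops px)
  qed (rule cl)
  assume f: "f \<in> carrier (obj (Hom_cpx R P N) n)"
  show "Hom_cpx_pre M p (diff (Hom_cpx R P N) n f) = diff (Hom_cpx R M N) n (Hom_cpx_pre M p f)"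
  proof (rule Hom_cpx_eqI[OF cl[OF Hom_cpx_diff_closed[OF P N f]] Hom_cpx_diff_closed[OF M N cl[OF f]]])
    fix i x assume x: "x \<in> carrier (obj M i)"
    show "Hom_cpx_pre M p (diff (Hom_cpx R P N) n f) i x = diff (Hom_cpx R M N) n (Hom_cpx_pre M p f) i x"
      unfolding ev[OF x] Hom_cpx_diff[OF f px[OF x]] Hom_cpx_diff[OF cl[OF f] x] ev[OF dM[OF x]] comm[OF x] ..
  qed
qed

lemma Hom_cpx_post_props:
  assumes M: "M \<in> complexes R" and P: "P \<in> complexes R" and N: "N \<in> complexes R"
    and q: "\<And>n. linear_map R (obj P n) (obj N n) (q n)"
    and comm: "\<And>n x. x \<in> carrier (obj P n) \<Longrightarrow> q (n + 1) (diff P n x) = diff N n (q n x)"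
  shows Hom_cpx_post_linear: "linear_map R (obj (Hom_cpx R M P) n) (obj (Hom_cpx R M N) n) (Hom_cpx_post M q n)"
    and Hom_cpx_post_diff: "f \<in> carrier (obj (Hom_cpx R M P) n) \<Longrightarrow>
      Hom_cpx_post M q (n + 1) (diff (Hom_cpx R M P) n f) = diff (Hom_cpx R M N) n (Hom_cpx_post M q n f)"
proof -
  note mM = complexes_module[OF M] and mN = complexes_module[OF N] and mP = complexes_module[OF P]
  note dM = mod_hom_closed[OF complexes_diff[OF M]] and dP = mod_hom_closed[OF complexes_diff[OF P]]
  interpret HN: module R "obj (Hom_cpx R M N) d" for d by (rule Hom_cpx_module[OF mM mN])
  interpret HP: module R "obj (Hom_cpx R M P) d" for d by (rule Hom_cpx_module[OF mM mP])
  have cl: "Hom_cpx_post M q n f \<in> carrier (obj (Hom_cpx R M N) n)"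
    if "f \<in> carrier (obj (Hom_cpx R M P) n)" for f n
    using that compose_mod_hom[OF mM _ q] unfolding Hom_cpx_carrier Hom_cpx_post_def by (blast dest: mod_homD)
  have ev: "Hom_cpx_post M q n f i x = q (i + n) (f i x)" if "x \<in> carrier (obj M i)" for f i n x
    using that by (simp add: Hom_cpx_post_def compose_def)
  have fc: "f i x \<in> carrier (obj P (i + n))"
    if "f \<in> carrier (obj (Hom_cpx R M P) n)" "x \<in> carrier (obj M i)" for f i n x
    using that mod_hom_closed[of "f i"] unfolding Hom_cpx_carrier by blast
  show "linear_map R (obj (Hom_cpx R M P) n) (obj (Hom_cpx R M N) n) (Hom_cpx_post M q n)"
  proof (rule linear_mapI)
    fix f g assume f: "f \<in> carrier (obj (Hom_cpx R M P) n)" and g: "g \<in> carrier (obj (Hom_cpx R M P) n)"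
    show "Hom_cpx_post M q n (f \<oplus>\<^bsub>obj (Hom_cpx R M P) n\<^esub> g) =
        Hom_cpx_post M q n f \<oplus>\<^bsub>obj (Hom_cpx R M N) n\<^esub> Hom_cpx_post M q n g"
      by (rule Hom_cpx_eqI[OF cl[OF HP.M.add.m_closed[OF f g]] HN.M.add.m_closed[OF cl[OF f] cl[OF g]]])
        (simp add: ev Hom_cpx_ops linear_map_add[OF q] fc[OF f] fc[OF g])
  next
    fix r f assume r: "r \<in> carrier R" and f: "f \<in> carrier (obj (Hom_cpx R M P) n)"
    show "Hom_cpx_post M q n (r \<odot>\<^bsub>obj (Hom_cpx R M P) n\<^esub> f) = r \<odot>\<^bsub>obj (Hom_cpx R M N) n\<^esub> Hom_cpx_post M q n f"
      by (rule Hom_cpx_eqI[OF cl[OF HP.smult_closed[OF r f]] HN.smult_closed[OF r cl[OF f]]])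
        (simp add: ev Hom_cpx_ops linear_map_smult[OF q] r fc[OF f])
  qed (rule cl)
  assume f: "f \<in> carrier (obj (Hom_cpx R M P) n)"
  show "Hom_cpx_post M q (n + 1) (diff (Hom_cpx R M P) n f) = diff (Hom_cpx R M N) n (Hom_cpx_post M q n f)"
  proof (rule Hom_cpx_eqI[OF cl[OF Hom_cpx_diff_closed[OF M P f]] Hom_cpx_diff_closed[OF M N cl[OF f]]])
    fix i x assume x: "x \<in> carrier (obj M i)"
    define k where "k = i + n"
    have ix: "i + (n + 1) = k + 1" "i + 1 + n = k + 1" "i + n = k" by (simp_all add: k_def)
    have y: "f (i + 1) (diff M i x) \<in> carrier (obj P (k + 1))" using fc[OF f dM[OF x]] unfolding ix .
    have z: "f i x \<in> carrier (obj P k)" using fc[OF f x] unfolding ix .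
    have sy: "signed (obj P (k + 1)) n (f (i + 1) (diff M i x)) \<in> carrier (obj P (k + 1))"
      by (rule linear_map_closed[OF signed_linear[OF mP] y])
    show "Hom_cpx_post M q (n + 1) (diff (Hom_cpx R M P) n f) i x = diff (Hom_cpx R M N) n (Hom_cpx_post M q n f) i x"
      unfolding ev[OF x] Hom_cpx_diff[OF f x] Hom_cpx_diff[OF cl[OF f] x] ev[OF dM[OF x]] ix
        linear_map_diff[OF mP mN q dP[OF z] sy] signed_natural[OF mP mN q y] comm[OF z] ..
  qed
qed

subsection \<open>The complex R/J and homomorphisms from it\<close>

lemma concentrated_obj: "obj (concentrated X) n = (if n = 0 then X else X\<lparr>carrier := {\<zero>\<^bsub>X\<^esub>}\<rparr>)"
  by (simp add: concentrated_def Let_def)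

lemma concentrated_diff: "diff (concentrated X) n = (\<lambda>x\<in>carrier (obj (concentrated X) n). \<zero>\<^bsub>X\<^esub>)"
  by (simp add: concentrated_def Let_def)

lemma concentrated_module:
  assumes "module R X"
  shows "module R (obj (concentrated X) n)"
proof -
  interpret X: module R X by fact
  show ?thesis
    by (rule module_of_injection[OF assms, of "\<lambda>x. x"]) (auto simp: concentrated_obj split: if_splits)
qed

lemma concentrated_complex:
  assumes "module R X"
  shows "concentrated X \<in> complexes R"
proof -
  interpret X: module R X by fact
  note m = concentrated_module[OF assms]
  have z: "\<zero>\<^bsub>obj (concentrated X) n\<^esub> = \<zero>\<^bsub>X\<^esub>" "\<zero>\<^bsub>X\<^esub> \<in> carrier (obj (concentrated X) n)" for n
    by (auto simp: concentrated_obj)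
  have "diff (concentrated X) n \<in> mod_hom R (obj (concentrated X) n) (obj (concentrated X) (n + 1))" for n
    unfolding concentrated_diff
    by (rule restrict_mod_hom[OF m], rule linear_mapI) (auto simp: concentrated_obj)
  then show ?thesis
    using m by (auto simp: complexes_def z concentrated_diff)
qed

text \<open>The complex \<open>R/J\<close> vanishes outside degree \<open>0\<close>, so a family of maps out of it is determined by its
  component at \<open>0\<close>, and that component by its value at \<open>1\<close>. The correction term of the differential
  passes through the zero differential of \<open>R/J\<close>.\<close>

lemma Hom_quot_eval:
  assumes M: "M \<in> complexes R" and J: "ideal J R"
  defines "H \<equiv> Hom_cpx R (concentrated (quot_ring_mod R J)) M"
  shows Hom_quot_eval_linear: "linear_map R (obj H n) (obj M n) (\<lambda>f. f 0 (quot_one R J))"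
    and Hom_quot_eval_inj: "inj_on (\<lambda>f. f 0 (quot_one R J)) (carrier (obj H n))"
    and Hom_quot_eval_image: "(\<lambda>f. f 0 (quot_one R J)) ` carrier (obj H n) = annihilated_elements J (obj M n)"
    and Hom_quot_eval_diff: "f \<in> carrier (obj H n) \<Longrightarrow> diff H n f 0 (quot_one R J) = diff M n (f 0 (quot_one R J))"
    and Hom_quot_complex: "H \<in> complexes R"
proof -
  note mM = complexes_module[OF M]
  interpret M: module R "obj M d" for d by (rule mM)
  have R: "cring R" by (rule M.R.is_cring)
  let ?Q = "concentrated (quot_ring_mod R J)"
  note mX = quot_ring_mod_module[OF R J]
  note Q = concentrated_complex[OF mX]
  note mQ = complexes_module[OF Q]
  have Q0: "obj ?Q 0 = quot_ring_mod R J" by (simp add: concentrated_obj)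
  have Qi: "carrier (obj ?Q i) = {\<zero>\<^bsub>obj ?Q i\<^esub>}" if "i \<noteq> 0" for i using that by (simp add: concentrated_obj)
  have q1: "quot_one R J \<in> carrier (obj ?Q 0)" unfolding Q0 by (rule quot_one_closed[OF R J])
  have h: "f i \<in> mod_hom R (obj ?Q i) (obj M (i + n))" if "f \<in> carrier (obj H n)" for f i n
    using that unfolding H_def Hom_cpx_carrier by blast
  have h0: "f 0 \<in> mod_hom R (quot_ring_mod R J) (obj M n)" if "f \<in> carrier (obj H n)" for f n
    using h[OF that, of 0] by (simp add: Q0)
  show H: "H \<in> complexes R" unfolding H_def by (rule Hom_cpx_complex[OF Q M])
  show "linear_map R (obj H n) (obj M n) (\<lambda>f. f 0 (quot_one R J))"
    using mod_hom_closed[OF h0 quot_one_closed[OF R J]] Hom_cpx_ops[OF q1, where N = M and n = n]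
    unfolding H_def by (intro linear_mapI) simp_all
  show "inj_on (\<lambda>f. f 0 (quot_one R J)) (carrier (obj H n))"
  proof (rule inj_onI)
    fix f g assume f: "f \<in> carrier (obj H n)" and g: "g \<in> carrier (obj H n)"
      and eq: "f 0 (quot_one R J) = g 0 (quot_one R J)"
    have "f 0 = g 0" by (rule inj_onD[OF eval_one_inj[OF mM J] eq h0[OF f] h0[OF g]])
    moreover have "f i x = g i x" if "i \<noteq> 0" "x \<in> carrier (obj ?Q i)" for i x
      using that linear_map_zero[OF mQ mM mod_homD[OF h[OF f]]] linear_map_zero[OF mQ mM mod_homD[OF h[OF g]]]
      by (simp add: Qi)
    ultimately have "f i x = g i x" if "x \<in> carrier (obj ?Q i)" for i x using that by (cases "i = 0") auto
    then show "f = g" using f g unfolding H_def by (intro Hom_cpx_eqI)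
  qed
  show "(\<lambda>f. f 0 (quot_one R J)) ` carrier (obj H n) = annihilated_elements J (obj M n)"
  proof (intro equalityI subsetI)
    fix m assume "m \<in> (\<lambda>f. f 0 (quot_one R J)) ` carrier (obj H n)"
    then show "m \<in> annihilated_elements J (obj M n)"
      using h0 unfolding eval_one_image[OF mM J, symmetric] by blast
  next
    fix m assume "m \<in> annihilated_elements J (obj M n)"
    then obtain g where g: "g \<in> mod_hom R (quot_ring_mod R J) (obj M n)" "m = g (quot_one R J)"
      unfolding eval_one_image[OF mM J, symmetric] by blast
    define f where "f i = (if i = 0 then g else (\<lambda>x\<in>carrier (obj ?Q i). \<zero>\<^bsub>obj M (i + n)\<^esub>))" for i
    have "f i \<in> mod_hom R (obj ?Q i) (obj M (i + n))" for i
    proof (cases "i = 0")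
      case True
      then show ?thesis using g(1) by (simp add: f_def Q0)
    next
      case False
      have "linear_map R (obj ?Q i) (obj M (i + n)) (\<lambda>x. \<zero>\<^bsub>obj M (i + n)\<^esub>)" by (rule linear_mapI) auto
      then show ?thesis using False by (simp add: f_def restrict_mod_hom[OF mQ])
    qed
    then have "f \<in> carrier (obj H n)" unfolding H_def Hom_cpx_carrier by blast
    moreover have "f 0 (quot_one R J) = m" by (simp add: f_def g(2))
    ultimately show "m \<in> (\<lambda>f. f 0 (quot_one R J)) ` carrier (obj H n)" by blast
  qed
  assume f: "f \<in> carrier (obj H n)"
  have "diff ?Q 0 (quot_one R J) = \<zero>\<^bsub>obj ?Q (0 + 1)\<^esub>"
    using q1 by (simp add: concentrated_diff) (simp add: concentrated_obj)
  then have "f (0 + 1) (diff ?Q 0 (quot_one R J)) = \<zero>\<^bsub>obj M (n + 1)\<^esub>"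
    using linear_map_zero[OF mQ mM mod_homD[OF h[OF f]], of "0 + 1"] by (simp add: add.commute)
  moreover have "x \<ominus>\<^bsub>obj M (n + 1)\<^esub> signed (obj M (n + 1)) n \<zero>\<^bsub>obj M (n + 1)\<^esub> = x"
    if "x \<in> carrier (obj M (n + 1))" for x
  proof -
    have z: "\<ominus>\<^bsub>obj M (n + 1)\<^esub> \<zero>\<^bsub>obj M (n + 1)\<^esub> = \<zero>\<^bsub>obj M (n + 1)\<^esub>" by (rule M.M.minus_equality) simp_all
    show ?thesis using that by (simp add: a_minus_def signed_def z)
  qed
  moreover have "diff M n (f 0 (quot_one R J)) \<in> carrier (obj M (n + 1))"
    by (rule mod_hom_closed[OF complexes_diff[OF M] mod_hom_closed[OF h0[OF f] quot_one_closed[OF R J]]])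
  ultimately show "diff H n f 0 (quot_one R J) = diff M n (f 0 (quot_one R J))"
    using Hom_cpx_diff[OF f[unfolded H_def] q1] unfolding H_def by simp
qed

subsection \<open>The tensor complex of R/J with a complex\<close>

lemma tensor_mod_trivial:
  assumes "module R M" "module R N" "carrier M = {\<zero>\<^bsub>M\<^esub>}"
  shows "carrier (tensor_mod R M N) = {\<zero>\<^bsub>tensor_mod R M N\<^esub>}"
proof -
  note T = tensor_mod_module[OF assms(1,2)]
  interpret T: module R "tensor_mod R M N" by (rule T)
  have "carrier (tensor_mod R M N) \<subseteq> {x \<in> carrier (tensor_mod R M N). x = \<zero>\<^bsub>tensor_mod R M N\<^esub>}"
  proof (rule tensor_induct[OF assms(1,2)])
    have "linear_map R (tensor_mod R M N) (tensor_mod R M N) (\<lambda>x. x)" by (simp add: linear_map_def)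
    from kernel_submodule[OF T T this]
    show "submodule {x \<in> carrier (tensor_mod R M N). x = \<zero>\<^bsub>tensor_mod R M N\<^esub>} R (tensor_mod R M N)" .
    fix x y assume "x \<in> carrier M" "y \<in> carrier N"
    then show "pure_tensor R M N x y \<in> {x \<in> carrier (tensor_mod R M N). x = \<zero>\<^bsub>tensor_mod R M N\<^esub>}"
      using linear_map_zero[OF assms(1) T pure_tensor_left[OF assms(1,2)]] assms(3) by simp
  qed
  then show ?thesis using T.M.zero_closed by blast
qed

lemma dsum_mod_module:
  assumes "\<And>i. module R (F i)"
  shows "module R (dsum_mod F)"
proof -
  interpret F: module R "F i" for i by (rule assms)
  show ?thesis
  proof (rule module_of_injection[OF prod_mod_module[of R F, OF assms], of "\<lambda>x. x"])
    fix x y assume x: "x \<in> carrier (dsum_mod F)" and y: "y \<in> carrier (dsum_mod F)"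
    have "{i. x i \<oplus>\<^bsub>F i\<^esub> y i \<noteq> \<zero>\<^bsub>F i\<^esub>} \<subseteq> {i. x i \<noteq> \<zero>\<^bsub>F i\<^esub>} \<union> {i. y i \<noteq> \<zero>\<^bsub>F i\<^esub>}" by auto
    then have "finite {i. x i \<oplus>\<^bsub>F i\<^esub> y i \<noteq> \<zero>\<^bsub>F i\<^esub>}" using x y by (auto intro: finite_subset)
    then show "x \<oplus>\<^bsub>dsum_mod F\<^esub> y \<in> carrier (dsum_mod F) \<and> x \<oplus>\<^bsub>dsum_mod F\<^esub> y = x \<oplus>\<^bsub>prod_mod F\<^esub> y"
      using x y by simp
  next
    fix r x assume r: "r \<in> carrier R" and x: "x \<in> carrier (dsum_mod F)"
    have "{i. r \<odot>\<^bsub>F i\<^esub> x i \<noteq> \<zero>\<^bsub>F i\<^esub>} \<subseteq> {i. x i \<noteq> \<zero>\<^bsub>F i\<^esub>}" using r by auto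
    then have "finite {i. r \<odot>\<^bsub>F i\<^esub> x i \<noteq> \<zero>\<^bsub>F i\<^esub>}" using x by (auto intro: finite_subset)
    then show "r \<odot>\<^bsub>dsum_mod F\<^esub> x \<in> carrier (dsum_mod F) \<and> r \<odot>\<^bsub>dsum_mod F\<^esub> x = r \<odot>\<^bsub>prod_mod F\<^esub> x"
      using r x by simp
  qed auto
qed

text \<open>The summand indexed by \<open>i\<close> involves the degree \<open>i\<close> part of the complex \<open>R/J\<close>; only \<open>i = 0\<close> contributes,
  and there the sign of the differential is positive.\<close>

definition tensor_quot_proj :: "'a ring \<Rightarrow> 'a set \<Rightarrow> ('a, 'm) cpx \<Rightarrow> int \<Rightarrow> 'm \<Rightarrow> int \<Rightarrow> ('a set \<times> 'm \<Rightarrow> 'a) set" where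
  "tensor_quot_proj R J M n m = (\<lambda>i. if i = 0 then one_tensor R J (obj M n) m
     else \<zero>\<^bsub>tensor_mod R (obj (concentrated (quot_ring_mod R J)) i) (obj M (n - i))\<^esub>)"

lemma tensor_quot_proj_props:
  assumes M: "M \<in> complexes R" and J: "ideal J R"
  defines "T \<equiv> tensor_cpx R (concentrated (quot_ring_mod R J)) M"
  shows tensor_quot_proj_linear: "linear_map R (obj M n) (obj T n) (tensor_quot_proj R J M n)"
    and tensor_quot_proj_surj: "carrier (obj T n) = tensor_quot_proj R J M n ` carrier (obj M n)"
    and tensor_quot_proj_kernel: "\<lbrakk>x \<in> carrier (obj M n); y \<in> carrier (obj M n)\<rbrakk> \<Longrightarrow>
      tensor_quot_proj R J M n x = tensor_quot_proj R J M n y \<longleftrightarrow> x \<ominus>\<^bsub>obj M n\<^esub> y \<in> ideal_smult R J (obj M n)"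
    and tensor_quot_proj_diff: "x \<in> carrier (obj M n) \<Longrightarrow>
      diff T n (tensor_quot_proj R J M n x) = tensor_quot_proj R J M (n + 1) (diff M n x)"
    and tensor_quot_complex: "T \<in> complexes R"
proof -
  note mM = complexes_module[OF M]
  note dM = complexes_diff[OF M]
  interpret M: module R "obj M d" for d by (rule mM)
  have R: "cring R" by (rule M.R.is_cring)
  let ?Q = "concentrated (quot_ring_mod R J)"
  let ?t = "\<lambda>n i. tensor_mod R (obj ?Q i) (obj M (n - i))"
  note mX = quot_ring_mod_module[OF R J]
  note Q = concentrated_complex[OF mX]
  note mQ = complexes_module[OF Q]
  have Q0: "obj ?Q 0 = quot_ring_mod R J" by (simp add: concentrated_obj)
  have Qi: "carrier (obj ?Q i) = {\<zero>\<^bsub>obj ?Q i\<^esub>}" if "i \<noteq> 0" for i using that by (simp add: concentrated_obj)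
  have mt: "module R (?t n i)" for n i by (rule tensor_mod_module[OF mQ mM])
  interpret t: module R "?t d i" for d i by (rule mt)
  have obj: "obj T n = dsum_mod (?t n)" for n by (simp add: T_def tensor_cpx_def Let_def)
  have mT: "module R (obj T n)" for n unfolding obj by (rule dsum_mod_module[OF mt])
  have triv: "w = \<zero>\<^bsub>?t n i\<^esub>" if "i \<noteq> 0" "w \<in> carrier (?t n i)" for n i w
    using tensor_mod_trivial[OF mQ mM Qi[OF that(1)]] that(2) by blast
  let ?q = "tensor_quot_proj R J M"
  note one = one_tensor_linear[OF mM J]
  have t0: "tensor_mod R (quot_ring_mod R J) (obj M n) = ?t n 0" for n by (simp add: Q0)
  have qc: "?q n x i \<in> carrier (?t n i)" if "x \<in> carrier (obj M n)" for n x i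
    using linear_map_closed[OF one that] by (simp add: tensor_quot_proj_def t0)
  have qT: "?q n x \<in> carrier (obj T n)" if "x \<in> carrier (obj M n)" for n x
  proof -
    have "{i. ?q n x i \<noteq> \<zero>\<^bsub>?t n i\<^esub>} \<subseteq> {0}" by (auto simp: tensor_quot_proj_def)
    then show ?thesis using qc[OF that] by (auto simp: obj intro: finite_subset)
  qed
  show lin: "linear_map R (obj M n) (obj T n) (?q n)" for n
  proof (rule linear_mapI)
    fix x y assume "x \<in> carrier (obj M n)" "y \<in> carrier (obj M n)"
    then show "?q n (x \<oplus>\<^bsub>obj M n\<^esub> y) = ?q n x \<oplus>\<^bsub>obj T n\<^esub> ?q n y"
      using linear_map_add[OF one, of x n y] by (auto simp: tensor_quot_proj_def obj t0 fun_eq_iff)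
  next
    fix r x assume "r \<in> carrier R" "x \<in> carrier (obj M n)"
    then show "?q n (r \<odot>\<^bsub>obj M n\<^esub> x) = r \<odot>\<^bsub>obj T n\<^esub> ?q n x"
      using linear_map_smult[OF one, of r x n] by (auto simp: tensor_quot_proj_def obj t0 fun_eq_iff)
  qed (rule qT)
  show surj: "carrier (obj T n) = ?q n ` carrier (obj M n)" for n
  proof (intro equalityI subsetI)
    fix w assume "w \<in> carrier (obj T n)"
    then have w: "\<And>i. w i \<in> carrier (?t n i)" by (auto simp: obj)
    then obtain m where m: "m \<in> carrier (obj M n)" "w 0 = one_tensor R J (obj M n) m"
      using one_tensor_surj[OF mM J, of n] unfolding t0 by blast
    have "w i = ?q n m i" for i
      using triv[OF _ w] m(2) by (cases "i = 0") (auto simp: tensor_quot_proj_def)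
    then show "w \<in> ?q n ` carrier (obj M n)" using m(1) by (intro image_eqI[of _ _ m]) auto
  qed (use qT in auto)
  show "?q n x = ?q n y \<longleftrightarrow> x \<ominus>\<^bsub>obj M n\<^esub> y \<in> ideal_smult R J (obj M n)"
    if x: "x \<in> carrier (obj M n)" and y: "y \<in> carrier (obj M n)"
  proof -
    have "?q n x = ?q n y \<longleftrightarrow> one_tensor R J (obj M n) x = one_tensor R J (obj M n) y"
      by (auto simp: tensor_quot_proj_def fun_eq_iff)
    also have "\<dots> \<longleftrightarrow> x \<ominus>\<^bsub>obj M n\<^esub> y \<in> ideal_smult R J (obj M n)"
      by (rule one_tensor_eq_iff[OF mM J x y])
    finally show ?thesis .
  qed
  have "linear_map R (obj M d) (obj M d) id" for d by (rule linear_mapI) auto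
  note idM = this
  have "linear_map R (obj ?Q d) (obj ?Q d) id" for d
  proof -
    interpret Qd: module R "obj ?Q d" by (rule mQ)
    show ?thesis by (rule linear_mapI) auto
  qed
  note idQ = this
  show diff: "diff T n (?q n x) = ?q (n + 1) (diff M n x)" if x: "x \<in> carrier (obj M n)" for n x
  proof
    fix i
    let ?A = "tensor_map R (obj ?Q (i - 1)) (obj M (n + 1 - i)) (obj ?Q i) (obj M (n + 1 - i))
            (diff ?Q (i - 1)) id (?q n x (i - 1))"
    let ?B = "tensor_map R (obj ?Q i) (obj M (n - i)) (obj ?Q i) (obj M (n + 1 - i)) id (diff M (n - i)) (?q n x i)"
    have ix: "i - 1 + 1 = i" "n - (i - 1) = n + 1 - i" "n - i + 1 = n + 1 - i" by simp_all
    have dQ: "linear_map R (obj ?Q (i - 1)) (obj ?Q i) (diff ?Q (i - 1))"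
      using mod_homD[OF complexes_diff[OF Q, of "i - 1"]] unfolding ix .
    have dMi: "linear_map R (obj M (n - i)) (obj M (n + 1 - i)) (diff M (n - i))"
      using mod_homD[OF dM[of "n - i"]] unfolding ix .
    note hA = tensor_map_hom[OF mQ mM mQ mM dQ idM, of "n + 1 - i"]
    note hB = tensor_map_hom[OF mQ mM mQ mM idQ dMi]
    have A: "?A \<in> carrier (?t (n + 1) i)"
      using mod_hom_closed[OF hA, of "?q n x (i - 1)"] qc[OF x, of "i - 1"] unfolding ix by blast
    have B: "?B \<in> carrier (?t (n + 1) i)" by (rule mod_hom_closed[OF hB qc[OF x]])
    have D: "diff T n (?q n x) i = ?A \<oplus>\<^bsub>?t (n + 1) i\<^esub> signed (?t (n + 1) i) i ?B"
      using qT[OF x] by (simp add: T_def tensor_cpx_def Let_def)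
    show "diff T n (?q n x) i = ?q (n + 1) (diff M n x) i"
    proof (cases "i = 0")
      case False
      have "diff T n (?q n x) i \<in> carrier (?t (n + 1) i)"
        unfolding D using A linear_map_closed[OF signed_linear[OF mt] B] by simp
      then show ?thesis
        using triv[OF False] triv[OF False qc[OF mod_hom_closed[OF dM x]]] by metis
    next
      case True
      interpret t0: module R "tensor_mod R (obj ?Q 0) (obj M (n + 1))" by (rule tensor_mod_module[OF mQ mM])
      have "?A = \<zero>\<^bsub>?t (n + 1) i\<^esub>"
      proof -
        have "?q n x (i - 1) = \<zero>\<^bsub>?t n (i - 1)\<^esub>" using True by (simp add: tensor_quot_proj_def)
        then show ?thesis
          using linear_map_zero[OF tensor_mod_module[OF mQ mM] tensor_mod_module[OF mQ mM] mod_homD[OF hA]]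
          unfolding ix by simp
      qed
      moreover have "?B = one_tensor R J (obj M (n + 1)) (diff M n x)"
        using tensor_map_pure[OF mQ mM mQ mM idQ[of 0] dMi, where x = "quot_one R J" and y = x] x True
          quot_one_closed[OF R J]
        by (simp add: tensor_quot_proj_def one_tensor_def Q0)
      ultimately show ?thesis
        using D B True by (simp add: signed_def tensor_quot_proj_def)
    qed
  qed
  have "diff T n \<in> mod_hom R (obj T n) (obj T (n + 1))" for n
  proof (rule mod_homI)
    show "linear_map R (obj T n) (obj T (n + 1)) (diff T n)"
      by (rule linear_map_cancel_surjection[OF mM lin surj],
          rule linear_map_cong[OF mM linear_map_comp[OF mod_homD[OF dM] lin] diff])
    show "diff T n \<in> extensional (carrier (obj T n))"
      by (simp add: T_def tensor_cpx_def Let_def)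
  qed
  then show "T \<in> complexes R"
    by (rule complex_of_surjection[OF M mT _ lin surj diff])
qed

section \<open>Torsion and completion of complexes\<close>

lemma red_complexesD: "M \<in> red_complexes R I \<Longrightarrow> M \<in> complexes R" "M \<in> red_complexes R I \<Longrightarrow> reduced_mod R I (obj M n)"
  by (auto simp: red_complexes_def)

lemma cor_complexesD: "M \<in> cor_complexes R I \<Longrightarrow> M \<in> complexes R" "M \<in> cor_complexes R I \<Longrightarrow> coreduced_mod R I (obj M n)"
  by (auto simp: cor_complexes_def)

subsection \<open>Torsion\<close>

lemma Gamma_sel [simp]:
  "obj (Gamma R I M) n = tors_mod R I (obj M n)"
  "diff (Gamma R I M) n = tors_map R I (obj M n) (obj M (n + 1)) (diff M n)"
  by (simp_all add: Gamma_def)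

lemma Gamma_incl:
  assumes M: "M \<in> complexes R" and I: "ideal I R"
  shows Gamma_incl_linear: "linear_map R (obj (Gamma R I M) n) (obj M n) (tors_incl R I)"
    and Gamma_incl_inj: "inj_on (tors_incl R I) (carrier (obj (Gamma R I M) n))"
    and Gamma_incl_diff: "X \<in> carrier (obj (Gamma R I M) n) \<Longrightarrow>
      tors_incl R I (diff (Gamma R I M) n X) = diff M n (tors_incl R I X)"
    and Gamma_complex: "Gamma R I M \<in> complexes R"
proof -
  note mM = complexes_module[OF M] and dM = mod_homD[OF complexes_diff[OF M]]
  show lin: "linear_map R (obj (Gamma R I M) n) (obj M n) (tors_incl R I)" for n
    using tors_incl_linear[OF mM I] by simp
  show inj: "inj_on (tors_incl R I) (carrier (obj (Gamma R I M) n))" for n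
    using tors_incl_inj[OF mM I] by simp
  show comm: "tors_incl R I (diff (Gamma R I M) n X) = diff M n (tors_incl R I X)"
    if "X \<in> carrier (obj (Gamma R I M) n)" for n X
    using tors_incl_natural[OF mM mM I dM] that by simp
  show "Gamma R I M \<in> complexes R"
  proof (rule complex_of_injection[OF M _ _ lin inj comm])
    show "module R (obj (Gamma R I M) n)" for n using tors_mod_module[OF mM I] by simp
    show "diff (Gamma R I M) n \<in> mod_hom R (obj (Gamma R I M) n) (obj (Gamma R I M) (n + 1))" for n
      using tors_map_hom[OF mM mM I dM] by simp
  qed
qed

lemma Gamma_incl_image:
  assumes "M \<in> red_complexes R I" "ideal I R"
  shows "tors_incl R I ` carrier (obj (Gamma R I M) n) = annihilated_elements I (obj M n)"
  using tors_incl_image[OF complexes_module[OF red_complexesD(1)[OF assms(1)]] assms(2) red_complexesD(2)[OF assms(1)]]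
  by simp

lemma Gamma_annihilated:
  assumes "M \<in> red_complexes R I" "ideal I R"
  shows "carrier (obj (Gamma R I M) n) \<subseteq> annihilated_elements I (obj (Gamma R I M) n)"
  using tors_mod_annihilated[OF complexes_module[OF red_complexesD(1)[OF assms(1)]] assms(2) red_complexesD(2)[OF assms(1)]]
  by simp

lemma Gamma_coreduced:
  assumes "M \<in> red_complexes R I" "ideal I R"
  shows "Gamma R I M \<in> cor_complexes R I"
proof -
  note G = Gamma_complex[OF red_complexesD(1)[OF assms(1)] assms(2)]
  show ?thesis
    using G annihilated_imp_coreduced[OF complexes_module[OF G] assms(2) Gamma_annihilated[OF assms]]
    by (simp add: cor_complexes_def)
qed

lemma Gamma_reduced:
  assumes "M \<in> red_complexes R I" "ideal I R"
  shows "Gamma R I M \<in> red_complexes R I"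
  using Gamma_complex[OF red_complexesD(1)[OF assms(1)] assms(2)] annihilated_imp_reduced[OF Gamma_annihilated[OF assms]]
  by (simp add: red_complexes_def)

lemma Gamma_functor:
  assumes I: "ideal I R"
  shows "cpx_functor R (red_complexes R I) (cor_complexes R I) (Gamma R I) (Gamma_map R I)"
proof (rule cpx_functor_of_injection[where u = "\<lambda>M n. tors_incl R I"])
  fix M :: "('a, 'b) cpx" and n assume M: "M \<in> red_complexes R I"
  note M' = red_complexesD(1)[OF M]
  show "Gamma R I M \<in> cor_complexes R I" by (rule Gamma_coreduced[OF M I])
  show "inj_on (tors_incl R I) (carrier (obj (Gamma R I M) n))" by (rule Gamma_incl_inj[OF M' I])
  show "tors_incl R I X \<in> carrier (obj M n)" if "X \<in> carrier (obj (Gamma R I M) n)" for X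
    by (rule linear_map_closed[OF Gamma_incl_linear[OF M' I] that])
  show "tors_incl R I (diff (Gamma R I M) n X) = diff M n (tors_incl R I X)"
    if "X \<in> carrier (obj (Gamma R I M) n)" for X
    by (rule Gamma_incl_diff[OF M' I that])
next
  fix M N :: "('a, 'b) cpx" and f n
  assume M: "M \<in> red_complexes R I" and N: "N \<in> red_complexes R I"
    and f: "\<And>n. f n \<in> mod_hom R (obj M n) (obj N n)"
  note mM = complexes_module[OF red_complexesD(1)[OF M]] and mN = complexes_module[OF red_complexesD(1)[OF N]]
  show "Gamma_map R I M N f n \<in> mod_hom R (obj (Gamma R I M) n) (obj (Gamma R I N) n)"
    using tors_map_hom[OF mM mN I mod_homD[OF f]] by (simp add: Gamma_map_def)
  show "tors_incl R I (Gamma_map R I M N f n X) = f n (tors_incl R I X)"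
    if "X \<in> carrier (obj (Gamma R I M) n)" for X
    using tors_incl_natural[OF mM mN I mod_homD[OF f]] that by (simp add: Gamma_map_def)
qed (auto simp: red_complexes_def cor_complexes_def)

text \<open>All of \<open>\<Gamma>M\<close> is killed by \<open>I\<close>, so the inclusion of \<open>\<Gamma>\<Gamma>M\<close> in \<open>\<Gamma>M\<close> is surjective.\<close>

lemma Gamma_idempotent:
  assumes M: "M \<in> red_complexes R I" and I: "ideal I R"
  shows "cpx_iso R (Gamma R I (Gamma R I M)) (Gamma R I M)"
proof -
  note G = Gamma_complex[OF red_complexesD(1)[OF M] I]
  note GG = Gamma_complex[OF G I]
  interpret G: module R "obj (Gamma R I M) d" for d by (rule complexes_module[OF G])
  show ?thesis
  proof (rule cpx_iso_of_injections[where M = "Gamma R I M" and u = "\<lambda>n. tors_incl R I" and v = "\<lambda>n x. x"])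
    show "tors_incl R I ` carrier (obj (Gamma R I (Gamma R I M)) n) = (\<lambda>x. x) ` carrier (obj (Gamma R I M) n)" for n
      using Gamma_annihilated[OF M I, of n] unfolding Gamma_incl_image[OF Gamma_reduced[OF M I] I]
      by (auto simp: annihilated_elements_def)
  qed (rule G GG Gamma_incl_linear[OF G I] Gamma_incl_inj[OF G I] Gamma_incl_diff[OF G I]
      refl inj_on_id2 | assumption | simp add: linear_map_def)+
qed

lemma Gamma_iso_Hom:
  assumes M: "M \<in> red_complexes R I" and I: "ideal I R"
  shows "cpx_iso R (Gamma R I M) (Hom_cpx R (concentrated (quot_ring_mod R I)) M)"
proof -
  note M' = red_complexesD(1)[OF M]
  show ?thesis
    by (rule cpx_iso_of_injections[where M = M and u = "\<lambda>n. tors_incl R I" and v = "\<lambda>n f. f 0 (quot_one R I)",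
        OF Gamma_complex[OF M' I] Hom_quot_complex[OF M' I]
        Gamma_incl_linear[OF M' I] Gamma_incl_inj[OF M' I] Gamma_incl_diff[OF M' I]
        Hom_quot_eval_linear[OF M' I] Hom_quot_eval_inj[OF M' I] Hom_quot_eval_diff[OF M' I]])
      (simp_all only: Gamma_incl_image[OF M I] Hom_quot_eval_image[OF M' I])
qed

subsection \<open>Completion\<close>

lemma Lambda_sel [simp]:
  "obj (Lambda R I M) n = compl_mod R I (obj M n)"
  "diff (Lambda R I M) n = compl_map R I (obj M n) (obj M (n + 1)) (diff M n)"
  by (simp_all add: Lambda_def)

abbreviation Lambda_proj :: "'a ring \<Rightarrow> 'a set \<Rightarrow> ('a, 'm) cpx \<Rightarrow> int \<Rightarrow> 'm \<Rightarrow> nat \<Rightarrow> ('a set \<times> 'm \<Rightarrow> 'a) set" where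
  "Lambda_proj R I M n \<equiv> compl_proj R I (obj M n)"

lemma Lambda_proj_props:
  assumes M: "M \<in> cor_complexes R I" and I: "ideal I R"
  shows Lambda_proj_linear: "linear_map R (obj M n) (obj (Lambda R I M) n) (Lambda_proj R I M n)"
    and Lambda_proj_surj: "carrier (obj (Lambda R I M) n) = Lambda_proj R I M n ` carrier (obj M n)"
    and Lambda_proj_diff: "x \<in> carrier (obj M n) \<Longrightarrow>
      diff (Lambda R I M) n (Lambda_proj R I M n x) = Lambda_proj R I M (n + 1) (diff M n x)"
    and Lambda_complex: "Lambda R I M \<in> complexes R"
proof -
  note M' = cor_complexesD(1)[OF M] and c = cor_complexesD(2)[OF M]
  note mM = complexes_module[OF M'] and dM = mod_homD[OF complexes_diff[OF M']]
  show lin: "linear_map R (obj M n) (obj (Lambda R I M) n) (Lambda_proj R I M n)" for n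
    using compl_proj_linear[OF mM I c] by simp
  show surj: "carrier (obj (Lambda R I M) n) = Lambda_proj R I M n ` carrier (obj M n)" for n
    using compl_proj_surj[OF mM I c] by simp
  show comm: "diff (Lambda R I M) n (Lambda_proj R I M n x) = Lambda_proj R I M (n + 1) (diff M n x)"
    if "x \<in> carrier (obj M n)" for n x
    using compl_proj_natural[OF mM mM I c c dM that] by simp
  show "Lambda R I M \<in> complexes R"
  proof (rule complex_of_surjection[OF M' _ _ lin surj comm])
    show "module R (obj (Lambda R I M) n)" for n using compl_mod_module[OF mM I c] by simp
    show "diff (Lambda R I M) n \<in> mod_hom R (obj (Lambda R I M) n) (obj (Lambda R I M) (n + 1))" for n
      using compl_map_hom[OF mM mM I c c dM] by simp
  qed
qed

lemma Lambda_proj_kernel: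
  assumes "M \<in> cor_complexes R I" "ideal I R" "x \<in> carrier (obj M n)" "y \<in> carrier (obj M n)"
  shows "Lambda_proj R I M n x = Lambda_proj R I M n y \<longleftrightarrow> x \<ominus>\<^bsub>obj M n\<^esub> y \<in> ideal_smult R I (obj M n)"
  by (rule compl_proj_kernel[OF complexes_module[OF cor_complexesD(1)[OF assms(1)]] assms(2)
        cor_complexesD(2)[OF assms(1)] assms(3,4)])

lemma Lambda_annihilated:
  assumes "M \<in> cor_complexes R I" "ideal I R"
  shows "carrier (obj (Lambda R I M) n) \<subseteq> annihilated_elements I (obj (Lambda R I M) n)"
  using compl_mod_annihilated[OF complexes_module[OF cor_complexesD(1)[OF assms(1)]] assms(2) cor_complexesD(2)[OF assms(1)]]
  by simp

lemma Lambda_reduced: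
  assumes "M \<in> cor_complexes R I" "ideal I R"
  shows "Lambda R I M \<in> red_complexes R I"
  using Lambda_complex[OF assms] annihilated_imp_reduced[OF Lambda_annihilated[OF assms]]
  by (simp add: red_complexes_def)

lemma Lambda_coreduced:
  assumes "M \<in> cor_complexes R I" "ideal I R"
  shows "Lambda R I M \<in> cor_complexes R I"
proof -
  note L = Lambda_complex[OF assms]
  show ?thesis
    using L annihilated_imp_coreduced[OF complexes_module[OF L] assms(2) Lambda_annihilated[OF assms]]
    by (simp add: cor_complexes_def)
qed

lemma Lambda_functor:
  assumes I: "ideal I R"
  shows "cpx_functor R (cor_complexes R I) (red_complexes R I) (Lambda R I) (Lambda_map R I)"
proof (rule cpx_functor_of_surjection[where p = "Lambda_proj R I"])
  fix M :: "('a, 'b) cpx" and n assume M: "M \<in> cor_complexes R I"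
  show "Lambda R I M \<in> red_complexes R I" by (rule Lambda_reduced[OF M I])
  show "carrier (obj (Lambda R I M) n) = Lambda_proj R I M n ` carrier (obj M n)"
    by (rule Lambda_proj_surj[OF M I])
  show "diff (Lambda R I M) n (Lambda_proj R I M n x) = Lambda_proj R I M (n + 1) (diff M n x)"
    if "x \<in> carrier (obj M n)" for x
    by (rule Lambda_proj_diff[OF M I that])
next
  fix M N :: "('a, 'b) cpx" and f n
  assume M: "M \<in> cor_complexes R I" and N: "N \<in> cor_complexes R I"
    and f: "\<And>n. f n \<in> mod_hom R (obj M n) (obj N n)"
  note mM = complexes_module[OF cor_complexesD(1)[OF M]] and mN = complexes_module[OF cor_complexesD(1)[OF N]]
  note cM = cor_complexesD(2)[OF M] and cN = cor_complexesD(2)[OF N]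
  show "Lambda_map R I M N f n \<in> mod_hom R (obj (Lambda R I M) n) (obj (Lambda R I N) n)"
    using compl_map_hom[OF mM mN I cM cN mod_homD[OF f]] by (simp add: Lambda_map_def)
  show "Lambda_map R I M N f n (Lambda_proj R I M n x) = Lambda_proj R I N n (f n x)"
    if "x \<in> carrier (obj M n)" for x
    using compl_proj_natural[OF mM mN I cM cN mod_homD[OF f] that] by (simp add: Lambda_map_def)
qed (auto simp: red_complexes_def cor_complexes_def)

text \<open>The kernel of the projection from \<open>\<Lambda>M\<close> to \<open>\<Lambda>\<Lambda>M\<close> is \<open>I\<Lambda>M\<close>, which is zero.\<close>

lemma Lambda_idempotent:
  assumes M: "M \<in> cor_complexes R I" and I: "ideal I R"
  shows "cpx_iso R (Lambda R I (Lambda R I M)) (Lambda R I M)"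
proof -
  note L = Lambda_complex[OF M I] and Lc = Lambda_coreduced[OF M I]
  note LL = Lambda_complex[OF Lc I]
  note mL = complexes_module[OF L]
  interpret L: module R "obj (Lambda R I M) d" for d by (rule mL)
  have "Lambda_proj R I (Lambda R I M) n x = Lambda_proj R I (Lambda R I M) n y \<longleftrightarrow> x = y"
    if "x \<in> carrier (obj (Lambda R I M) n)" "y \<in> carrier (obj (Lambda R I M) n)" for n x y
    unfolding Lambda_proj_kernel[OF Lc I that]
      annihilated_imp_ideal_smult_zero[OF mL Lambda_annihilated[OF M I]]
    using module_diff_eq_zero_iff[OF mL that] by simp
  note ker = this
  have id: "linear_map R (obj (Lambda R I M) n) (obj (Lambda R I M) n) (\<lambda>x. x)" for n
    by (simp add: linear_map_def)
  show ?thesis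
    by (rule cpx_iso_of_surjections[where q = "\<lambda>n x. x", OF L LL L Lambda_proj_linear[OF Lc I] Lambda_proj_surj[OF Lc I]
          Lambda_proj_diff[OF Lc I] id image_ident[symmetric] refl ker])
qed

lemma Lambda_iso_tensor:
  assumes M: "M \<in> cor_complexes R I" and I: "ideal I R"
  shows "cpx_iso R (Lambda R I M) (tensor_cpx R (concentrated (quot_ring_mod R I)) M)"
proof -
  note M' = cor_complexesD(1)[OF M]
  show ?thesis
    by (rule cpx_iso_of_surjections[OF M' Lambda_complex[OF M I] tensor_quot_complex[OF M' I]
          Lambda_proj_linear[OF M I] Lambda_proj_surj[OF M I] Lambda_proj_diff[OF M I]
          tensor_quot_proj_linear[OF M' I] tensor_quot_proj_surj[OF M' I] tensor_quot_proj_diff[OF M' I]])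
      (simp_all only: Lambda_proj_kernel[OF M I] tensor_quot_proj_kernel[OF M' I])
qed

subsection \<open>Adjointness\<close>

text \<open>Hom complexes are products in each degree; this computes the image of a map that acts separately on
  each factor.\<close>

lemma image_of_products:
  assumes "\<And>i. F i ` A i = B i"
  shows "(\<lambda>f i. F i (f i)) ` {f. \<forall>i. f i \<in> A i} = {g. \<forall>i. g i \<in> B i}"
proof (intro equalityI subsetI)
  fix g assume "g \<in> {g. \<forall>i. g i \<in> B i}"
  then have "\<forall>i. \<exists>a. a \<in> A i \<and> g i = F i a" using assms by blast
  then obtain f where "\<And>i. f i \<in> A i \<and> g i = F i (f i)" by metis
  then show "g \<in> (\<lambda>f i. F i (f i)) ` {f. \<forall>i. f i \<in> A i}" by (intro image_eqI[of _ _ f]) auto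
qed (use assms in auto)

text \<open>Values of a map out of the completion are killed by \<open>I\<close> because the completion is. Conversely, a map
  whose values are killed by \<open>I\<close> vanishes on \<open>IM\<close>, hence descends.\<close>

lemma precompose_compl_proj_image:
  assumes M: "module R M" and N: "module R N" and I: "ideal I R" and c: "coreduced_mod R I M"
  shows "(\<lambda>h. compose (carrier M) h (compl_proj R I M)) ` mod_hom R (compl_mod R I M) N =
    {f \<in> mod_hom R M N. f ` carrier M \<subseteq> annihilated_elements I N}"
proof (intro equalityI subsetI)
  interpret N: module R N by (rule N)
  interpret M: module R M by (rule M)
  interpret I: ideal I R by (rule I)
  note p = compl_proj_linear[OF M I c] and surj = compl_proj_surj[OF M I c]
  note C = compl_mod_module[OF M I c]
  fix f assume "f \<in> (\<lambda>h. compose (carrier M) h (compl_proj R I M)) ` mod_hom R (compl_mod R I M) N"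
  then obtain h where h: "linear_map R (compl_mod R I M) N h" and f: "f = compose (carrier M) h (compl_proj R I M)"
    by (auto dest: mod_homD)
  have "f m \<in> annihilated_elements I N" if m: "m \<in> carrier M" for m
  proof -
    have pm: "compl_proj R I M m \<in> carrier (compl_mod R I M)" by (rule linear_map_closed[OF p m])
    have "x \<odot>\<^bsub>N\<^esub> h (compl_proj R I M m) = \<zero>\<^bsub>N\<^esub>" if x: "x \<in> I" for x
    proof -
      have "x \<odot>\<^bsub>compl_mod R I M\<^esub> compl_proj R I M m = \<zero>\<^bsub>compl_mod R I M\<^esub>"
        using compl_mod_annihilated[OF M I c] pm x by (auto simp: annihilated_elements_def)
      then show ?thesis
        using linear_map_smult[OF h _ pm, of x] linear_map_zero[OF C N h] x I.a_subset by auto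
    qed
    then show ?thesis
      using linear_map_closed[OF h pm] m by (simp add: f compose_def annihilated_elements_def)
  qed
  then show "f \<in> {f \<in> mod_hom R M N. f ` carrier M \<subseteq> annihilated_elements I N}"
    using compose_mod_hom[OF M p h] by (auto simp: f)
next
  interpret N: module R N by (rule N)
  interpret M: module R M by (rule M)
  interpret I: ideal I R by (rule I)
  note p = compl_proj_linear[OF M I c] and surj = compl_proj_surj[OF M I c]
  fix f assume "f \<in> {f \<in> mod_hom R M N. f ` carrier M \<subseteq> annihilated_elements I N}"
  then have fh: "f \<in> mod_hom R M N" and ann: "\<And>m. m \<in> carrier M \<Longrightarrow> f m \<in> annihilated_elements I N" by auto
  note f = mod_homD[OF fh]
  have kill: "ideal_smult R I M \<subseteq> {m \<in> carrier M. f m = \<zero>\<^bsub>N\<^esub>}"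
  proof (rule ideal_smult_least[OF kernel_submodule[OF M N f]])
    fix x m assume x: "x \<in> I" and m: "m \<in> carrier M"
    have xR: "x \<in> carrier R" using x I.a_subset by auto
    have "x \<odot>\<^bsub>N\<^esub> f m = \<zero>\<^bsub>N\<^esub>" using ann[OF m] x by (simp add: annihilated_elements_def)
    then show "x \<odot>\<^bsub>M\<^esub> m \<in> {m \<in> carrier M. f m = \<zero>\<^bsub>N\<^esub>}"
      using xR m linear_map_smult[OF f xR m] by simp
  qed
  obtain h where h: "h \<in> mod_hom R (compl_mod R I M) N" "\<And>x. x \<in> carrier M \<Longrightarrow> h (compl_proj R I M x) = f x"
  proof (rule descend_along_surjection[OF M p surj f])
    fix x y assume x: "x \<in> carrier M" and y: "y \<in> carrier M" and eq: "compl_proj R I M x = compl_proj R I M y"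
    have "x \<ominus>\<^bsub>M\<^esub> y \<in> ideal_smult R I M" using eq compl_proj_kernel[OF M I c x y] by simp
    then have "f x \<ominus>\<^bsub>N\<^esub> f y = \<zero>\<^bsub>N\<^esub>" using kill linear_map_diff[OF M N f x y] by auto
    then show "f x = f y"
      using module_diff_eq_zero_iff[OF N linear_map_closed[OF f x] linear_map_closed[OF f y]] by simp
  qed blast
  have "f = compose (carrier M) h (compl_proj R I M)"
    by (rule mod_hom_eqI[OF fh compose_mod_hom[OF M p mod_homD[OF h(1)]]]) (simp add: compose_def h(2))
  then show "f \<in> (\<lambda>h. compose (carrier M) h (compl_proj R I M)) ` mod_hom R (compl_mod R I M) N"
    using h(1) by blast
qed

text \<open>The torsion submodule of \<open>N\<close> consists of the elements killed by \<open>I\<close>, so a map with values there lifts,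
  and the lift is linear since the inclusion is injective.\<close>

lemma postcompose_tors_incl_image:
  assumes M: "module R M" and N: "module R N" and I: "ideal I R" and r: "reduced_mod R I N"
  shows "(\<lambda>h. compose (carrier M) (tors_incl R I) h) ` mod_hom R M (tors_mod R I N) =
    {f \<in> mod_hom R M N. f ` carrier M \<subseteq> annihilated_elements I N}"
proof (intro equalityI subsetI)
  note i = tors_incl_linear[OF N I] and img = tors_incl_image[OF N I r]
  fix f assume "f \<in> (\<lambda>h. compose (carrier M) (tors_incl R I) h) ` mod_hom R M (tors_mod R I N)"
  then obtain h where h: "h \<in> mod_hom R M (tors_mod R I N)" and f: "f = compose (carrier M) (tors_incl R I) h"
    by auto
  have "f m \<in> annihilated_elements I N" if "m \<in> carrier M" for m
    using mod_hom_closed[OF h that] that unfolding img[symmetric] by (simp add: f compose_def)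
  then show "f \<in> {f \<in> mod_hom R M N. f ` carrier M \<subseteq> annihilated_elements I N}"
    using compose_mod_hom[OF M mod_homD[OF h] i] by (auto simp: f)
next
  note i = tors_incl_linear[OF N I] and img = tors_incl_image[OF N I r]
  fix f assume "f \<in> {f \<in> mod_hom R M N. f ` carrier M \<subseteq> annihilated_elements I N}"
  then have fh: "f \<in> mod_hom R M N" and ann: "\<And>m. m \<in> carrier M \<Longrightarrow> f m \<in> annihilated_elements I N" by auto
  define h where "h = (\<lambda>m\<in>carrier M. inv_into (carrier (tors_mod R I N)) (tors_incl R I) (f m))"
  have hc: "h m \<in> carrier (tors_mod R I N)" and ih: "tors_incl R I (h m) = f m" if "m \<in> carrier M" for m
    using ann[OF that] that unfolding img[symmetric] h_def by (auto intro: inv_into_into f_inv_into_f)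
  have "linear_map R M (tors_mod R I N) h"
    by (rule linear_map_cancel_injection[OF M tors_mod_module[OF N I] i tors_incl_inj[OF N I] hc
          linear_map_cong[OF M mod_homD[OF fh] ih]])
  then have h: "h \<in> mod_hom R M (tors_mod R I N)" by (rule mod_homI) (simp add: h_def)
  have "f = compose (carrier M) (tors_incl R I) h"
    by (rule mod_hom_eqI[OF fh compose_mod_hom[OF M mod_homD[OF h] i]]) (simp add: compose_def ih)
  then show "f \<in> (\<lambda>h. compose (carrier M) (tors_incl R I) h) ` mod_hom R M (tors_mod R I N)"
    using h by blast
qed

text \<open>Both complexes embed in \<open>Hom(M, N)\<close>, and by the two preceding lemmas both images consist of the families
  whose values are killed by \<open>I\<close>.\<close>

lemma Hom_Lambda_iso_Hom_Gamma:
  assumes M: "M \<in> cor_complexes R I" and N: "N \<in> red_complexes R I" and I: "ideal I R"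
  shows "cpx_iso R (Hom_cpx R (Lambda R I M) N) (Hom_cpx R M (Gamma R I N))"
proof -
  note M' = cor_complexesD(1)[OF M] and c = cor_complexesD(2)[OF M]
  note N' = red_complexesD(1)[OF N] and r = red_complexesD(2)[OF N]
  note mM = complexes_module[OF M'] and mN = complexes_module[OF N']
  note L = Lambda_complex[OF M I] and G = Gamma_complex[OF N' I]
  let ?p = "Lambda_proj R I M" and ?i = "\<lambda>n::int. tors_incl R I"
  let ?HL = "Hom_cpx R (Lambda R I M) N" and ?HG = "Hom_cpx R M (Gamma R I N)"
  note pre = Hom_cpx_pre_linear[OF M' L N' Lambda_proj_linear[OF M I] Lambda_proj_diff[OF M I]]
    Hom_cpx_pre_diff[OF M' L N' Lambda_proj_linear[OF M I] Lambda_proj_diff[OF M I]]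
  note post = Hom_cpx_post_linear[OF M' G N' Gamma_incl_linear[OF N' I] Gamma_incl_diff[OF N' I]]
    Hom_cpx_post_diff[OF M' G N' Gamma_incl_linear[OF N' I] Gamma_incl_diff[OF N' I]]
  have inj_pre: "inj_on (Hom_cpx_pre M ?p) (carrier (obj ?HL n))" for n
  proof (rule inj_onI)
    fix f g assume f: "f \<in> carrier (obj ?HL n)" and g: "g \<in> carrier (obj ?HL n)"
      and eq: "Hom_cpx_pre M ?p f = Hom_cpx_pre M ?p g"
    show "f = g"
    proof (rule Hom_cpx_eqI[OF f g])
      fix i y assume "y \<in> carrier (obj (Lambda R I M) i)"
      then obtain x where x: "x \<in> carrier (obj M i)" "y = ?p i x" unfolding Lambda_proj_surj[OF M I] by blast
      have "Hom_cpx_pre M ?p f i x = Hom_cpx_pre M ?p g i x" using eq by simp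
      then show "f i y = g i y" using x by (simp add: Hom_cpx_pre_def compose_def)
    qed
  qed
  have inj_post: "inj_on (Hom_cpx_post M ?i n) (carrier (obj ?HG n))" for n
  proof (rule inj_onI)
    fix f g assume f: "f \<in> carrier (obj ?HG n)" and g: "g \<in> carrier (obj ?HG n)"
      and eq: "Hom_cpx_post M ?i n f = Hom_cpx_post M ?i n g"
    show "f = g"
    proof (rule Hom_cpx_eqI[OF f g])
      fix i x assume x: "x \<in> carrier (obj M i)"
      have "f i \<in> mod_hom R (obj M i) (obj (Gamma R I N) (i + n))" "g i \<in> mod_hom R (obj M i) (obj (Gamma R I N) (i + n))"
        using f g unfolding Hom_cpx_carrier by blast+
      note fgx = this[THEN mod_hom_closed, OF x]
      have "Hom_cpx_post M ?i n f i x = Hom_cpx_post M ?i n g i x" using eq by simp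
      then have "tors_incl R I (f i x) = tors_incl R I (g i x)" using x by (simp add: Hom_cpx_post_def compose_def)
      then show "f i x = g i x" by (rule inj_onD[OF Gamma_incl_inj[OF N' I] _ fgx])
    qed
  qed
  let ?B = "\<lambda>n i. {f \<in> mod_hom R (obj M i) (obj N (i + n)). f ` carrier (obj M i) \<subseteq> annihilated_elements I (obj N (i + n))}"
  have "Hom_cpx_pre M ?p ` carrier (obj ?HL n) = {g. \<forall>i. g i \<in> ?B n i}" for n
    using image_of_products[where B = "?B n", OF precompose_compl_proj_image[OF mM mN I c]]
    by (simp add: Hom_cpx_pre_def[abs_def] Hom_cpx_obj prod_mod_def)
  moreover have "Hom_cpx_post M ?i n ` carrier (obj ?HG n) = {g. \<forall>i. g i \<in> ?B n i}" for n
    using image_of_products[where B = "?B n", OF postcompose_tors_incl_image[OF mM mN I r]]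
    by (simp add: Hom_cpx_post_def[abs_def] Hom_cpx_obj prod_mod_def)
  ultimately have img: "Hom_cpx_pre M ?p ` carrier (obj ?HL n) = Hom_cpx_post M ?i n ` carrier (obj ?HG n)" for n
    by simp
  show ?thesis
    by (rule cpx_iso_of_injections[where u = "\<lambda>n. Hom_cpx_pre M ?p" and v = "Hom_cpx_post M ?i",
          OF Hom_cpx_complex[OF L N'] Hom_cpx_complex[OF M' G]
          pre(1) inj_pre pre(2) post(1) inj_post post(2) img])
qed

theorem theorem1p1:
  fixes A :: "'a ring" and \<aa> :: "'a set"
  assumes "cring A" and "ideal \<aa> A"
  shows
    "(cpx_functor A (red_complexes A \<aa> :: ('a, 'm) cpx set) (cor_complexes A \<aa>)
        (Gamma A \<aa>) (Gamma_map A \<aa>) \<and>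
      (\<forall>M \<in> (red_complexes A \<aa> :: ('a, 'm) cpx set).
        cpx_iso A (Gamma A \<aa> (Gamma A \<aa> M)) (Gamma A \<aa> M)) \<and>
      (\<forall>M \<in> (red_complexes A \<aa> :: ('a, 'm) cpx set).
        cpx_iso A (Gamma A \<aa> M) (Hom_cpx A (concentrated (quot_ring_mod A \<aa>)) M)))
     \<and>
     (cpx_functor A (cor_complexes A \<aa> :: ('a, 'm) cpx set) (red_complexes A \<aa>)
        (Lambda A \<aa>) (Lambda_map A \<aa>) \<and>
      (\<forall>M \<in> (cor_complexes A \<aa> :: ('a, 'm) cpx set).
        cpx_iso A (Lambda A \<aa> (Lambda A \<aa> M)) (Lambda A \<aa> M)) \<and>
      (\<forall>M \<in> (cor_complexes A \<aa> :: ('a, 'm) cpx set).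
        cpx_iso A (Lambda A \<aa> M) (tensor_cpx A (concentrated (quot_ring_mod A \<aa>)) M)))
     \<and>
     (\<forall>M \<in> (cor_complexes A \<aa> :: ('a, 'm) cpx set).
      \<forall>N \<in> (red_complexes A \<aa> :: ('a, 'n) cpx set).
        cpx_iso A (Hom_cpx A (Lambda A \<aa> M) N) (Hom_cpx A M (Gamma A \<aa> N)))"
  using Gamma_functor[OF assms(2)] Gamma_idempotent[OF _ assms(2)] Gamma_iso_Hom[OF _ assms(2)]
    Lambda_functor[OF assms(2)] Lambda_idempotent[OF _ assms(2)] Lambda_iso_tensor[OF _ assms(2)]
    Hom_Lambda_iso_Hom_Gamma[OF _ _ assms(2)]
  by (intro conjI ballI) assumption+

end
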